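(* For all $\mu,\nu\in\{-,0,+\}$ and $\tau\in\mathbb{R}$, the coaction $\gamma$ of $\mathrm{Pol}_q(\mu)$ on $B_{\mu\nu}^{\tau}$ is ergodic: if $x\in B_{\mu\nu}^\tau$ satisfies $\gamma(x)=x\otimes1$, then $x\in\mathbb{C}1$.
   Context: Fix a real number $0<q<1$ and put $\lambda=(q-q^{-1})^{-1}<0$. The symbols $-,0,+$ stand for the real numbers $-1,0,1$. For $\mu,\nu\in\mathbb{R}$, $U_q(\mu,\nu)$ is the universal unital algebra over $\mathbb{C}$ generated by $K,K^{-1},E,F$ (subscripted by $\mu\nu$ when needed) with relations $K^{-1}K=1=KK^{-1}$, $KE=qEK$, $KF=q^{-1}FK$, $[E,F]=\lambda(\mu K^2-\nu K^{-2})$, with $^*$-structure determined by $K^*=K$, $E^*=F$. Let $C_{\mu\nu}=EF+\lambda^2(q^{-1}\mu K^2+q\nu K^{-2})$, a central self-adjoint element, and $A_{\mu\nu}^\tau=U_q(\mu,\nu)/(C_{\mu\nu}-\tau q^{-1}\lambda^2 1)$ with quotient map $\pi_\tau$. $B_{\mu\nu}^\tau$ is the unital sub-$^*$-algebra of $A_{\mu\nu}^\tau$ generated by $\pi_\tau(K_{\mu\nu}^2)$ and $\pi_\tau(K_{\mu\nu}E_{\mu\nu})$. Put $X=q^{1/2}(q^{-1}-q)\pi_\tau(F_{\mu\nu}K_{\mu\nu})$ and $Z=\pi_\tau(K_{\mu\nu}^2)$; these generate $B_{\mu\nu}^\tau$ as a unital $^*$-algebra. $\mathrm{Pol}(SL_q(2,\mathbb{C}))$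 is the unital algebra generated by $a,b,c,d$ with relations $ab=qba$, $ac=qca$, $bd=qdb$, $cd=qdc$, $bc=cb$, $da-q^{-1}cb=1$, $ad-qbc=1$; it is a Hopf algebra with $\Delta(a)=a\otimes a+c\otimes b$, $\Delta(b)=b\otimes a+d\otimes b$, $\Delta(c)=a\otimes c+c\otimes d$, $\Delta(d)=b\otimes c+d\otimes d$. $\mathrm{Pol}_q(+)$ is this Hopf algebra with $^*$-structure $a^*=d$, $b^*=-q^{-1}c$, generators denoted $a_+,b_+$. $\mathrm{Pol}_q(-)$ is this Hopf algebra with $^*$-structure $a^*=d$, $b^*=q^{-1}c$, generators denoted $a_-,b_-$. $\mathrm{Pol}_q(0)$ is the universal unital $^*$-algebra generated by $a_0,b_0$ with $a_0^*a_0=1=a_0a_0^*$, $a_0b_0=qb_0a_0$, $a_0^*b_0=q^{-1}b_0a_0^*$, $b_0b_0^*=b_0^*b_0$, a Hopf $^*$-algebra with $\Delta_0(a_0)=a_0\otimes a_0$, $\Delta_0(b_0)=b_0\otimes a_0+a_0^*\otimes b_0$. $\gamma:B_{\mu\nu}^\tau\to B_{\mu\nu}^\tau\otimes\mathrm{Pol}_q(\mu)$ is the right coaction (a unital $^*$-homomorphism that is coassociative and counital; it exists and is unique) determined by \[\gamma(X)=-q\mu X^*\otimes b_\mu^2-q(1+q^2)\mu Z\otimes b_\mu a_\mu+X\otimes a_\mu^2+q\tau\,1\otimes b_\mu a_\mu,\] \[\gamma(Z)=X^*\otimes a_\mu^*b_\mu+Z\otimes(1-(1+q^2)\mu b_\mu^*b_\mu)+X\otimes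 b_\mu^*a_\mu+\tau\,1\otimes b_\mu^*b_\mu.\] *)

theory Defs
  imports Complex_Main "HOL-Library.Poly_Mapping" "HOL-Algebra.QuotRing" "HOL-Algebra.Module"
begin

section \<open>Unital complex star-algebras\<close>

text \<open>
  The algebras below depend on real parameters, so they are records with explicit carriers
  and not types. The type \<open>'b \<Rightarrow>\<^sub>0 complex\<close> of finitely supported functions is the complex
  vector space with basis \<open>'b\<close>.
\<close>

record 'a star_algebra = "(complex, 'a) module" +
  star :: "'a \<Rightarrow> 'a"

definition complex_algebra :: "complex star_algebra" where
  "complex_algebra =
    \<lparr>carrier = UNIV, mult = (*), one = 1, zero = 0, add = (+), smult = (*), star = cnj\<rparr>"

definition star_alg_hom ::
  "('a, 'm) star_algebra_scheme \<Rightarrow> ('b, 'n) star_algebra_scheme \<Rightarrow> ('a \<Rightarrow> 'b) \<Rightarrow> bool" where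
  "star_alg_hom A B f \<longleftrightarrow>
     f \<in> ring_hom A B \<and>
     (\<forall>c. \<forall>x\<in>carrier A. f (c \<odot>\<^bsub>A\<^esub> x) = c \<odot>\<^bsub>B\<^esub> f x) \<and>
     (\<forall>x\<in>carrier A. f (star A x) = star B (f x))"

definition star_subalgebra :: "'a set \<Rightarrow> ('a, 'm) star_algebra_scheme \<Rightarrow> bool" where
  "star_subalgebra S A \<longleftrightarrow>
     S \<subseteq> carrier A \<and> \<zero>\<^bsub>A\<^esub> \<in> S \<and> \<one>\<^bsub>A\<^esub> \<in> S \<and>
     (\<forall>x\<in>S. \<forall>y\<in>S. x \<oplus>\<^bsub>A\<^esub> y \<in> S \<and> x \<otimes>\<^bsub>A\<^esub> y \<in> S) \<and>
     (\<forall>c. \<forall>x\<in>S. c \<odot>\<^bsub>A\<^esub> x \<in> S) \<and>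
     (\<forall>x\<in>S. star A x \<in> S)"

definition generated_star_subalgebra ::
  "('a, 'm) star_algebra_scheme \<Rightarrow> 'a set \<Rightarrow> ('a, 'm) star_algebra_scheme" where
  "generated_star_subalgebra A G =
     A\<lparr>carrier := \<Inter>{S. star_subalgebra S A \<and> G \<subseteq> S}\<rparr>"

text \<open>
  \<open>I\<close> is a two-sided ideal (or, for the tensor product, a subspace that is one) stable under
  scalars and star, so that every union below is a single coset.
\<close>

definition quotient_algebra ::
  "('a, 'm) star_algebra_scheme \<Rightarrow> 'a set \<Rightarrow> 'a set star_algebra" where
  "quotient_algebra A I =
    \<lparr>carrier = carrier (A Quot I), mult = mult (A Quot I), one = one (A Quot I),
     zero = zero (A Quot I), add = add (A Quot I),
     smult = (\<lambda>c S. \<Union>x\<in>S. I +>\<^bsub>A\<^esub> (c \<odot>\<^bsub>A\<^esub> x)),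
     star = (\<lambda>S. \<Union>x\<in>S. I +>\<^bsub>A\<^esub> star A x)\<rparr>"

text \<open>
  The linear extension of a map given on basis elements, and the map that \<open>h\<close> induces on
  cosets on which it is constant.
\<close>

definition linear_ext ::
  "('v, 'm) star_algebra_scheme \<Rightarrow> ('b \<Rightarrow> 'v) \<Rightarrow> ('b \<Rightarrow>\<^sub>0 complex) \<Rightarrow> 'v" where
  "linear_ext V \<phi> f =
     finsum V (\<lambda>x. Poly_Mapping.lookup f x \<odot>\<^bsub>V\<^esub> \<phi> x) (Poly_Mapping.keys f)"

definition induced_map :: "('a \<Rightarrow> 'b) \<Rightarrow> 'a set \<Rightarrow> 'b" where
  "induced_map h S = the_elem (h ` S)"


section \<open>Monoid algebras, free algebras and presentations\<close>

definition scale :: "complex \<Rightarrow> ('b \<Rightarrow>\<^sub>0 complex) \<Rightarrow> ('b \<Rightarrow>\<^sub>0 complex)" where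
  "scale c f = Poly_Mapping.map ((*) c) f"

definition convolution ::
  "('b, 'm) monoid_scheme \<Rightarrow> ('b \<Rightarrow>\<^sub>0 complex) \<Rightarrow> ('b \<Rightarrow>\<^sub>0 complex) \<Rightarrow> ('b \<Rightarrow>\<^sub>0 complex)" where
  "convolution M f g =
     (\<Sum>x\<in>Poly_Mapping.keys f. \<Sum>y\<in>Poly_Mapping.keys g.
        Poly_Mapping.single (x \<otimes>\<^bsub>M\<^esub> y) (Poly_Mapping.lookup f x * Poly_Mapping.lookup g y))"

text \<open>The argument \<open>s\<close> gives the star of each basis element; it is extended antilinearly.\<close>

definition monoid_algebra ::
  "('b, 'm) monoid_scheme \<Rightarrow> ('b \<Rightarrow> ('b \<Rightarrow>\<^sub>0 complex)) \<Rightarrow> ('b \<Rightarrow>\<^sub>0 complex) star_algebra" where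
  "monoid_algebra M s =
    \<lparr>carrier = {f. Poly_Mapping.keys f \<subseteq> carrier M}, mult = convolution M,
     one = Poly_Mapping.single \<one>\<^bsub>M\<^esub> 1, zero = 0, add = (+), smult = scale,
     star = (\<lambda>f. \<Sum>x\<in>Poly_Mapping.keys f. scale (cnj (Poly_Mapping.lookup f x)) (s x))\<rparr>"

definition word_monoid :: "'g list monoid" where
  "word_monoid = \<lparr>carrier = UNIV, mult = (@), one = []\<rparr>"

text \<open>
  The free unital algebra on the letters \<open>'g\<close>; the star maps the letter \<open>g\<close> to \<open>\<sigma> g\<close> and
  reverses products.
\<close>

definition free_star_algebra ::
  "('g \<Rightarrow> ('g list \<Rightarrow>\<^sub>0 complex)) \<Rightarrow> ('g list \<Rightarrow>\<^sub>0 complex) star_algebra" where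
  "free_star_algebra \<sigma> =
     monoid_algebra word_monoid
       (\<lambda>w. foldr (\<lambda>g p. convolution word_monoid p (\<sigma> g)) w (Poly_Mapping.single [] 1))"

abbreviation wd :: "'g list \<Rightarrow> ('g list \<Rightarrow>\<^sub>0 complex)" where
  "wd w \<equiv> Poly_Mapping.single w 1"

definition presented_algebra ::
  "('g \<Rightarrow> ('g list \<Rightarrow>\<^sub>0 complex)) \<Rightarrow> ('g list \<Rightarrow>\<^sub>0 complex) set
    \<Rightarrow> ('g list \<Rightarrow>\<^sub>0 complex) set star_algebra" where
  "presented_algebra \<sigma> R =
     quotient_algebra (free_star_algebra \<sigma>) (Idl\<^bsub>free_star_algebra \<sigma>\<^esub> R)"

definition presented_gen ::
  "('g \<Rightarrow> ('g list \<Rightarrow>\<^sub>0 complex)) \<Rightarrow> ('g list \<Rightarrow>\<^sub>0 complex) set \<Rightarrow> 'g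
    \<Rightarrow> ('g list \<Rightarrow>\<^sub>0 complex) set" where
  "presented_gen \<sigma> R g =
     (Idl\<^bsub>free_star_algebra \<sigma>\<^esub> R) +>\<^bsub>free_star_algebra \<sigma>\<^esub> wd [g]"

text \<open>The unital algebra homomorphism from a presented algebra to \<open>V\<close> with generator images \<open>\<phi>\<close>.\<close>

definition presented_lift ::
  "('v, 'm) star_algebra_scheme \<Rightarrow> ('g \<Rightarrow> 'v) \<Rightarrow> ('g list \<Rightarrow>\<^sub>0 complex) set \<Rightarrow> 'v" where
  "presented_lift V \<phi> =
     induced_map (linear_ext V (\<lambda>w. foldr (\<lambda>g v. \<phi> g \<otimes>\<^bsub>V\<^esub> v) w \<one>\<^bsub>V\<^esub>))"


section \<open>Tensor products\<close>

text \<open>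
  The tensor product is the vector space with basis \<open>carrier A \<times> carrier B\<close> modulo the linear
  span of the bilinearity relators, with product and star determined by
  \<open>(a \<otimes> b)(a' \<otimes> b') = aa' \<otimes> bb'\<close> and \<open>(a \<otimes> b)\<^sup>* = a\<^sup>* \<otimes> b\<^sup>*\<close>.
\<close>

definition bilinearity_relators ::
  "('a, 'm) star_algebra_scheme \<Rightarrow> ('b, 'n) star_algebra_scheme \<Rightarrow> ('a \<times> 'b \<Rightarrow>\<^sub>0 complex) set" where
  "bilinearity_relators A B =
     {Poly_Mapping.single (a \<oplus>\<^bsub>A\<^esub> a', b) 1 - Poly_Mapping.single (a, b) 1
        - Poly_Mapping.single (a', b) 1 | a a' b.
        a \<in> carrier A \<and> a' \<in> carrier A \<and> b \<in> carrier B} \<union>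
     {Poly_Mapping.single (a, b \<oplus>\<^bsub>B\<^esub> b') 1 - Poly_Mapping.single (a, b) 1
        - Poly_Mapping.single (a, b') 1 | a b b'.
        a \<in> carrier A \<and> b \<in> carrier B \<and> b' \<in> carrier B} \<union>
     {Poly_Mapping.single (c \<odot>\<^bsub>A\<^esub> a, b) 1 - Poly_Mapping.single (a, b) c | c a b.
        a \<in> carrier A \<and> b \<in> carrier B} \<union>
     {Poly_Mapping.single (a, c \<odot>\<^bsub>B\<^esub> b) 1 - Poly_Mapping.single (a, b) c | c a b.
        a \<in> carrier A \<and> b \<in> carrier B}"

definition tensor_free ::
  "('a, 'm) star_algebra_scheme \<Rightarrow> ('b, 'n) star_algebra_scheme
    \<Rightarrow> ('a \<times> 'b \<Rightarrow>\<^sub>0 complex) star_algebra" where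
  "tensor_free A B =
     monoid_algebra (A \<times>\<times> B) (\<lambda>(a, b). Poly_Mapping.single (star A a, star B b) 1)"

definition tensor_null ::
  "('a, 'm) star_algebra_scheme \<Rightarrow> ('b, 'n) star_algebra_scheme \<Rightarrow> ('a \<times> 'b \<Rightarrow>\<^sub>0 complex) set" where
  "tensor_null A B = module.span scale (bilinearity_relators A B)"

definition tensor ::
  "('a, 'm) star_algebra_scheme \<Rightarrow> ('b, 'n) star_algebra_scheme
    \<Rightarrow> ('a \<times> 'b \<Rightarrow>\<^sub>0 complex) set star_algebra" where
  "tensor A B = quotient_algebra (tensor_free A B) (tensor_null A B)"

definition pure_tensor ::
  "('a, 'm) star_algebra_scheme \<Rightarrow> ('b, 'n) star_algebra_scheme \<Rightarrow> 'a \<Rightarrow> 'b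
    \<Rightarrow> ('a \<times> 'b \<Rightarrow>\<^sub>0 complex) set" where
  "pure_tensor A B a b =
     tensor_null A B +>\<^bsub>tensor_free A B\<^esub> Poly_Mapping.single (a, b) 1"

text \<open>The linear map on a tensor product given by a bilinear map \<open>\<phi>\<close> into \<open>V\<close>.\<close>

definition tensor_lift ::
  "('v, 'm) star_algebra_scheme \<Rightarrow> ('a \<Rightarrow> 'b \<Rightarrow> 'v) \<Rightarrow> ('a \<times> 'b \<Rightarrow>\<^sub>0 complex) set \<Rightarrow> 'v" where
  "tensor_lift V \<phi> = induced_map (linear_ext V (\<lambda>(a, b). \<phi> a b))"

text \<open>\<open>tensor_map C D f g\<close> is \<open>f \<otimes> g\<close>, with values in \<open>C \<otimes> D\<close>.\<close>

definition tensor_map ::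
  "('c, 'm) star_algebra_scheme \<Rightarrow> ('d, 'n) star_algebra_scheme \<Rightarrow> ('a \<Rightarrow> 'c) \<Rightarrow> ('b \<Rightarrow> 'd)
    \<Rightarrow> ('a \<times> 'b \<Rightarrow>\<^sub>0 complex) set \<Rightarrow> ('c \<times> 'd \<Rightarrow>\<^sub>0 complex) set" where
  "tensor_map C D f g = tensor_lift (tensor C D) (\<lambda>a b. pure_tensor C D (f a) (g b))"

definition tensor_assoc ::
  "('a, 'm) star_algebra_scheme \<Rightarrow> ('b, 'n) star_algebra_scheme \<Rightarrow> ('c, 'k) star_algebra_scheme
    \<Rightarrow> (('a \<times> 'b \<Rightarrow>\<^sub>0 complex) set \<times> 'c \<Rightarrow>\<^sub>0 complex) set
    \<Rightarrow> ('a \<times> ('b \<times> 'c \<Rightarrow>\<^sub>0 complex) set \<Rightarrow>\<^sub>0 complex) set" where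
  "tensor_assoc A B C =
     tensor_lift (tensor A (tensor B C))
       (\<lambda>t c. tensor_lift (tensor A (tensor B C))
          (\<lambda>a b. pure_tensor A (tensor B C) a (pure_tensor B C b c)) t)"

text \<open>
  Right coactions of a Hopf star-algebra with underlying algebra \<open>P\<close>, comultiplication \<open>\<Delta>\<close> and
  counit \<open>\<epsilon>\<close>.
\<close>

definition right_coaction ::
  "('a, 'm) star_algebra_scheme \<Rightarrow> ('p, 'n) star_algebra_scheme
    \<Rightarrow> ('p \<Rightarrow> ('p \<times> 'p \<Rightarrow>\<^sub>0 complex) set) \<Rightarrow> ('p \<Rightarrow> complex)
    \<Rightarrow> ('a \<Rightarrow> ('a \<times> 'p \<Rightarrow>\<^sub>0 complex) set) \<Rightarrow> bool" where
  "right_coaction B P \<Delta> \<epsilon> \<gamma> \<longleftrightarrow>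
     star_alg_hom B (tensor B P) \<gamma> \<and>
     (\<forall>x\<in>carrier B. tensor_assoc B P P (tensor_map (tensor B P) P \<gamma> id (\<gamma> x)) =
                    tensor_map B (tensor P P) id \<Delta> (\<gamma> x)) \<and>
     (\<forall>x\<in>carrier B. tensor_lift B (\<lambda>b p. \<epsilon> p \<odot>\<^bsub>B\<^esub> b) (\<gamma> x) = x)"

definition ergodic_coaction ::
  "('a, 'm) star_algebra_scheme \<Rightarrow> ('p, 'n) star_algebra_scheme
    \<Rightarrow> ('a \<Rightarrow> ('a \<times> 'p \<Rightarrow>\<^sub>0 complex) set) \<Rightarrow> bool" where
  "ergodic_coaction B P \<gamma> \<longleftrightarrow>
     (\<forall>x\<in>carrier B. \<gamma> x = pure_tensor B P x \<one>\<^bsub>P\<^esub> \<longrightarrow> (\<exists>c. x = c \<odot>\<^bsub>B\<^esub> \<one>\<^bsub>B\<^esub>))"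


section \<open>The algebras $U_q(\mu,\nu)$, $A_{\mu\nu}^\tau$ and $B_{\mu\nu}^\tau$\<close>

abbreviation cr :: "real \<Rightarrow> complex" where
  "cr \<equiv> complex_of_real"

definition lam :: "real \<Rightarrow> real" where
  "lam q = inverse (q - inverse q)"

datatype U_gen = UK | UKinv | UE | UF

fun U_star :: "U_gen \<Rightarrow> (U_gen list \<Rightarrow>\<^sub>0 complex)" where
  "U_star UK = wd [UK]"
| "U_star UKinv = wd [UKinv]"
| "U_star UE = wd [UF]"
| "U_star UF = wd [UE]"

definition U_relators :: "real \<Rightarrow> real \<Rightarrow> real \<Rightarrow> (U_gen list \<Rightarrow>\<^sub>0 complex) set" where
  "U_relators q \<mu> \<nu> =
     {wd [UKinv, UK] - wd [],
      wd [UK, UKinv] - wd [],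
      wd [UK, UE] - scale (cr q) (wd [UE, UK]),
      wd [UK, UF] - scale (cr (inverse q)) (wd [UF, UK]),
      (wd [UE, UF] - wd [UF, UE])
        - scale (cr (lam q))
            (scale (cr \<mu>) (wd [UK, UK]) - scale (cr \<nu>) (wd [UKinv, UKinv]))}"

definition Uq :: "real \<Rightarrow> real \<Rightarrow> real \<Rightarrow> (U_gen list \<Rightarrow>\<^sub>0 complex) set star_algebra" where
  "Uq q \<mu> \<nu> = presented_algebra U_star (U_relators q \<mu> \<nu>)"

definition Uq_gen :: "real \<Rightarrow> real \<Rightarrow> real \<Rightarrow> U_gen \<Rightarrow> (U_gen list \<Rightarrow>\<^sub>0 complex) set" where
  "Uq_gen q \<mu> \<nu> = presented_gen U_star (U_relators q \<mu> \<nu>)"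

definition Casimir :: "real \<Rightarrow> real \<Rightarrow> real \<Rightarrow> (U_gen list \<Rightarrow>\<^sub>0 complex) set" where
  "Casimir q \<mu> \<nu> =
     (let U = Uq q \<mu> \<nu>; K = Uq_gen q \<mu> \<nu> UK; Ki = Uq_gen q \<mu> \<nu> UKinv;
          E = Uq_gen q \<mu> \<nu> UE; F = Uq_gen q \<mu> \<nu> UF
      in (E \<otimes>\<^bsub>U\<^esub> F) \<oplus>\<^bsub>U\<^esub>
         (cr ((lam q)\<^sup>2) \<odot>\<^bsub>U\<^esub>
            ((cr (inverse q * \<mu>) \<odot>\<^bsub>U\<^esub> (K \<otimes>\<^bsub>U\<^esub> K)) \<oplus>\<^bsub>U\<^esub>
             (cr (q * \<nu>) \<odot>\<^bsub>U\<^esub> (Ki \<otimes>\<^bsub>U\<^esub> Ki)))))"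

definition A_ideal ::
  "real \<Rightarrow> real \<Rightarrow> real \<Rightarrow> real \<Rightarrow> (U_gen list \<Rightarrow>\<^sub>0 complex) set set" where
  "A_ideal q \<mu> \<nu> \<tau> =
     (let U = Uq q \<mu> \<nu> in
      Idl\<^bsub>U\<^esub> {Casimir q \<mu> \<nu> \<ominus>\<^bsub>U\<^esub> (cr (\<tau> * inverse q * (lam q)\<^sup>2) \<odot>\<^bsub>U\<^esub> \<one>\<^bsub>U\<^esub>)})"

definition A_alg ::
  "real \<Rightarrow> real \<Rightarrow> real \<Rightarrow> real \<Rightarrow> (U_gen list \<Rightarrow>\<^sub>0 complex) set set star_algebra" where
  "A_alg q \<mu> \<nu> \<tau> = quotient_algebra (Uq q \<mu> \<nu>) (A_ideal q \<mu> \<nu> \<tau>)"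

definition A_proj ::
  "real \<Rightarrow> real \<Rightarrow> real \<Rightarrow> real \<Rightarrow> (U_gen list \<Rightarrow>\<^sub>0 complex) set
    \<Rightarrow> (U_gen list \<Rightarrow>\<^sub>0 complex) set set" where
  "A_proj q \<mu> \<nu> \<tau> u = A_ideal q \<mu> \<nu> \<tau> +>\<^bsub>Uq q \<mu> \<nu>\<^esub> u"

definition B_alg ::
  "real \<Rightarrow> real \<Rightarrow> real \<Rightarrow> real \<Rightarrow> (U_gen list \<Rightarrow>\<^sub>0 complex) set set star_algebra" where
  "B_alg q \<mu> \<nu> \<tau> =
     (let U = Uq q \<mu> \<nu>; K = Uq_gen q \<mu> \<nu> UK; E = Uq_gen q \<mu> \<nu> UE
      in generated_star_subalgebra (A_alg q \<mu> \<nu> \<tau>)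
           {A_proj q \<mu> \<nu> \<tau> (K \<otimes>\<^bsub>U\<^esub> K), A_proj q \<mu> \<nu> \<tau> (K \<otimes>\<^bsub>U\<^esub> E)})"

definition B_X ::
  "real \<Rightarrow> real \<Rightarrow> real \<Rightarrow> real \<Rightarrow> (U_gen list \<Rightarrow>\<^sub>0 complex) set set" where
  "B_X q \<mu> \<nu> \<tau> =
     cr (sqrt q * (inverse q - q)) \<odot>\<^bsub>A_alg q \<mu> \<nu> \<tau>\<^esub>
       A_proj q \<mu> \<nu> \<tau> (Uq_gen q \<mu> \<nu> UF \<otimes>\<^bsub>Uq q \<mu> \<nu>\<^esub> Uq_gen q \<mu> \<nu> UK)"

definition B_Z ::
  "real \<Rightarrow> real \<Rightarrow> real \<Rightarrow> real \<Rightarrow> (U_gen list \<Rightarrow>\<^sub>0 complex) set set" where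
  "B_Z q \<mu> \<nu> \<tau> =
     A_proj q \<mu> \<nu> \<tau> (Uq_gen q \<mu> \<nu> UK \<otimes>\<^bsub>Uq q \<mu> \<nu>\<^esub> Uq_gen q \<mu> \<nu> UK)"


section \<open>The Hopf star-algebras $\mathrm{Pol}_q(\mu)$\<close>

text \<open>
  For \<open>\<mu> = \<plusminus>1\<close> the letters are the four generators $a,b,c,d$ of $\mathrm{Pol}(SL_q(2,\mathbb{C}))$.
  For \<open>\<mu> = 0\<close> the letters \<open>Pa\<close>, \<open>Pb\<close>, \<open>Pc\<close>, \<open>Pd\<close> are $a_0,b_0,b_0^*,a_0^*$, so that the free
  algebra on them is the free star-algebra on $a_0,b_0$.
\<close>

datatype P_gen = Pa | Pb | Pc | Pd

definition SL_relators :: "real \<Rightarrow> (P_gen list \<Rightarrow>\<^sub>0 complex) set" where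
  "SL_relators q =
     {wd [Pa, Pb] - scale (cr q) (wd [Pb, Pa]),
      wd [Pa, Pc] - scale (cr q) (wd [Pc, Pa]),
      wd [Pb, Pd] - scale (cr q) (wd [Pd, Pb]),
      wd [Pc, Pd] - scale (cr q) (wd [Pd, Pc]),
      wd [Pb, Pc] - wd [Pc, Pb],
      (wd [Pd, Pa] - scale (cr (inverse q)) (wd [Pc, Pb])) - wd [],
      (wd [Pa, Pd] - scale (cr q) (wd [Pb, Pc])) - wd []}"

text \<open>
  \<open>SL_star q \<mu>\<close> is used for \<open>\<mu> = \<plusminus>1\<close>: $b^* = -\mu q^{-1}c$, hence $c^* = -\mu q b$.
\<close>

fun SL_star :: "real \<Rightarrow> real \<Rightarrow> P_gen \<Rightarrow> (P_gen list \<Rightarrow>\<^sub>0 complex)" where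
  "SL_star q \<mu> Pa = wd [Pd]"
| "SL_star q \<mu> Pb = scale (cr (- \<mu> * inverse q)) (wd [Pc])"
| "SL_star q \<mu> Pc = scale (cr (- \<mu> * q)) (wd [Pb])"
| "SL_star q \<mu> Pd = wd [Pa]"

fun P0_star :: "P_gen \<Rightarrow> (P_gen list \<Rightarrow>\<^sub>0 complex)" where
  "P0_star Pa = wd [Pd]"
| "P0_star Pb = wd [Pc]"
| "P0_star Pc = wd [Pb]"
| "P0_star Pd = wd [Pa]"

definition P0_defining_relators :: "real \<Rightarrow> (P_gen list \<Rightarrow>\<^sub>0 complex) set" where
  "P0_defining_relators q =
     {wd [Pd, Pa] - wd [],
      wd [Pa, Pd] - wd [],
      wd [Pa, Pb] - scale (cr q) (wd [Pb, Pa]),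
      wd [Pd, Pb] - scale (cr (inverse q)) (wd [Pb, Pd]),
      wd [Pb, Pc] - wd [Pc, Pb]}"

text \<open>The universal star-algebra also satisfies the adjoints of the defining relations.\<close>

definition P0_relators :: "real \<Rightarrow> (P_gen list \<Rightarrow>\<^sub>0 complex) set" where
  "P0_relators q =
     P0_defining_relators q \<union> star (free_star_algebra P0_star) ` P0_defining_relators q"

definition P_star :: "real \<Rightarrow> real \<Rightarrow> P_gen \<Rightarrow> (P_gen list \<Rightarrow>\<^sub>0 complex)" where
  "P_star q \<mu> = (if \<mu> = 0 then P0_star else SL_star q \<mu>)"

definition P_relators :: "real \<Rightarrow> real \<Rightarrow> (P_gen list \<Rightarrow>\<^sub>0 complex) set" where
  "P_relators q \<mu> = (if \<mu> = 0 then P0_relators q else SL_relators q)"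

definition Polq :: "real \<Rightarrow> real \<Rightarrow> (P_gen list \<Rightarrow>\<^sub>0 complex) set star_algebra" where
  "Polq q \<mu> = presented_algebra (P_star q \<mu>) (P_relators q \<mu>)"

definition Polq_gen :: "real \<Rightarrow> real \<Rightarrow> P_gen \<Rightarrow> (P_gen list \<Rightarrow>\<^sub>0 complex) set" where
  "Polq_gen q \<mu> = presented_gen (P_star q \<mu>) (P_relators q \<mu>)"

fun SL_comult_gen ::
  "real \<Rightarrow> real \<Rightarrow> P_gen
    \<Rightarrow> ((P_gen list \<Rightarrow>\<^sub>0 complex) set \<times> (P_gen list \<Rightarrow>\<^sub>0 complex) set \<Rightarrow>\<^sub>0 complex) set" where
  "SL_comult_gen q \<mu> g =
     (let P = Polq q \<mu>; T = tensor P P; ten = pure_tensor P P;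
          a = Polq_gen q \<mu> Pa; b = Polq_gen q \<mu> Pb; c = Polq_gen q \<mu> Pc; d = Polq_gen q \<mu> Pd
      in case g of
           Pa \<Rightarrow> ten a a \<oplus>\<^bsub>T\<^esub> ten c b
         | Pb \<Rightarrow> ten b a \<oplus>\<^bsub>T\<^esub> ten d b
         | Pc \<Rightarrow> ten a c \<oplus>\<^bsub>T\<^esub> ten c d
         | Pd \<Rightarrow> ten b c \<oplus>\<^bsub>T\<^esub> ten d d)"

fun P0_comult_gen ::
  "real \<Rightarrow> P_gen
    \<Rightarrow> ((P_gen list \<Rightarrow>\<^sub>0 complex) set \<times> (P_gen list \<Rightarrow>\<^sub>0 complex) set \<Rightarrow>\<^sub>0 complex) set" where
  "P0_comult_gen q g =
     (let P = Polq q 0; T = tensor P P; ten = pure_tensor P P;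
          a = Polq_gen q 0 Pa; b = Polq_gen q 0 Pb;
          Da = ten a a; Db = ten b a \<oplus>\<^bsub>T\<^esub> ten (star P a) b
      in case g of Pa \<Rightarrow> Da | Pb \<Rightarrow> Db | Pc \<Rightarrow> star T Db | Pd \<Rightarrow> star T Da)"

definition Polq_comult ::
  "real \<Rightarrow> real \<Rightarrow> (P_gen list \<Rightarrow>\<^sub>0 complex) set
    \<Rightarrow> ((P_gen list \<Rightarrow>\<^sub>0 complex) set \<times> (P_gen list \<Rightarrow>\<^sub>0 complex) set \<Rightarrow>\<^sub>0 complex) set" where
  "Polq_comult q \<mu> =
     presented_lift (tensor (Polq q \<mu>) (Polq q \<mu>))
       (if \<mu> = 0 then P0_comult_gen q else SL_comult_gen q \<mu>)"

text \<open>
  The counit that belongs to these comultiplications: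
  $\varepsilon(a)=\varepsilon(d)=1$, $\varepsilon(b)=\varepsilon(c)=0$.
\<close>

definition Polq_counit :: "(P_gen list \<Rightarrow>\<^sub>0 complex) set \<Rightarrow> complex" where
  "Polq_counit = presented_lift complex_algebra (\<lambda>g. if g = Pa \<or> g = Pd then 1 else 0)"


section \<open>The prescribed values of the coaction\<close>

definition gamma_X ::
  "real \<Rightarrow> real \<Rightarrow> real \<Rightarrow> real
    \<Rightarrow> ((U_gen list \<Rightarrow>\<^sub>0 complex) set set \<times> (P_gen list \<Rightarrow>\<^sub>0 complex) set \<Rightarrow>\<^sub>0 complex) set" where
  "gamma_X q \<mu> \<nu> \<tau> =
     (let B = B_alg q \<mu> \<nu> \<tau>; P = Polq q \<mu>; T = tensor B P; ten = pure_tensor B P;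
          X = B_X q \<mu> \<nu> \<tau>; Z = B_Z q \<mu> \<nu> \<tau>;
          a = Polq_gen q \<mu> Pa; b = Polq_gen q \<mu> Pb
      in (cr (- q * \<mu>) \<odot>\<^bsub>T\<^esub> ten (star B X) (b \<otimes>\<^bsub>P\<^esub> b)) \<oplus>\<^bsub>T\<^esub>
         (cr (- q * (1 + q\<^sup>2) * \<mu>) \<odot>\<^bsub>T\<^esub> ten Z (b \<otimes>\<^bsub>P\<^esub> a)) \<oplus>\<^bsub>T\<^esub>
         ten X (a \<otimes>\<^bsub>P\<^esub> a) \<oplus>\<^bsub>T\<^esub>
         (cr (q * \<tau>) \<odot>\<^bsub>T\<^esub> ten \<one>\<^bsub>B\<^esub> (b \<otimes>\<^bsub>P\<^esub> a)))"

definition gamma_Z ::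
  "real \<Rightarrow> real \<Rightarrow> real \<Rightarrow> real
    \<Rightarrow> ((U_gen list \<Rightarrow>\<^sub>0 complex) set set \<times> (P_gen list \<Rightarrow>\<^sub>0 complex) set \<Rightarrow>\<^sub>0 complex) set" where
  "gamma_Z q \<mu> \<nu> \<tau> =
     (let B = B_alg q \<mu> \<nu> \<tau>; P = Polq q \<mu>; T = tensor B P; ten = pure_tensor B P;
          X = B_X q \<mu> \<nu> \<tau>; Z = B_Z q \<mu> \<nu> \<tau>;
          a = Polq_gen q \<mu> Pa; b = Polq_gen q \<mu> Pb
      in ten (star B X) (star P a \<otimes>\<^bsub>P\<^esub> b) \<oplus>\<^bsub>T\<^esub>
         ten Z (\<one>\<^bsub>P\<^esub> \<ominus>\<^bsub>P\<^esub> (cr ((1 + q\<^sup>2) * \<mu>) \<odot>\<^bsub>P\<^esub> (star P b \<otimes>\<^bsub>P\<^esub> b))) \<oplus>\<^bsub>T\<^esub>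
         ten X (star P b \<otimes>\<^bsub>P\<^esub> a) \<oplus>\<^bsub>T\<^esub>
         (cr \<tau> \<odot>\<^bsub>T\<^esub> ten \<one>\<^bsub>B\<^esub> (star P b \<otimes>\<^bsub>P\<^esub> b)))"

end

theory Submission
  imports Defs
begin

text \<open>
  $\mathrm{Pol}_q(\mu)$ has a two-dimensional upper triangular representation $\rho$ with $a
  \mapsto \mathrm{diag}(q,1)$, $b \mapsto e_{12}$, $c \mapsto 0$. For every weight representation
  $R$ of $A_{\mu\nu}^\tau$, in which $K$ is diagonal and $E$, $F$ are weighted shifts, the
  homomorphism $(R\otimes\rho)\circ\gamma$ and $x \mapsto R(x)\otimes 1$ are intertwined by one
  explicit operator $G$: the coaction becomes a conjugation. It suffices to check this on $X$,
  $X^*$ and $Z$. If $\gamma(x)=x\otimes 1$, then $R(x)\otimes 1$ commutes with $G$, that is,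
  $R(x)$ commutes with the diagonal operator $q^{-2n}$ and with a multiple of $X^*Z^{-1}$. The
  first forces $R(x)$ to be diagonal, the second forces its diagonal to be constant when all
  weights of $E$ are nonzero. Writing $x$ as a combination of the monomials $K^jE^m$, $K^jF^m$ and
  using one representation with $E$ a pure shift and one with $F$ a pure shift, all coefficients
  except that of $1$ vanish.
\<close>

section \<open>Linear functionals and monoid algebras\<close>

text \<open>Write X' for the adjoint of X. Under \<rho> the images of \<open>b b\<close> and of the
  adjoint of \<open>b\<close> vanish, so the image of \<gamma> is block upper triangular: Z gives
  diagonal Z, Z and corner X'/q; X' gives diagonal X'/q^2, X' and corner 0; X gives diagonal q^2 X,
  X and corner q (\<tau> - (1 + q^2) \<mu> Z). The entries of G solve the resulting equations. The
  diagonals ask for an operator that commutes with Z and commutes with X, X' up to powers of q^2: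
  this is Q. The corner of Z asks for Ze - eZ = X'/q, solved by e. The corner of X then reads q^2 Xe
  - eX = q (\<tau> - (1 + q^2) \<mu> Z), which is a form of the Casimir relation.

  R \<otimes> \<rho> is not a star representation, so X' is a separate check. In exchange the
  weights of E and F are constrained only through their products: no positivity enters, and either
  sequence can be made constant 1 for every \<nu> and \<tau>.

  The monomials are only shown to span A; the representations take the place of linear independence,
  since they separate the coefficients.\<close>

definition lin :: "('b \<Rightarrow> complex) \<Rightarrow> ('b \<Rightarrow>\<^sub>0 complex) \<Rightarrow> complex" where
  "lin \<phi> f = (\<Sum>x\<in>Poly_Mapping.keys f. Poly_Mapping.lookup f x * \<phi> x)"

lemma lin_superset:
  assumes "finite S" "Poly_Mapping.keys f \<subseteq> S"
  shows "lin \<phi> f = (\<Sum>x\<in>S. Poly_Mapping.lookup f x * \<phi> x)"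
  unfolding lin_def using assms
  by (intro sum.mono_neutral_left) (auto simp: in_keys_iff)

lemma lin_zero [simp]: "lin \<phi> 0 = 0"
  by (simp add: lin_def)

lemma lin_single [simp]: "lin \<phi> (Poly_Mapping.single x c) = c * \<phi> x"
  by (simp add: lin_def)

lemma lin_add [simp]: "lin \<phi> (f + g) = lin \<phi> f + lin \<phi> g"
proof -
  let ?S = "Poly_Mapping.keys f \<union> Poly_Mapping.keys g"
  have "lin \<phi> (f + g) = (\<Sum>x\<in>?S. Poly_Mapping.lookup (f + g) x * \<phi> x)"
    using Poly_Mapping.keys_add[of f g] by (intro lin_superset) auto
  then show ?thesis
    by (simp add: lookup_add distrib_right sum.distrib lin_superset[of ?S])
qed

lemma lookup_scale [simp]: "Poly_Mapping.lookup (scale c f) x = c * Poly_Mapping.lookup f x"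
  unfolding scale_def by (simp add: Poly_Mapping.map.rep_eq when_def)

lemma keys_scale: "Poly_Mapping.keys (scale c f) \<subseteq> Poly_Mapping.keys f"
  by (auto simp: in_keys_iff)

lemma lin_scale [simp]: "lin \<phi> (scale c f) = c * lin \<phi> f"
  by (subst lin_superset[OF _ keys_scale]) (simp_all add: lin_def sum_distrib_left mult.assoc)

lemma scale_uminus: "- f = scale (- 1) f"
  by (rule poly_mapping_eqI) simp

lemma lin_uminus [simp]: "lin \<phi> (- f) = - lin \<phi> f"
  by (simp add: scale_uminus)

lemma lin_diff [simp]: "lin \<phi> (f - g) = lin \<phi> f - lin \<phi> g"
  using lin_add[of \<phi> f "- g"] by simp

lemma lin_sum [simp]: "lin \<phi> (\<Sum>i\<in>S. F i) = (\<Sum>i\<in>S. lin \<phi> (F i))"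
  by (induction S rule: infinite_finite_induct) auto

lemma lin_cong:
  "(\<And>x. x \<in> Poly_Mapping.keys f \<Longrightarrow> \<phi> x = \<psi> x) \<Longrightarrow> lin \<phi> f = lin \<psi> f"
  by (simp add: lin_def)

lemma lin_fun_add: "lin (\<lambda>x. \<phi> x + \<psi> x) f = lin \<phi> f + lin \<psi> f"
  by (simp add: lin_def sum.distrib distrib_left)

lemma lin_fun_mult: "lin (\<lambda>x. c * \<phi> x) f = c * lin \<phi> f"
  by (simp add: lin_def sum_distrib_left mult_ac)

lemma lin_fun_zero [simp]: "lin (\<lambda>x. 0) f = 0"
  by (simp add: lin_def)

lemma lin_fun_zero_prod [simp]: "lin (\<lambda>(i, j). 0) f = 0"
  by (simp add: lin_def case_prod_beta)

lemma lin_fun_sum: "lin (\<lambda>x. \<Sum>i\<in>S. F i x) f = (\<Sum>i\<in>S. lin (F i) f)"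
  by (induction S rule: infinite_finite_induct) (auto simp: lin_fun_add)

lemma lin_swap: "lin (\<lambda>x. lin (\<lambda>y. F x y) g) f = lin (\<lambda>y. lin (\<lambda>x. F x y) f) g"
  unfolding lin_def[of _ g] lin_fun_sum lin_fun_mult ..

text \<open>Linear functionals separate points. Most identities in the free algebras below go
  through this rule: testing with \<open>lin \<phi>\<close> turns \<open>scale\<close>,
  \<open>convolution\<close> and the star into arithmetic of complex numbers.\<close>

lemma lin_eqI:
  fixes f g :: "'b \<Rightarrow>\<^sub>0 complex"
  assumes "\<And>\<phi>. lin \<phi> f = lin \<phi> g"
  shows "f = g"
proof (rule poly_mapping_eqI)
  fix k
  have "lin (\<lambda>x. if x = k then 1 else 0) h = Poly_Mapping.lookup h k" for h :: "'b \<Rightarrow>\<^sub>0 complex"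
  proof -
    have "lin (\<lambda>x. if x = k then 1 else 0) h
        = (\<Sum>x\<in>Poly_Mapping.keys h. if k = x then Poly_Mapping.lookup h x else 0)"
      unfolding lin_def by (rule sum.cong) auto
    also have "\<dots> = Poly_Mapping.lookup h k"
      by (simp add: in_keys_iff)
    finally show ?thesis .
  qed
  then show "Poly_Mapping.lookup f k = Poly_Mapping.lookup g k"
    using assms by metis
qed

lemma vector_space_scale: "vector_space (scale :: complex \<Rightarrow> ('b \<Rightarrow>\<^sub>0 complex) \<Rightarrow> _)"
  by unfold_locales (rule lin_eqI, simp add: algebra_simps)+

lemma scale_single [simp]:
  "scale c (Poly_Mapping.single x d) = Poly_Mapping.single x (c * d)"
  by (rule lin_eqI) simp

lemma sum_single_keys:
  fixes f :: "'b \<Rightarrow>\<^sub>0 complex"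
  shows "(\<Sum>x\<in>Poly_Mapping.keys f. Poly_Mapping.single x (Poly_Mapping.lookup f x)) = f"
  by (rule lin_eqI) (simp add: lin_def[of _ f])

lemma poly_mapping_span_induct [consumes 1, case_names single add]:
  fixes f :: "'b \<Rightarrow>\<^sub>0 complex"
  assumes "Poly_Mapping.keys f \<subseteq> S"
    and single: "\<And>x c. x \<in> S \<Longrightarrow> P (Poly_Mapping.single x c)"
    and add: "\<And>g h. Poly_Mapping.keys g \<subseteq> S \<Longrightarrow> Poly_Mapping.keys h \<subseteq> S \<Longrightarrow> P g \<Longrightarrow> P h \<Longrightarrow> P (g + h)"
    and zero: "P 0"
  shows "P f"
proof -
  \<comment> \<open>The bound on the keys is carried through the induction because
    \<open>add\<close> asks for it of both summands.\<close>
  have "P (\<Sum>x\<in>T. Poly_Mapping.single x (Poly_Mapping.lookup f x)) \<and>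
      Poly_Mapping.keys (\<Sum>x\<in>T. Poly_Mapping.single x (Poly_Mapping.lookup f x)) \<subseteq> S"
    if "finite T" "T \<subseteq> S" for T
    using that
  proof (induction T)
    case (insert t T)
    then have "P (Poly_Mapping.single t (Poly_Mapping.lookup f t))"
      "Poly_Mapping.keys (Poly_Mapping.single t (Poly_Mapping.lookup f t)) \<subseteq> S"
      by (auto intro: single split: if_splits)
    with insert show ?case
      by (auto intro!: add dest!: subsetD[OF Poly_Mapping.keys_add])
  qed (simp add: zero)
  from this[OF finite_keys assms(1)] show ?thesis
    by (simp add: sum_single_keys)
qed

lemma lin_convolution [simp]:
  "lin \<phi> (convolution M f g) = lin (\<lambda>x. lin (\<lambda>y. \<phi> (x \<otimes>\<^bsub>M\<^esub> y)) g) f"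
  unfolding convolution_def
  by (simp add: lin_def[of _ f] lin_def[of _ g] sum_distrib_left mult.assoc)

lemma keys_convolution:
  "Poly_Mapping.keys (convolution M f g) \<subseteq>
     {x \<otimes>\<^bsub>M\<^esub> y | x y. x \<in> Poly_Mapping.keys f \<and> y \<in> Poly_Mapping.keys g}"
  unfolding convolution_def
  by (rule order_trans[OF Poly_Mapping.keys_sum] UN_least)+ (auto split: if_splits)

section \<open>Star algebras and their quotients\<close>

locale star_alg = ring A for A :: "('a, 'm) star_algebra_scheme" (structure) +
  assumes smult_closed [simp, intro]: "x \<in> carrier A \<Longrightarrow> c \<odot> x \<in> carrier A"
    and smult_add_right: "x \<in> carrier A \<Longrightarrow> y \<in> carrier A \<Longrightarrow> c \<odot> (x \<oplus> y) = c \<odot> x \<oplus> c \<odot> y"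
    and smult_add_left: "x \<in> carrier A \<Longrightarrow> (c + d) \<odot> x = c \<odot> x \<oplus> d \<odot> x"
    and smult_smult: "x \<in> carrier A \<Longrightarrow> c \<odot> (d \<odot> x) = (c * d) \<odot> x"
    and smult_one_left [simp]: "x \<in> carrier A \<Longrightarrow> 1 \<odot> x = x"
    and smult_mult_left: "x \<in> carrier A \<Longrightarrow> y \<in> carrier A \<Longrightarrow> (c \<odot> x) \<otimes> y = c \<odot> (x \<otimes> y)"
    and smult_mult_right: "x \<in> carrier A \<Longrightarrow> y \<in> carrier A \<Longrightarrow> x \<otimes> (c \<odot> y) = c \<odot> (x \<otimes> y)"
    and star_closed [simp, intro]: "x \<in> carrier A \<Longrightarrow> star A x \<in> carrier A"
    and star_add: "x \<in> carrier A \<Longrightarrow> y \<in> carrier A \<Longrightarrow> star A (x \<oplus> y) = star A x \<oplus> star A y"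
    and star_smult: "x \<in> carrier A \<Longrightarrow> star A (c \<odot> x) = cnj c \<odot> star A x"
    and star_mult: "x \<in> carrier A \<Longrightarrow> y \<in> carrier A \<Longrightarrow> star A (x \<otimes> y) = star A y \<otimes> star A x"
    and star_star [simp]: "x \<in> carrier A \<Longrightarrow> star A (star A x) = x"

lemma carrier_free [simp]: "carrier (free_star_algebra \<sigma>) = UNIV"
  and mult_free [simp]: "mult (free_star_algebra \<sigma>) = convolution word_monoid"
  and one_free [simp]: "one (free_star_algebra \<sigma>) = wd []"
  and zero_free [simp]: "zero (free_star_algebra \<sigma>) = 0"
  and add_free [simp]: "add (free_star_algebra \<sigma>) = (+)"
  and smult_free [simp]: "module.smult (free_star_algebra \<sigma>) = scale"
  by (simp_all add: free_star_algebra_def monoid_algebra_def word_monoid_def)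

lemma mult_word_monoid [simp]: "mult word_monoid = (@)"
  by (simp add: word_monoid_def)

lemma convolution_single [simp]:
  "convolution M (Poly_Mapping.single x c) (Poly_Mapping.single y d) =
    Poly_Mapping.single (x \<otimes>\<^bsub>M\<^esub> y) (c * d)"
  by (rule lin_eqI) simp

lemma ring_free: "ring (free_star_algebra \<sigma>)"
proof (rule ringI)
  show "abelian_group (free_star_algebra \<sigma>)"
    by (rule abelian_groupI) (auto simp: add_ac intro: exI[of _ "- x" for x])
  show "Group.monoid (free_star_algebra \<sigma>)"
    by (rule Group.monoidI) (auto intro!: lin_eqI)
qed (auto intro!: lin_eqI simp: lin_fun_add)

abbreviation word_star :: "('g \<Rightarrow> ('g list \<Rightarrow>\<^sub>0 complex)) \<Rightarrow> 'g list \<Rightarrow> ('g list \<Rightarrow>\<^sub>0 complex)" where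
  "word_star \<sigma> w \<equiv> foldr (\<lambda>g p. convolution word_monoid p (\<sigma> g)) w (wd [])"

lemma star_free: 
  "star (free_star_algebra \<sigma>) f =
    (\<Sum>x\<in>Poly_Mapping.keys f. scale (cnj (Poly_Mapping.lookup f x)) (word_star \<sigma> x))"
  by (simp add: free_star_algebra_def monoid_algebra_def)

lemma lin_star_free:
  "lin \<phi> (star (free_star_algebra \<sigma>) f) = cnj (lin (\<lambda>x. cnj (lin \<phi> (word_star \<sigma> x))) f)"
  by (simp add: star_free lin_def[of _ f] sum_distrib_left)

lemma word_star_append:
  "word_star \<sigma> (u @ v) = convolution word_monoid (word_star \<sigma> v) (word_star \<sigma> u)"
proof (induction u)
  case Nil
  then show ?case by (auto intro!: lin_eqI)
next
  case (Cons g u)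
  interpret ring "free_star_algebra \<sigma>" by (rule ring_free)
  show ?case using Cons m_assoc by simp
qed

lemma star_free_single [simp]:
  "star (free_star_algebra \<sigma>) (Poly_Mapping.single x c) = scale (cnj c) (word_star \<sigma> x)"
  by (rule lin_eqI) (simp add: lin_star_free)

lemma star_free_add [simp]:
  "star (free_star_algebra \<sigma>) (f + g) = star (free_star_algebra \<sigma>) f + star (free_star_algebra \<sigma>) g"
  by (rule lin_eqI) (simp add: lin_star_free)

lemma star_free_scale [simp]:
  "star (free_star_algebra \<sigma>) (scale c f) = scale (cnj c) (star (free_star_algebra \<sigma>) f)"
  by (rule lin_eqI) (simp add: lin_star_free)

lemma star_free_diff [simp]:
  "star (free_star_algebra \<sigma>) (f - g) = star (free_star_algebra \<sigma>) f - star (free_star_algebra \<sigma>) g"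
  by (rule lin_eqI) (simp add: lin_star_free)

lemma star_free_zero [simp]: "star (free_star_algebra \<sigma>) 0 = 0"
  by (rule lin_eqI) (simp add: lin_star_free)

lemma star_free_mult:
  "star (free_star_algebra \<sigma>) (convolution word_monoid f g) =
    convolution word_monoid (star (free_star_algebra \<sigma>) g) (star (free_star_algebra \<sigma>) f)"
proof -
  \<comment> \<open>Both sides of the claim are additive in each argument, so two nested inductions
    reduce it to a pair of scaled words.\<close>
  have eq: "P f g" if "\<And>x y c d. P (Poly_Mapping.single x c) (Poly_Mapping.single y d)"
    "\<And>f f' g. P f g \<Longrightarrow> P f' g \<Longrightarrow> P (f + f') g" "\<And>f g g'. P f g \<Longrightarrow> P f g' \<Longrightarrow> P f (g + g')"
    "\<And>g. P 0 g" "\<And>f. P f 0"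
    for P :: "('a list \<Rightarrow>\<^sub>0 complex) \<Rightarrow> ('a list \<Rightarrow>\<^sub>0 complex) \<Rightarrow> bool"
  proof (rule poly_mapping_span_induct[OF subset_UNIV, of _ f])
    fix x c
    show "P (Poly_Mapping.single x c) g"
      by (rule poly_mapping_span_induct[OF subset_UNIV, of _ g]) (use that in auto)
  qed (use that in auto)
  interpret ring "free_star_algebra \<sigma>" by (rule ring_free)
  show ?thesis
  proof (rule eq)
    fix x y :: "'a list" and c d
    show "star (free_star_algebra \<sigma>)
            (convolution word_monoid (Poly_Mapping.single x c) (Poly_Mapping.single y d)) =
          convolution word_monoid (star (free_star_algebra \<sigma>) (Poly_Mapping.single y d))
            (star (free_star_algebra \<sigma>) (Poly_Mapping.single x c))"
      by (rule lin_eqI) (simp add: word_star_append lin_fun_mult del: foldr_append)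
  qed (use l_distr r_distr l_null r_null in auto)
qed

text \<open>By \<open>star_free_mult\<close> the star reverses products, so it suffices to test on
  letters that it is an involution; the property then spreads to words and to linear
  combinations.\<close>

lemma star_alg_free:
  assumes "\<And>g. star (free_star_algebra \<sigma>) (\<sigma> g) = wd [g]"
  shows "star_alg (free_star_algebra \<sigma>)"
proof -
  interpret ring "free_star_algebra \<sigma>" by (rule ring_free)
  have word: "star (free_star_algebra \<sigma>) (word_star \<sigma> w) = wd w" for w
    by (induction w) (simp_all add: star_free_mult assms)
  have "star (free_star_algebra \<sigma>) (star (free_star_algebra \<sigma>) f) = f" for f
    by (rule poly_mapping_span_induct[OF subset_UNIV, of _ f]) (simp_all add: word)
  then show ?thesis
    by unfold_locales
      (auto intro!: lin_eqI simp: star_free_mult lin_fun_mult distrib_right distrib_left)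
qed

context star_alg
begin

text \<open>Ideals are taken in the ring sense. They are subspaces because scaling by
  \<open>c\<close> is multiplication by the element \<open>c \<odot> \<one>\<close>.\<close>

lemma smult_in_ideal:
  assumes "ideal I A" "x \<in> I"
  shows "c \<odot> x \<in> I"
proof -
  interpret ideal I A by fact
  have "x \<in> carrier A" using a_subset assms(2) by blast
  then have "c \<odot> x = (c \<odot> \<one>) \<otimes> x" by (simp add: smult_mult_left)
  then show ?thesis using I_l_closed[OF assms(2)] by simp
qed

lemma coset_add_ideal:
  assumes "ideal I A" "i \<in> I" "x \<in> carrier A"
  shows "I +> (i \<oplus> x) = I +> x"
proof -
  interpret ideal I A by fact
  have "i \<oplus> x \<in> I +> x" using assms by (auto simp: a_r_coset_def')
  from a_repr_independence[OF this assms(3) a_subgroup] show ?thesis by simp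
qed

text \<open>In the quotient, scalar action and star are unions over all representatives. Two
  representatives differ by an element of \<open>I\<close>, and \<open>I\<close> is stable under
  scalars and star, so all members of the union are the same coset.\<close>

lemma
  assumes "ideal I A"
  shows carrier_quotient: "carrier (quotient_algebra A I) = (\<lambda>x. I +> x) ` carrier A"
    and one_quotient: "\<one>\<^bsub>quotient_algebra A I\<^esub> = I +> \<one>"
    and zero_quotient: "\<zero>\<^bsub>quotient_algebra A I\<^esub> = I +> \<zero>"
    and add_quotient: "x \<in> carrier A \<Longrightarrow> y \<in> carrier A \<Longrightarrow>
      (I +> x) \<oplus>\<^bsub>quotient_algebra A I\<^esub> (I +> y) = I +> (x \<oplus> y)"
    and mult_quotient: "x \<in> carrier A \<Longrightarrow> y \<in> carrier A \<Longrightarrow>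
      (I +> x) \<otimes>\<^bsub>quotient_algebra A I\<^esub> (I +> y) = I +> (x \<otimes> y)"
    and smult_quotient: "x \<in> carrier A \<Longrightarrow>
      c \<odot>\<^bsub>quotient_algebra A I\<^esub> (I +> x) = I +> (c \<odot> x)"
    and star_quotient: "x \<in> carrier A \<Longrightarrow> star A ` I \<subseteq> I \<Longrightarrow>
      star (quotient_algebra A I) (I +> x) = I +> star A x"
proof -
  interpret ideal I A by fact
  show "carrier (quotient_algebra A I) = (\<lambda>x. I +> x) ` carrier A"
    by (auto simp: quotient_algebra_def FactRing_def A_RCOSETS_def')
  show "\<one>\<^bsub>quotient_algebra A I\<^esub> = I +> \<one>"
    by (simp add: quotient_algebra_def FactRing_def)
  show "\<zero>\<^bsub>quotient_algebra A I\<^esub> = I +> \<zero>"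
    using a_subset by (simp add: quotient_algebra_def FactRing_def)
  show "(I +> x) \<oplus>\<^bsub>quotient_algebra A I\<^esub> (I +> y) = I +> (x \<oplus> y)"
    if "x \<in> carrier A" "y \<in> carrier A"
    using that by (simp add: quotient_algebra_def FactRing_def a_rcos_sum)
  show "(I +> x) \<otimes>\<^bsub>quotient_algebra A I\<^esub> (I +> y) = I +> (x \<otimes> y)"
    if "x \<in> carrier A" "y \<in> carrier A"
    using that by (simp add: quotient_algebra_def FactRing_def rcoset_mult_add)
  have mem: "\<exists>i\<in>I. y = i \<oplus> x" if "y \<in> I +> x" for x y
    using that by (auto simp: a_r_coset_def')
  have self: "x \<in> I +> x" if "x \<in> carrier A" for x
    using that by (rule a_rcos_self)
  show "c \<odot>\<^bsub>quotient_algebra A I\<^esub> (I +> x) = I +> (c \<odot> x)" if x: "x \<in> carrier A" for c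
  proof -
    have "I +> (c \<odot> y) = I +> (c \<odot> x)" if y: "y \<in> I +> x" for y
    proof -
      obtain i where i: "i \<in> I" "y = i \<oplus> x" using mem[OF y] by blast
      then have "c \<odot> y = c \<odot> i \<oplus> c \<odot> x" using smult_add_right[of i x] x by (simp add: a_Hcarr)
      moreover have "I +> (c \<odot> i \<oplus> c \<odot> x) = I +> (c \<odot> x)"
        by (rule coset_add_ideal[OF assms smult_in_ideal[OF assms i(1)] smult_closed[OF x]])
      ultimately show ?thesis by (simp only:)
    qed
    then have "(\<Union>y\<in>I +> x. I +> c \<odot> y) = I +> c \<odot> x" using self[OF x] by blast
    then show ?thesis by (simp only: quotient_algebra_def module.simps star_algebra.simps)
  qed
  show "star (quotient_algebra A I) (I +> x) = I +> star A x"
    if x: "x \<in> carrier A" and s: "star A ` I \<subseteq> I"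
  proof -
    have "I +> star A y = I +> star A x" if y: "y \<in> I +> x" for y
    proof -
      obtain i where i: "i \<in> I" "y = i \<oplus> x" using mem[OF y] by blast
      then have "star A y = star A i \<oplus> star A x" using star_add[of i x] x by (simp add: a_Hcarr)
      moreover have "star A i \<in> I" using i(1) s by blast
      then have "I +> (star A i \<oplus> star A x) = I +> star A x"
        by (rule coset_add_ideal[OF assms _ star_closed[OF x]])
      ultimately show ?thesis by (simp only:)
    qed
    then have "(\<Union>y\<in>I +> x. I +> star A y) = I +> star A x" using self[OF x] by blast
    then show ?thesis by (simp only: quotient_algebra_def module.simps star_algebra.simps)
  qed
qed

lemma star_alg_quotient:
  assumes I: "ideal I A" and s: "star A ` I \<subseteq> I"
  shows "star_alg (quotient_algebra A I)"
proof -
  interpret ideal I A by fact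
  let ?Q = "quotient_algebra A I"
  note q = carrier_quotient[OF I] one_quotient[OF I] zero_quotient[OF I] add_quotient[OF I]
    mult_quotient[OF I] smult_quotient[OF I] star_quotient[OF I _ s]
  have "ring ?Q"
  proof (rule ringI)
    show "abelian_group ?Q"
    proof (rule abelian_groupI)
      fix x assume "x \<in> carrier ?Q"
      then obtain y where "y \<in> carrier A" "x = I +> y" by (auto simp: q)
      then have "(I +> (\<ominus> y)) \<oplus>\<^bsub>?Q\<^esub> x = \<zero>\<^bsub>?Q\<^esub>" "I +> (\<ominus> y) \<in> carrier ?Q"
        by (auto simp: q l_neg)
      then show "\<exists>y\<in>carrier ?Q. y \<oplus>\<^bsub>?Q\<^esub> x = \<zero>\<^bsub>?Q\<^esub>" by blast
    qed (auto simp: q a_ac)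
    show "Group.monoid ?Q"
      by (rule Group.monoidI) (auto simp: q m_assoc)
  qed (auto simp: q l_distr r_distr)
  then show ?thesis
    by (intro star_alg.intro star_alg_axioms.intro)
      (auto simp: q smult_add_right smult_add_left smult_smult smult_mult_left smult_mult_right
         star_add star_smult star_mult)
qed

lemma star_zero [simp]: "star A \<zero> = \<zero>"
proof -
  have "star A \<zero> \<oplus> star A \<zero> = star A \<zero>"
    unfolding star_add[OF zero_closed zero_closed, symmetric] by simp
  then show ?thesis by (simp only: add.l_cancel_one zero_closed star_closed)
qed

lemma star_a_inv: "x \<in> carrier A \<Longrightarrow> star A (\<ominus> x) = \<ominus> star A x"
  using star_add[of "\<ominus> x" x] minus_equality[of "star A (\<ominus> x)" "star A x"]
  by (simp add: l_neg)

lemma star_minus: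
  "x \<in> carrier A \<Longrightarrow> y \<in> carrier A \<Longrightarrow> star A (x \<ominus> y) = star A x \<ominus> star A y"
  by (simp add: minus_eq star_add star_a_inv)

text \<open>The preimage of the ideal under the star is again a two-sided ideal, as the star merely
  exchanges left and right multiplication; it contains \<open>G\<close>, so minimality
  applies.\<close>

lemma star_genideal:
  assumes G: "G \<subseteq> carrier A" and s: "star A ` G \<subseteq> Idl G"
  shows "star A ` (Idl G) \<subseteq> Idl G"
proof -
  interpret I: ideal "Idl G" A by (rule genideal_ideal[OF G])
  let ?J = "{x \<in> carrier A. star A x \<in> Idl G}"
  have "ideal ?J A"
  proof (rule idealI)
    show "subgroup ?J (add_monoid A)"
    proof (rule add.subgroupI)
      show "?J \<noteq> {}" by (auto intro!: exI[of _ \<zero>])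
    qed (auto simp: star_a_inv star_add)
  qed (auto simp: star_mult I.I_l_closed I.I_r_closed ring_axioms)
  moreover have "G \<subseteq> ?J" using G s by auto
  ultimately have "Idl G \<subseteq> ?J" by (rule genideal_minimal)
  then show ?thesis by auto
qed

end

section \<open>Representations by linear operators\<close>

text \<open>Vectors are arbitrary functions without any support condition. The operators used below
  have finitely many nonzero matrix entries in each row, so they act on all functions.\<close>

definition linop :: "(('x \<Rightarrow> complex) \<Rightarrow> ('x \<Rightarrow> complex)) \<Rightarrow> bool" where
  "linop T \<longleftrightarrow> (\<forall>f g. T (\<lambda>x. f x + g x) = (\<lambda>x. T f x + T g x)) \<and>
     (\<forall>c f. T (\<lambda>x. c * f x) = (\<lambda>x. c * T f x))"

lemma
  assumes "linop T"
  shows linop_add: "T (\<lambda>x. f x + g x) = (\<lambda>x. T f x + T g x)"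
    and linop_mult: "T (\<lambda>x. c * f x) = (\<lambda>x. c * T f x)"
  using assms unfolding linop_def by blast+

lemma linop_zero:
  assumes "linop T"
  shows "T (\<lambda>x. 0) = (\<lambda>x. 0)"
  using linop_mult[OF assms, of 0 "\<lambda>x. 0"] by simp

lemma linop_lin:
  assumes "linop T"
  shows "T (\<lambda>y. lin (\<lambda>k. F k y) v) x = lin (\<lambda>k. T (F k) x) v"
proof -
  have "T (\<lambda>y. \<Sum>k\<in>S. F' k y) = (\<lambda>x. \<Sum>k\<in>S. T (F' k) x)" for S :: "'b set" and F'
  proof (induction S rule: infinite_finite_induct)
    case (insert k S)
    then have "T (\<lambda>y. \<Sum>k\<in>insert k S. F' k y) = T (\<lambda>y. F' k y + (\<Sum>k\<in>S. F' k y))"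
      by simp
    then show ?case
      unfolding linop_add[OF assms] insert.IH using insert.hyps by simp
  qed (simp_all add: linop_zero[OF assms])
  then show ?thesis
    unfolding lin_def by (simp only: linop_mult[OF assms])
qed

text \<open>The star is left out on purpose: in the representation \<open>P_act\<close> the
  generator \<open>b\<close> acts nontrivially while its adjoint acts as zero.\<close>

definition oprep ::
  "('a, 'm) star_algebra_scheme \<Rightarrow> ('a \<Rightarrow> ('x \<Rightarrow> complex) \<Rightarrow> 'x \<Rightarrow> complex) \<Rightarrow> bool" where
  "oprep A \<theta> \<longleftrightarrow>
     (\<forall>x\<in>carrier A. linop (\<theta> x) \<and> (\<forall>c. \<theta> (c \<odot>\<^bsub>A\<^esub> x) = (\<lambda>w z. c * \<theta> x w z)) \<and>
       (\<forall>y\<in>carrier A. \<theta> (x \<oplus>\<^bsub>A\<^esub> y) = (\<lambda>w z. \<theta> x w z + \<theta> y w z) \<and>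
         \<theta> (x \<otimes>\<^bsub>A\<^esub> y) = \<theta> x \<circ> \<theta> y)) \<and>
     \<theta> \<one>\<^bsub>A\<^esub> = id"

lemma
  assumes "oprep A \<theta>" "x \<in> carrier A"
  shows oprep_linop: "linop (\<theta> x)"
    and oprep_smult: "\<theta> (c \<odot>\<^bsub>A\<^esub> x) = (\<lambda>w z. c * \<theta> x w z)"
    and oprep_add: "y \<in> carrier A \<Longrightarrow> \<theta> (x \<oplus>\<^bsub>A\<^esub> y) = (\<lambda>w z. \<theta> x w z + \<theta> y w z)"
    and oprep_mult: "y \<in> carrier A \<Longrightarrow> \<theta> (x \<otimes>\<^bsub>A\<^esub> y) = \<theta> x \<circ> \<theta> y"
  using assms by (auto simp: oprep_def)

lemma oprep_one: "oprep A \<theta> \<Longrightarrow> \<theta> \<one>\<^bsub>A\<^esub> = id"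
  by (simp add: oprep_def)

lemma (in star_alg) oprep_zero:
  assumes "oprep A \<theta>"
  shows "\<theta> \<zero> = (\<lambda>w z. 0)"
proof (intro ext)
  fix w z
  have "\<theta> (\<zero> \<oplus> \<zero>) w z = \<theta> \<zero> w z + \<theta> \<zero> w z"
    by (simp only: oprep_add[OF assms zero_closed zero_closed])
  then show "\<theta> \<zero> w z = 0"
    by (simp only: l_zero[OF zero_closed] add_cancel_right_right)
qed

lemma (in star_alg) oprep_a_inv:
  assumes "oprep A \<theta>" "x \<in> carrier A"
  shows "\<theta> (\<ominus> x) = (\<lambda>w z. - \<theta> x w z)"
proof (intro ext)
  fix w z
  have "\<theta> (x \<oplus> \<ominus> x) w z = \<theta> x w z + \<theta> (\<ominus> x) w z"
    by (simp only: oprep_add[OF assms a_inv_closed[OF assms(2)]])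
  then have "\<theta> x w z + \<theta> (\<ominus> x) w z = 0"
    by (simp only: r_neg[OF assms(2)] oprep_zero[OF assms(1)])
  then show "\<theta> (\<ominus> x) w z = - \<theta> x w z"
    by (simp only: add_eq_0_iff)
qed

lemma (in star_alg) oprep_minus:
  assumes "oprep A \<theta>" "x \<in> carrier A" "y \<in> carrier A"
  shows "\<theta> (x \<ominus> y) = (\<lambda>w z. \<theta> x w z - \<theta> y w z)"
  using assms by (simp add: minus_eq oprep_add[OF assms(1)] oprep_a_inv)

text \<open>The kernel of a representation is a two-sided ideal, so it contains the ideal generated
  by any of its subsets.\<close>

lemma (in star_alg) oprep_genideal:
  assumes \<theta>: "oprep A \<theta>" and G: "G \<subseteq> carrier A" and z: "\<And>g. g \<in> G \<Longrightarrow> \<theta> g = (\<lambda>w z. 0)"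
    and "x \<in> Idl G"
  shows "\<theta> x = (\<lambda>w z. 0)"
proof -
  let ?J = "{x \<in> carrier A. \<theta> x = (\<lambda>w z. 0)}"
  have "ideal ?J A"
  proof (rule idealI)
    show "subgroup ?J (add_monoid A)"
    proof (rule add.subgroupI)
      show "?J \<noteq> {}" using oprep_zero[OF \<theta>] by (auto intro!: exI[of _ \<zero>])
    qed (auto simp: oprep_a_inv[OF \<theta>] oprep_add[OF \<theta>])
  qed (auto simp: oprep_mult[OF \<theta>] ring_axioms comp_def linop_zero oprep_linop[OF \<theta>])
  moreover have "G \<subseteq> ?J" using G z by auto
  ultimately have "Idl G \<subseteq> ?J" by (rule genideal_minimal)
  then show ?thesis using assms by auto
qed

text \<open>The choice of representative is harmless once \<open>\<theta>\<close> vanishes on the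
  ideal; \<open>quotient_rep_coset\<close> is the rule that removes it.\<close>

definition quotient_rep ::
  "('a \<Rightarrow> ('x \<Rightarrow> complex) \<Rightarrow> 'x \<Rightarrow> complex) \<Rightarrow> 'a set \<Rightarrow> ('x \<Rightarrow> complex) \<Rightarrow> 'x \<Rightarrow> complex" where
  "quotient_rep \<theta> S = \<theta> (SOME x. x \<in> S)"

lemma (in star_alg) quotient_rep_coset:
  assumes \<theta>: "oprep A \<theta>" and I: "ideal I A" and z: "\<And>i. i \<in> I \<Longrightarrow> \<theta> i = (\<lambda>w z. 0)"
    and x: "x \<in> carrier A"
  shows "quotient_rep \<theta> (I +> x) = \<theta> x"
proof -
  interpret ideal I A by fact
  have "(SOME y. y \<in> I +> x) \<in> I +> x"
    using a_rcos_self[OF x] by (rule someI)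
  then obtain i where "i \<in> I" "(SOME y. y \<in> I +> x) = i \<oplus> x"
    by (auto simp: a_r_coset_def')
  then show ?thesis
    using x a_subset z by (auto simp: quotient_rep_def oprep_add[OF \<theta>])
qed

lemma (in star_alg) oprep_quotient:
  assumes \<theta>: "oprep A \<theta>" and I: "ideal I A" and z: "\<And>i. i \<in> I \<Longrightarrow> \<theta> i = (\<lambda>w z. 0)"
  shows "oprep (quotient_algebra A I) (quotient_rep \<theta>)"
  unfolding oprep_def carrier_quotient[OF I] one_quotient[OF I]
  by (auto simp: add_quotient[OF I] mult_quotient[OF I] smult_quotient[OF I]
     quotient_rep_coset[OF \<theta> I z] oprep_one[OF \<theta>] oprep_linop[OF \<theta>] oprep_add[OF \<theta>]
     oprep_mult[OF \<theta>] oprep_smult[OF \<theta>])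

definition word_op :: "('g \<Rightarrow> ('x \<Rightarrow> complex) \<Rightarrow> 'x \<Rightarrow> complex) \<Rightarrow> 'g list
    \<Rightarrow> ('x \<Rightarrow> complex) \<Rightarrow> 'x \<Rightarrow> complex" where
  "word_op act v = foldr (\<lambda>g T. act g \<circ> T) v id"

definition free_rep :: "('g \<Rightarrow> ('x \<Rightarrow> complex) \<Rightarrow> 'x \<Rightarrow> complex) \<Rightarrow> ('g list \<Rightarrow>\<^sub>0 complex)
    \<Rightarrow> ('x \<Rightarrow> complex) \<Rightarrow> 'x \<Rightarrow> complex" where
  "free_rep act u w z = lin (\<lambda>v. word_op act v w z) u"

lemma word_op_simps [simp]: "word_op act [] = id" "word_op act (g # v) = act g \<circ> word_op act v"
  by (simp_all add: word_op_def)

lemma word_op_append: "word_op act (u @ v) = word_op act u \<circ> word_op act v"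
  by (induction u) (auto simp: comp_assoc)

lemma linop_word_op:
  assumes "\<And>g. linop (act g)"
  shows "linop (word_op act v)"
  by (induction v) (use assms in \<open>simp_all add: linop_def\<close>)

lemma linop_free_rep:
  assumes "\<And>g. linop (act g)"
  shows "linop (free_rep act u)"
  using linop_word_op[of act] assms
  by (simp add: linop_def free_rep_def fun_eq_iff lin_fun_add lin_fun_mult)

lemma oprep_free:
  assumes "\<And>g. linop (act g)"
  shows "oprep (free_star_algebra \<sigma>) (free_rep act)"
proof -
  have "free_rep act (convolution word_monoid u v) w z = free_rep act u (free_rep act v w) z" for u v w z
    unfolding free_rep_def
    by (simp add: word_op_append linop_lin[OF linop_word_op[OF assms]])
  then show ?thesis
    using assms by (auto simp: oprep_def linop_free_rep fun_eq_iff free_rep_def)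
qed

text \<open>Commutation passes from letters to words by induction on each word, and from words to
  linear combinations by interchanging two finite sums.\<close>

lemma free_rep_commute:
  assumes lin: "\<And>g. linop (act g)" "\<And>g. linop (act' g)"
    and comm: "\<And>g g' w. act g (act' g' w) = act' g' (act g w)"
  shows "free_rep act u (free_rep act' v w) = free_rep act' v (free_rep act u w)"
proof -
  have "word_op act a (act' g' w) = act' g' (word_op act a w)" for a g' w
    by (induction a) (auto simp: comm)
  then have "word_op act a (word_op act' b w) = word_op act' b (word_op act a w)" for a b w
    by (induction b arbitrary: w) auto
  then show ?thesis
    unfolding free_rep_def fun_eq_iff
    by (simp add: linop_lin[OF linop_word_op[OF lin(1)]] linop_lin[OF linop_word_op[OF lin(2)]] lin_swap[of _ v u])
qed

section \<open>Presented star algebras\<close>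

locale star_presentation =
  fixes \<sigma> :: "'g \<Rightarrow> ('g list \<Rightarrow>\<^sub>0 complex)" and R :: "('g list \<Rightarrow>\<^sub>0 complex) set"
  assumes involutive: "star (free_star_algebra \<sigma>) (\<sigma> g) = wd [g]"
    and star_relators: "star (free_star_algebra \<sigma>) ` R \<subseteq> Idl\<^bsub>free_star_algebra \<sigma>\<^esub> R"
begin

abbreviation "Fr \<equiv> free_star_algebra \<sigma>"
abbreviation "Rel \<equiv> Idl\<^bsub>Fr\<^esub> R"
abbreviation "proj u \<equiv> Rel +>\<^bsub>Fr\<^esub> u"

sublocale Fr: star_alg Fr
  by (rule star_alg_free) (rule involutive)

lemma Rel_ideal: "ideal Rel Fr"
  by (rule Fr.genideal_ideal) simp

lemma star_Rel: "star Fr ` Rel \<subseteq> Rel"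
  by (rule Fr.star_genideal[OF _ star_relators]) simp

lemma star_alg_presented: "star_alg (presented_algebra \<sigma> R)"
  unfolding presented_algebra_def by (rule Fr.star_alg_quotient[OF Rel_ideal star_Rel])

lemma
  shows proj_add: "proj (u + v) = proj u \<oplus>\<^bsub>presented_algebra \<sigma> R\<^esub> proj v"
    and proj_mult: "proj (convolution word_monoid u v) = proj u \<otimes>\<^bsub>presented_algebra \<sigma> R\<^esub> proj v"
    and proj_scale: "proj (scale c u) = c \<odot>\<^bsub>presented_algebra \<sigma> R\<^esub> proj u"
    and proj_one: "proj (wd []) = \<one>\<^bsub>presented_algebra \<sigma> R\<^esub>"
    and proj_star: "proj (star Fr u) = star (presented_algebra \<sigma> R) (proj u)"
    and proj_closed: "proj u \<in> carrier (presented_algebra \<sigma> R)"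
    and carrier_presented: "carrier (presented_algebra \<sigma> R) = range proj"
  using Fr.add_quotient[OF Rel_ideal] Fr.mult_quotient[OF Rel_ideal] Fr.smult_quotient[OF Rel_ideal]
    Fr.one_quotient[OF Rel_ideal] Fr.star_quotient[OF Rel_ideal _ star_Rel] Fr.carrier_quotient[OF Rel_ideal]
  by (auto simp: presented_algebra_def)

lemma proj_cong:
  assumes "u - v \<in> R"
  shows "proj u = proj v"
proof -
  have "u - v \<in> Rel" using Fr.genideal_self[of R] assms by auto
  from Fr.coset_add_ideal[OF Rel_ideal this, of v] show ?thesis by simp
qed

lemma
  assumes act: "\<And>g. linop (act g)" and R: "\<And>r. r \<in> R \<Longrightarrow> free_rep act r = (\<lambda>w z. 0)"
  shows presented_rep: "quotient_rep (free_rep act) (proj u) = free_rep act u"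
    and oprep_presented: "oprep (presented_algebra \<sigma> R) (quotient_rep (free_rep act))"
proof -
  note o = oprep_free[OF act, where \<sigma> = \<sigma>]
  have z: "free_rep act i = (\<lambda>w z. 0)" if "i \<in> Rel" for i
    by (rule Fr.oprep_genideal[OF o _ _ that]) (simp_all add: R)
  show "quotient_rep (free_rep act) (proj u) = free_rep act u"
    by (rule Fr.quotient_rep_coset[OF o Rel_ideal z]) simp_all
  show "oprep (presented_algebra \<sigma> R) (quotient_rep (free_rep act))"
    unfolding presented_algebra_def by (rule Fr.oprep_quotient[OF o Rel_ideal z])
qed

end

lemma free_rep_simps [simp]:
  "free_rep act (f + g) w z = free_rep act f w z + free_rep act g w z"
  "free_rep act (f - g) w z = free_rep act f w z - free_rep act g w z"
  "free_rep act (scale c f) w z = c * free_rep act f w z"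
  "free_rep act (Poly_Mapping.single v c) w z = c * word_op act v w z"
  "free_rep act 0 w z = 0"
  by (simp_all add: free_rep_def)

lemma scale_scale [simp]: "scale c (scale d f) = scale (c * d) f"
  by (rule lin_eqI) simp

text \<open>Vandermonde argument: subtracting \<open>x i\<close> times the relation for
  \<open>n\<close> from the relation for \<open>n + 1\<close> removes the term \<open>i\<close> and
  multiplies every other coefficient by \<open>x j - x i\<close>, which is nonzero by
  injectivity.\<close>

lemma exp_independent:
  fixes x c :: "'a \<Rightarrow> complex"
  assumes "finite S" "inj_on x S" "\<And>n::nat. (\<Sum>j\<in>S. c j * x j ^ n) = 0" "j \<in> S"
  shows "c j = 0"
  using assms
proof (induction S arbitrary: c j rule: finite_induct)
  case (insert i S)
  have "(\<Sum>j\<in>S. c j * (x j - x i) * x j ^ n) = 0" for n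
  proof -
    have "(\<Sum>j\<in>insert i S. c j * x j ^ Suc n) - x i * (\<Sum>j\<in>insert i S. c j * x j ^ n) = 0"
      by (simp only: insert.prems(2)) simp
    then show ?thesis
      using insert.hyps by (simp add: algebra_simps sum_distrib_left sum_subtractf)
  qed
  then have "c j * (x j - x i) = 0" if "j \<in> S" for j
    using insert.IH[of "\<lambda>j. c j * (x j - x i)" j] insert.prems(1) that by simp
  moreover have "x j - x i \<noteq> 0" if "j \<in> S" for j
    using insert.prems(1) insert.hyps(2) that by simp (metis imageI)
  ultimately have *: "c j = 0" if "j \<in> S" for j using that by auto
  \<comment> \<open>Exponent 0 is the right one to isolate \<open>c i\<close>, because
    \<open>x i ^ 0 = 1\<close> even when \<open>x i = 0\<close>.\<close>
  then have "(\<Sum>j\<in>S. c j * x j ^ 0) = 0" by simp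
  with insert.prems(2)[of 0] insert.hyps have "c i = 0" by simp
  with * insert.prems(3) show ?case by auto
qed simp

section \<open>The algebra $A_{\mu\nu}^\tau$ and its normal forms\<close>

locale podles =
  fixes q \<mu> \<nu> \<tau> :: real
  assumes q_pos: "0 < q" and q_less: "q < 1"
    and \<mu>: "\<mu> \<in> {-1, 0, 1}"
begin

lemma q_nonzero [simp]: "q \<noteq> 0" "cr q \<noteq> 0"
  using q_pos by auto

abbreviation "FU \<equiv> free_star_algebra U_star"
abbreviation "U \<equiv> Uq q \<mu> \<nu>"
abbreviation "A \<equiv> A_alg q \<mu> \<nu> \<tau>"
abbreviation "IA \<equiv> A_ideal q \<mu> \<nu> \<tau>"

lemma U_star_presentation: "star_presentation U_star (U_relators q \<mu> \<nu>)"
proof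
  show inv: "star FU (U_star g) = wd [g]" for g
    by (cases g) simp_all
  interpret FU: star_alg FU
    by (rule star_alg_free) (rule inv)
  let ?I = "Idl\<^bsub>FU\<^esub> (U_relators q \<mu> \<nu>)"
  have I: "ideal ?I FU" by (rule FU.genideal_ideal) simp
  have mem: "r \<in> ?I" if "r \<in> U_relators q \<mu> \<nu>" for r
    using FU.genideal_self[of "U_relators q \<mu> \<nu>"] that by auto
  \<comment> \<open>The star exchanges the relators of E and F with K up to a scalar; it permutes
    the remaining three. This is why the ideal, being stable under scalars, appears on the
    right-hand side of the goal.\<close>
  have 1: "star FU (wd [UK, UE] - scale (cr q) (wd [UE, UK]))
      = scale (- cr q) (wd [UK, UF] - scale (cr (inverse q)) (wd [UF, UK]))"
    "star FU (wd [UK, UF] - scale (cr (inverse q)) (wd [UF, UK]))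
      = scale (- cr (inverse q)) (wd [UK, UE] - scale (cr q) (wd [UE, UK]))"
    by (auto intro!: lin_eqI simp: of_real_inverse algebra_simps)
  have 2: "scale c r \<in> ?I" if "r \<in> U_relators q \<mu> \<nu>" for c r
    using FU.smult_in_ideal[OF I mem[OF that]] by simp
  show "star FU ` U_relators q \<mu> \<nu> \<subseteq> ?I"
    unfolding U_relators_def image_insert image_empty 1
    using mem 2 by (auto simp: U_relators_def)
qed

sublocale UP: star_presentation U_star "U_relators q \<mu> \<nu>"
  by (rule U_star_presentation)

abbreviation "prU \<equiv> UP.proj"

sublocale U: star_alg U
  unfolding Uq_def by (rule UP.star_alg_presented)

lemmas prU_simps = UP.proj_add[folded Uq_def] UP.proj_mult[folded Uq_def] UP.proj_scale[folded Uq_def]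
  UP.proj_one[folded Uq_def] UP.proj_star[folded Uq_def] UP.proj_closed[folded Uq_def]

lemmas carrier_U = UP.carrier_presented[folded Uq_def]

lemma Uq_gen_eq: "Uq_gen q \<mu> \<nu> g = prU (wd [g])"
  by (simp add: Uq_gen_def presented_gen_def)

lemma Uq_gen_closed [simp]: "Uq_gen q \<mu> \<nu> g \<in> carrier U"
  by (simp add: Uq_gen_eq prU_simps)

lemma star_Uq_gen:
  "star U (Uq_gen q \<mu> \<nu> UK) = Uq_gen q \<mu> \<nu> UK" "star U (Uq_gen q \<mu> \<nu> UKinv) = Uq_gen q \<mu> \<nu> UKinv"
  "star U (Uq_gen q \<mu> \<nu> UE) = Uq_gen q \<mu> \<nu> UF" "star U (Uq_gen q \<mu> \<nu> UF) = Uq_gen q \<mu> \<nu> UE"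
  by (simp_all add: Uq_gen_eq prU_simps(5)[symmetric])

abbreviation "casimir_relator \<equiv>
  Casimir q \<mu> \<nu> \<ominus>\<^bsub>U\<^esub> (cr (\<tau> * inverse q * (lam q)\<^sup>2) \<odot>\<^bsub>U\<^esub> \<one>\<^bsub>U\<^esub>)"

lemma IA_eq: "IA = Idl\<^bsub>U\<^esub> {casimir_relator}"
  by (simp only: A_ideal_def Let_def)

lemma Casimir_closed [simp]: "Casimir q \<mu> \<nu> \<in> carrier U"
  by (simp add: Casimir_def Let_def)

lemma IA_ideal: "ideal IA U"
  unfolding IA_eq by (rule U.genideal_ideal) simp

lemma star_casimir_relator: "star U casimir_relator = casimir_relator"
proof -
  have one: "star U \<one>\<^bsub>U\<^esub> = \<one>\<^bsub>U\<^esub>"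
    using prU_simps(5)[of "wd []"] by (simp add: prU_simps(4))
  have "star U (Casimir q \<mu> \<nu>) = Casimir q \<mu> \<nu>"
    by (simp add: Casimir_def Let_def U.star_add U.star_mult U.star_smult star_Uq_gen)
  then show ?thesis
    by (simp add: U.star_minus U.star_smult one)
qed

lemma star_IA: "star U ` IA \<subseteq> IA"
  unfolding IA_eq
proof (rule U.star_genideal)
  show "star U ` {casimir_relator} \<subseteq> Idl\<^bsub>U\<^esub> {casimir_relator}"
    unfolding image_insert image_empty star_casimir_relator
    using U.genideal_self'[of casimir_relator] by simp
qed simp

lemma A_eq: "A = quotient_algebra U IA"
  by (simp add: A_alg_def)

sublocale A: star_alg A
  unfolding A_eq by (rule U.star_alg_quotient[OF IA_ideal star_IA])

text \<open>Collapses the two successive quotients, by the relators and by the Casimir ideal, so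
  that computations in \<open>A\<close> can be done on words of the free algebra.\<close>

definition pr :: "(U_gen list \<Rightarrow>\<^sub>0 complex) \<Rightarrow> (U_gen list \<Rightarrow>\<^sub>0 complex) set set" where
  "pr u = A_proj q \<mu> \<nu> \<tau> (prU u)"

lemma
  shows pr_add: "pr (u + v) = pr u \<oplus>\<^bsub>A\<^esub> pr v"
    and pr_mult: "pr (convolution word_monoid u v) = pr u \<otimes>\<^bsub>A\<^esub> pr v"
    and pr_scale: "pr (scale c u) = c \<odot>\<^bsub>A\<^esub> pr u"
    and pr_one: "pr (wd []) = \<one>\<^bsub>A\<^esub>"
    and pr_star: "pr (star FU u) = star A (pr u)"
    and pr_closed [simp]: "pr u \<in> carrier A"
    and carrier_A: "carrier A = range pr"
  unfolding pr_def A_proj_def A_eq U.carrier_quotient[OF IA_ideal] U.one_quotient[OF IA_ideal] carrier_U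
  by (auto simp: prU_simps U.add_quotient[OF IA_ideal] U.mult_quotient[OF IA_ideal]
    U.smult_quotient[OF IA_ideal] U.star_quotient[OF IA_ideal _ star_IA])

lemma pr_relators:
  "pr (wd [UKinv, UK]) = pr (wd [])"
  "pr (wd [UK, UKinv]) = pr (wd [])"
  "pr (wd [UK, UE]) = pr (scale (cr q) (wd [UE, UK]))"
  "pr (wd [UK, UF]) = pr (scale (cr (inverse q)) (wd [UF, UK]))"
  "pr (wd [UE, UF] - wd [UF, UE]) = pr (scale (cr (lam q))
            (scale (cr \<mu>) (wd [UK, UK]) - scale (cr \<nu>) (wd [UKinv, UKinv])))"
  unfolding pr_def by (rule arg_cong[OF UP.proj_cong], simp add: U_relators_def)+

lemma pr_casimir:
  "pr (wd [UE, UF] + scale (cr ((lam q)\<^sup>2)) (scale (cr (inverse q * \<mu>)) (wd [UK, UK])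
      + scale (cr (q * \<nu>)) (wd [UKinv, UKinv]))) = pr (scale (cr (\<tau> * inverse q * (lam q)\<^sup>2)) (wd []))"
    (is "pr ?u = pr ?v")
proof -
  have mult: "prU (wd [g, h]) = prU (wd [g]) \<otimes>\<^bsub>U\<^esub> prU (wd [h])" for g h
    using prU_simps(2)[of "wd [g]" "wd [h]"] by simp
  have "Casimir q \<mu> \<nu> = prU ?u"
    by (simp only: Casimir_def Let_def Uq_gen_eq prU_simps mult)
  moreover have "casimir_relator \<in> IA"
    unfolding IA_eq using U.genideal_self' by simp
  ultimately have "prU ?u \<ominus>\<^bsub>U\<^esub> prU ?v \<in> IA"
    by (simp only: prU_simps)
  from U.coset_add_ideal[OF IA_ideal this, of "prU ?v"] show ?thesis
    by (simp only: pr_def A_proj_def prU_simps(6) U.minus_eq U.a_assoc U.l_neg U.a_inv_closed U.r_zero simp_thms)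
qed

end

section \<open>Spanning of A by the monomials K^j E^m and K^j F^m\<close>

definition k_word :: "int \<Rightarrow> U_gen list" where
  "k_word j = replicate (nat j) UK @ replicate (nat (- j)) UKinv"

text \<open>As in \<open>k_word\<close>, \<open>nat\<close> is 0 on negative numbers, so one of the
  two blocks is always empty. A single integer \<open>m\<close> thus covers powers of E and powers
  of F, and it is also the amount by which the word shifts the weight index.\<close>

definition ef_word :: "int \<Rightarrow> U_gen list" where
  "ef_word m = replicate (nat m) UE @ replicate (nat (- m)) UF"

definition normal_word :: "int \<times> int \<Rightarrow> U_gen list" where
  "normal_word = (\<lambda>(j, m). k_word j @ ef_word m)"

definition normal_form :: "(int \<times> int \<Rightarrow>\<^sub>0 complex) \<Rightarrow> (U_gen list \<Rightarrow>\<^sub>0 complex)" where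
  "normal_form N = (\<Sum>k\<in>Poly_Mapping.keys N. Poly_Mapping.single (normal_word k) (Poly_Mapping.lookup N k))"

lemma lin_normal_form [simp]: "lin \<phi> (normal_form N) = lin (\<lambda>k. \<phi> (normal_word k)) N"
  by (simp add: normal_form_def lin_def[of _ N])

lemma normal_form_simps [simp]:
  "normal_form (N + N') = normal_form N + normal_form N'"
  "normal_form (scale c N) = scale c (normal_form N)"
  "normal_form (Poly_Mapping.single k c) = Poly_Mapping.single (normal_word k) c"
  by (auto intro!: lin_eqI)

lemma k_word_simps:
  "0 \<le> j \<Longrightarrow> k_word (j + 1) = UK # k_word j" "j < 0 \<Longrightarrow> k_word j = UKinv # k_word (j + 1)"
  by (auto simp: k_word_def nat_add_distrib replicate_app_Cons_same simp flip: replicate_Suc)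

lemma ef_word_simps:
  "0 \<le> j \<Longrightarrow> ef_word (j + 1) = UE # ef_word j" "j < 0 \<Longrightarrow> ef_word j = UF # ef_word (j + 1)"
  by (auto simp: ef_word_def nat_add_distrib simp flip: replicate_Suc)

context podles
begin

definition W :: "U_gen list \<Rightarrow> (U_gen list \<Rightarrow>\<^sub>0 complex) set set" where
  "W v = pr (wd v)"

lemma W_closed [simp]: "W v \<in> carrier A"
  by (simp add: W_def)

lemma W_append: "W (u @ v) = W u \<otimes>\<^bsub>A\<^esub> W v"
  using pr_mult[of "wd u" "wd v"] by (simp add: W_def)

lemma W_Cons: "W (g # v) = W [g] \<otimes>\<^bsub>A\<^esub> W v"
  using W_append[of "[g]" v] by simp

lemma W_Nil: "W [] = \<one>\<^bsub>A\<^esub>"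
  by (simp add: W_def pr_one)

lemma pr_single: "pr (Poly_Mapping.single v c) = c \<odot>\<^bsub>A\<^esub> W v"
  using pr_scale[of c "wd v"] by (simp add: W_def)

lemma W_KK [simp]: "W [UK] \<otimes>\<^bsub>A\<^esub> W [UKinv] = \<one>\<^bsub>A\<^esub>" "W [UKinv] \<otimes>\<^bsub>A\<^esub> W [UK] = \<one>\<^bsub>A\<^esub>"
  using pr_relators(1,2) by (simp_all flip: W_def W_Nil W_append)

lemma pr_diff_cancel:
  assumes "pr (u + v) = pr w"
  shows "pr u = pr (w - v)"
proof -
  have "pr u = pr (u + v) \<oplus>\<^bsub>A\<^esub> pr (- v)" by (simp flip: pr_add)
  then show ?thesis unfolding assms by (simp flip: pr_add)
qed

text \<open>For a spanning statement the value of the scalar does not matter, so it stays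
  existential.\<close>

definition skew :: "U_gen \<Rightarrow> U_gen \<Rightarrow> bool" where
  "skew x y \<longleftrightarrow> (\<exists>c. W [x] \<otimes>\<^bsub>A\<^esub> W [y] = c \<odot>\<^bsub>A\<^esub> (W [y] \<otimes>\<^bsub>A\<^esub> W [x]))"

lemma skew_UK:
  assumes "pr (wd [UK, x]) = pr (scale c (wd [x, UK]))" "c \<noteq> 0"
  shows "skew x UK" "skew x UKinv"
proof -
  have eq: "W [UK] \<otimes>\<^bsub>A\<^esub> W [x] = c \<odot>\<^bsub>A\<^esub> (W [x] \<otimes>\<^bsub>A\<^esub> W [UK])"
    using assms(1) by (simp add: pr_single flip: W_def W_append)
  have "inverse c \<odot>\<^bsub>A\<^esub> (W [UK] \<otimes>\<^bsub>A\<^esub> W [x]) = W [x] \<otimes>\<^bsub>A\<^esub> W [UK]"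
    unfolding eq using assms(2) by (simp add: A.smult_smult)
  then show "skew x UK" unfolding skew_def by metis
  \<comment> \<open>Conjugating K x = c x K by the inverse of K gives the rule for moving
    \<open>x\<close> past \<open>UKinv\<close>, with the scalar \<open>c\<close> itself.\<close>
  have "W [x] \<otimes>\<^bsub>A\<^esub> W [UKinv] = (W [UKinv] \<otimes>\<^bsub>A\<^esub> W [UK]) \<otimes>\<^bsub>A\<^esub> (W [x] \<otimes>\<^bsub>A\<^esub> W [UKinv])"
    by simp
  also have "\<dots> = W [UKinv] \<otimes>\<^bsub>A\<^esub> (W [UK] \<otimes>\<^bsub>A\<^esub> W [x]) \<otimes>\<^bsub>A\<^esub> W [UKinv]"
    by (simp add: A.m_assoc del: W_KK)
  also have "\<dots> = c \<odot>\<^bsub>A\<^esub> ((W [UKinv] \<otimes>\<^bsub>A\<^esub> W [x]) \<otimes>\<^bsub>A\<^esub> (W [UK] \<otimes>\<^bsub>A\<^esub> W [UKinv]))"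
    unfolding eq by (simp add: A.m_assoc A.smult_mult_left A.smult_mult_right del: W_KK)
  finally show "skew x UKinv" unfolding skew_def by auto
qed

lemma skew_UE: "skew UE UK" "skew UE UKinv"
  using skew_UK[OF pr_relators(3)] by simp_all

lemma skew_UF: "skew UF UK" "skew UF UKinv"
  using skew_UK[OF pr_relators(4)] by simp_all

lemma skew_replicate:
  assumes "skew x y"
  shows "\<exists>c. W (x # replicate n y) = c \<odot>\<^bsub>A\<^esub> W (replicate n y @ [x])"
proof (induction n)
  case 0
  then show ?case by (auto intro: exI[of _ 1])
next
  case (Suc n)
  then obtain c where c: "W (x # replicate n y) = c \<odot>\<^bsub>A\<^esub> W (replicate n y @ [x])" by blast
  obtain d where d: "W [x] \<otimes>\<^bsub>A\<^esub> W [y] = d \<odot>\<^bsub>A\<^esub> (W [y] \<otimes>\<^bsub>A\<^esub> W [x])"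
    using assms unfolding skew_def by blast
  have "W (x # replicate (Suc n) y) = (W [x] \<otimes>\<^bsub>A\<^esub> W [y]) \<otimes>\<^bsub>A\<^esub> W (replicate n y)"
    using W_append[of "[x, y]" "replicate n y"] W_append[of "[x]" "[y]"] by simp
  also have "\<dots> = d \<odot>\<^bsub>A\<^esub> (W [y] \<otimes>\<^bsub>A\<^esub> W (x # replicate n y))"
    unfolding d W_Cons[of x "replicate n y"] by (simp add: A.smult_mult_left A.m_assoc)
  also have "\<dots> = (d * c) \<odot>\<^bsub>A\<^esub> W (replicate (Suc n) y @ [x])"
    unfolding c using W_Cons[of y "replicate n y @ [x]"]
    by (simp add: A.smult_mult_right A.smult_smult)
  finally show ?case by blast
qed

lemma skew_k_word:
  assumes "skew x UK" "skew x UKinv"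
  shows "\<exists>c. W (x # k_word j) = c \<odot>\<^bsub>A\<^esub> W (k_word j @ [x])"
  using skew_replicate[OF assms(1), of "nat j"] skew_replicate[OF assms(2), of "nat (- j)"]
  unfolding k_word_def by (cases "0 \<le> j") simp_all

definition normal_forms :: "(U_gen list \<Rightarrow>\<^sub>0 complex) set set set" where
  "normal_forms = range (\<lambda>N. pr (normal_form N))"

lemma normal_forms_add: "x \<in> normal_forms \<Longrightarrow> y \<in> normal_forms \<Longrightarrow> x \<oplus>\<^bsub>A\<^esub> y \<in> normal_forms"
  unfolding normal_forms_def by (auto simp flip: pr_add normal_form_simps)

lemma normal_forms_smult: "x \<in> normal_forms \<Longrightarrow> c \<odot>\<^bsub>A\<^esub> x \<in> normal_forms"
  unfolding normal_forms_def by (auto simp flip: pr_scale normal_form_simps)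

lemma normal_forms_closed: "x \<in> normal_forms \<Longrightarrow> x \<in> carrier A"
  unfolding normal_forms_def by auto

lemma normal_forms_normal_word: "W (k_word j @ ef_word m) \<in> normal_forms"
  unfolding normal_forms_def W_def
  using rangeI[of "\<lambda>N. pr (normal_form N)" "Poly_Mapping.single (j, m) 1"]
  by (simp add: normal_word_def)

lemma normal_forms_ef_word: "W (ef_word m) \<in> normal_forms"
  using normal_forms_normal_word[of 0 m] by (simp add: k_word_def)

lemma pr_zero: "pr 0 = \<zero>\<^bsub>A\<^esub>"
  using pr_add[of 0 0] by simp

lemma normal_forms_left:
  assumes a: "a \<in> carrier A" and "\<And>j m. a \<otimes>\<^bsub>A\<^esub> W (k_word j @ ef_word m) \<in> normal_forms" and "x \<in> normal_forms"
  shows "a \<otimes>\<^bsub>A\<^esub> x \<in> normal_forms"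
proof -
  obtain N where x: "x = pr (normal_form N)" using assms(3) by (auto simp: normal_forms_def)
  have "a \<otimes>\<^bsub>A\<^esub> pr (normal_form N) \<in> normal_forms"
  proof (rule poly_mapping_span_induct[OF subset_UNIV, of _ N])
    show "a \<otimes>\<^bsub>A\<^esub> pr (normal_form (Poly_Mapping.single k c)) \<in> normal_forms" for k c
      using assms(2) by (cases k) (auto simp: pr_single normal_word_def A.smult_mult_right a intro!: normal_forms_smult)
    have "normal_form 0 = 0" by (simp add: normal_form_def)
    moreover have "\<zero>\<^bsub>A\<^esub> \<in> normal_forms"
      using \<open>normal_form 0 = 0\<close> pr_zero unfolding normal_forms_def by (metis rangeI)
    ultimately show "a \<otimes>\<^bsub>A\<^esub> pr (normal_form 0) \<in> normal_forms"
      using a by (simp add: pr_zero)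
  qed (auto simp: pr_add A.r_distr a intro!: normal_forms_add)
  then show ?thesis by (simp add: x)
qed

lemma normal_forms_K: "x \<in> normal_forms \<Longrightarrow> W [UK] \<otimes>\<^bsub>A\<^esub> x \<in> normal_forms"
proof (erule normal_forms_left[rotated 2])
  fix j m
  show "W [UK] \<otimes>\<^bsub>A\<^esub> W (k_word j @ ef_word m) \<in> normal_forms"
  proof (cases "0 \<le> j")
    case True
    then show ?thesis
      using normal_forms_normal_word[of "j + 1" m] by (simp add: k_word_simps W_Cons[of UK "_ @ _"])
  next
    case False
    then have "W (k_word j @ ef_word m) = W [UKinv] \<otimes>\<^bsub>A\<^esub> W (k_word (j + 1) @ ef_word m)"
      by (simp add: k_word_simps(2)[of j] W_Cons[of UKinv "_ @ _"])
    then show ?thesis using normal_forms_normal_word[of "j + 1" m]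
      by (simp flip: A.m_assoc)
  qed
qed simp

lemma normal_forms_Kinv: "x \<in> normal_forms \<Longrightarrow> W [UKinv] \<otimes>\<^bsub>A\<^esub> x \<in> normal_forms"
proof (erule normal_forms_left[rotated 2])
  fix j m
  show "W [UKinv] \<otimes>\<^bsub>A\<^esub> W (k_word j @ ef_word m) \<in> normal_forms"
  proof (cases "0 < j")
    case True
    then have "W (k_word j @ ef_word m) = W [UK] \<otimes>\<^bsub>A\<^esub> W (k_word (j - 1) @ ef_word m)"
      using k_word_simps(1)[of "j - 1"] by (simp add: W_Cons[of UK "_ @ _"])
    then show ?thesis using normal_forms_normal_word[of "j - 1" m]
      by (simp flip: A.m_assoc)
  next
    case False
    then show ?thesis
      using normal_forms_normal_word[of "j - 1" m] k_word_simps(2)[of "j - 1"] by (simp add: W_Cons[of UKinv "_ @ _"])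
  qed
qed simp

lemma normal_forms_replicate:
  assumes "\<And>x. x \<in> normal_forms \<Longrightarrow> W [g] \<otimes>\<^bsub>A\<^esub> x \<in> normal_forms" "x \<in> normal_forms"
  shows "W (replicate n g) \<otimes>\<^bsub>A\<^esub> x \<in> normal_forms"
proof (induction n)
  case (Suc n)
  then show ?case
    using assms normal_forms_closed[OF assms(2)] by (simp add: W_Cons[of g "replicate n g"] A.m_assoc)
qed (use assms normal_forms_closed in \<open>simp add: W_Nil\<close>)

lemma normal_forms_k_word: "x \<in> normal_forms \<Longrightarrow> W (k_word j) \<otimes>\<^bsub>A\<^esub> x \<in> normal_forms"
  using normal_forms_replicate[of UK x "nat j"] normal_forms_replicate[of UKinv _ "nat (- j)"]
    normal_forms_K normal_forms_Kinv normal_forms_closed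
  unfolding k_word_def by (cases "0 \<le> j") simp_all

text \<open>The Casimir relation, which holds in \<open>A\<close> but not in U, turns EF into a
  combination of 1, K^2 and K^(-2). Therefore no monomial containing both E and F survives in the
  normal form. \<open>W_FE\<close> follows by subtracting the commutator.\<close>

lemma W_EF: "\<exists>c\<^sub>0 c\<^sub>1 c\<^sub>2. W [UE, UF] = c\<^sub>0 \<odot>\<^bsub>A\<^esub> W [] \<oplus>\<^bsub>A\<^esub> (c\<^sub>1 \<odot>\<^bsub>A\<^esub> W [UK, UK] \<oplus>\<^bsub>A\<^esub> c\<^sub>2 \<odot>\<^bsub>A\<^esub> W [UKinv, UKinv])"
proof -
  define v where "v = scale (cr ((lam q)\<^sup>2)) (scale (cr (inverse q * \<mu>)) (wd [UK, UK])
      + scale (cr (q * \<nu>)) (wd [UKinv, UKinv]))"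
  define w :: "U_gen list \<Rightarrow>\<^sub>0 complex" where "w = scale (cr (\<tau> * inverse q * (lam q)\<^sup>2)) (wd [])"
  have "W [UE, UF] = pr (w - v)"
    unfolding W_def by (rule pr_diff_cancel) (use pr_casimir in \<open>simp only: v_def w_def\<close>)
  moreover have "w - v = scale (cr (\<tau> * inverse q * (lam q)\<^sup>2)) (wd []) +
      (scale (- (cr ((lam q)\<^sup>2) * cr (inverse q * \<mu>))) (wd [UK, UK]) +
       scale (- (cr ((lam q)\<^sup>2) * cr (q * \<nu>))) (wd [UKinv, UKinv]))"
    unfolding v_def w_def by (rule lin_eqI) (simp add: algebra_simps)
  ultimately show ?thesis by (simp only: pr_add pr_scale W_def[symmetric]) blast
qed

lemma W_FE: "\<exists>c\<^sub>0 c\<^sub>1 c\<^sub>2. W [UF, UE] = c\<^sub>0 \<odot>\<^bsub>A\<^esub> W [] \<oplus>\<^bsub>A\<^esub> (c\<^sub>1 \<odot>\<^bsub>A\<^esub> W [UK, UK] \<oplus>\<^bsub>A\<^esub> c\<^sub>2 \<odot>\<^bsub>A\<^esub> W [UKinv, UKinv])"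
proof -
  obtain c0 c1 c2 where c: "pr (wd [UE, UF]) =
      pr (scale c0 (wd []) + (scale c1 (wd [UK, UK]) + scale c2 (wd [UKinv, UKinv])))"
    using W_EF unfolding W_def pr_add[symmetric] pr_scale[symmetric] by blast
  define l where "l = cr (lam q)"
  define u where "u = scale c0 (wd []) + (scale c1 (wd [UK, UK]) + scale c2 (wd [UKinv, UKinv]))"
  define v where "v = scale l (scale (cr \<mu>) (wd [UK, UK]) - scale (cr \<nu>) (wd [UKinv, UKinv]))"
  have "pr (wd [UF, UE] + v) = pr (wd [UF, UE]) \<oplus>\<^bsub>A\<^esub> pr (wd [UE, UF] - wd [UF, UE])"
    unfolding pr_add pr_relators(5) v_def l_def ..
  also have "\<dots> = pr u"
    unfolding pr_add[symmetric] u_def c[symmetric] by simp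
  finally have "W [UF, UE] = pr (u - v)" unfolding W_def by (rule pr_diff_cancel)
  moreover have "u - v = scale c0 (wd []) +
      (scale (c1 - l * cr \<mu>) (wd [UK, UK]) + scale (c2 + l * cr \<nu>) (wd [UKinv, UKinv]))"
    unfolding v_def u_def by (rule lin_eqI) (simp add: algebra_simps)
  ultimately show ?thesis by (simp only: pr_add pr_scale W_def[symmetric]) blast
qed

lemma normal_forms_quadratic:
  assumes "\<exists>c\<^sub>0 c\<^sub>1 c\<^sub>2. a = c\<^sub>0 \<odot>\<^bsub>A\<^esub> W [] \<oplus>\<^bsub>A\<^esub> (c\<^sub>1 \<odot>\<^bsub>A\<^esub> W [UK, UK] \<oplus>\<^bsub>A\<^esub> c\<^sub>2 \<odot>\<^bsub>A\<^esub> W [UKinv, UKinv])"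
    and x: "x \<in> normal_forms"
  shows "a \<otimes>\<^bsub>A\<^esub> x \<in> normal_forms"
proof -
  note xc = normal_forms_closed[OF x]
  have "W [UK, UK] \<otimes>\<^bsub>A\<^esub> x \<in> normal_forms" "W [UKinv, UKinv] \<otimes>\<^bsub>A\<^esub> x \<in> normal_forms" "W [] \<otimes>\<^bsub>A\<^esub> x \<in> normal_forms"
    using normal_forms_K[OF normal_forms_K[OF x]] normal_forms_Kinv[OF normal_forms_Kinv[OF x]] x xc
    by (simp_all add: W_Cons[of _ "[_]"] A.m_assoc W_Nil)
  then show ?thesis
    using assms(1) xc by (auto simp: A.l_distr A.smult_mult_left intro!: normal_forms_add normal_forms_smult)
qed

text \<open>Moving \<open>x\<close> through the power of K costs only a scalar, so what remains is
  the product of \<open>x\<close> with a pure power of E or F.\<close>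

lemma normal_forms_skew:
  assumes "skew x UK" "skew x UKinv" and ef: "\<And>m. W [x] \<otimes>\<^bsub>A\<^esub> W (ef_word m) \<in> normal_forms" and "y \<in> normal_forms"
  shows "W [x] \<otimes>\<^bsub>A\<^esub> y \<in> normal_forms"
proof (rule normal_forms_left[OF W_closed _ \<open>y \<in> normal_forms\<close>])
  fix j m
  obtain c where c: "W (x # k_word j) = c \<odot>\<^bsub>A\<^esub> W (k_word j @ [x])"
    using skew_k_word[OF assms(1,2)] by blast
  have "W [x] \<otimes>\<^bsub>A\<^esub> W (k_word j @ ef_word m) = W (x # k_word j) \<otimes>\<^bsub>A\<^esub> W (ef_word m)"
    using W_append[of "x # k_word j" "ef_word m"] W_Cons[of x "k_word j @ ef_word m"] by simp
  also have "\<dots> = c \<odot>\<^bsub>A\<^esub> (W (k_word j) \<otimes>\<^bsub>A\<^esub> (W [x] \<otimes>\<^bsub>A\<^esub> W (ef_word m)))"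
    unfolding c by (simp add: W_append A.smult_mult_left A.m_assoc)
  also have "\<dots> \<in> normal_forms" by (intro normal_forms_smult normal_forms_k_word ef)
  finally show "W [x] \<otimes>\<^bsub>A\<^esub> W (k_word j @ ef_word m) \<in> normal_forms" .
qed

lemma normal_forms_E: "x \<in> normal_forms \<Longrightarrow> W [UE] \<otimes>\<^bsub>A\<^esub> x \<in> normal_forms"
proof (rule normal_forms_skew[OF skew_UE])
  fix m
  show "W [UE] \<otimes>\<^bsub>A\<^esub> W (ef_word m) \<in> normal_forms"
  proof (cases "0 \<le> m")
    case True
    then show ?thesis using normal_forms_ef_word[of "m + 1"] by (simp add: ef_word_simps W_Cons[of UE "ef_word m"])
  next
    case False
    \<comment> \<open>For negative \<open>m\<close> the letter E meets the leading F, and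
      \<open>W_EF\<close> replaces the pair by powers of K.\<close>
    then have "W [UE] \<otimes>\<^bsub>A\<^esub> W (ef_word m) = W [UE, UF] \<otimes>\<^bsub>A\<^esub> W (ef_word (m + 1))"
      by (simp add: ef_word_simps(2)[of m] flip: W_append)
    then show ?thesis using normal_forms_quadratic[OF W_EF normal_forms_ef_word] by simp
  qed
qed

lemma normal_forms_F: "x \<in> normal_forms \<Longrightarrow> W [UF] \<otimes>\<^bsub>A\<^esub> x \<in> normal_forms"
proof (rule normal_forms_skew[OF skew_UF])
  fix m
  show "W [UF] \<otimes>\<^bsub>A\<^esub> W (ef_word m) \<in> normal_forms"
  proof (cases "0 < m")
    case True
    then have "W [UF] \<otimes>\<^bsub>A\<^esub> W (ef_word m) = W [UF, UE] \<otimes>\<^bsub>A\<^esub> W (ef_word (m - 1))"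
      using ef_word_simps(1)[of "m - 1"] by (simp flip: W_append)
    then show ?thesis using normal_forms_quadratic[OF W_FE normal_forms_ef_word] by simp
  next
    case False
    then show ?thesis
      using normal_forms_ef_word[of "m - 1"] ef_word_simps(2)[of "m - 1"] by (simp add: W_Cons[of UF "ef_word m"])
  qed
qed

text \<open>The span of the monomials contains 1 and is stable under left multiplication by each
  generator; hence it contains every word.\<close>

lemma normal_form_exists:
  assumes "x \<in> carrier A"
  obtains N where "x = pr (normal_form N)"
proof -
  obtain u where u: "x = pr u" using assms by (auto simp: carrier_A)
  have "W [g] \<otimes>\<^bsub>A\<^esub> y \<in> normal_forms" if "y \<in> normal_forms" for g y
    using that by (cases g) (simp_all add: normal_forms_K normal_forms_Kinv normal_forms_E normal_forms_F)
  moreover have "W [] \<in> normal_forms" using normal_forms_ef_word[of 0] by (simp add: ef_word_def)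
  ultimately have word: "W v \<in> normal_forms" for v
    by (induction v) (simp, metis W_Cons)
  have "pr u \<in> normal_forms"
  proof (rule poly_mapping_span_induct[OF subset_UNIV, of _ u])
    show single: "pr (Poly_Mapping.single v c) \<in> normal_forms" for v c
      unfolding pr_single by (rule normal_forms_smult[OF word])
    show "pr 0 \<in> normal_forms" using single[of "[]" 0] by simp
    show "pr (f + g) \<in> normal_forms" if "pr f \<in> normal_forms" "pr g \<in> normal_forms" for f g
      unfolding pr_add by (rule normal_forms_add[OF that])
  qed
  then show ?thesis using that u by (auto simp: normal_forms_def)
qed

end

section \<open>Weight representations and the commutant of the intertwiner\<close>

type_synonym tensor_coeffs =
  "(U_gen list \<Rightarrow>\<^sub>0 complex) set set \<times> (P_gen list \<Rightarrow>\<^sub>0 complex) set \<Rightarrow>\<^sub>0 complex"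

type_synonym vec = "bool \<times> int \<Rightarrow> complex"

text \<open>
  \<open>U_act\<close> acts on the second index only. The first index carries the two-dimensional
  representation of $\mathrm{Pol}_q(\mu)$ used later, so that both act on the same space and commute.
\<close>

primrec U_act :: "real \<Rightarrow> (int \<Rightarrow> complex) \<Rightarrow> (int \<Rightarrow> complex) \<Rightarrow> U_gen \<Rightarrow>
    vec \<Rightarrow> vec" where
  "U_act q \<alpha> \<beta> UK = (\<lambda>w (i, n). cr q powi n * w (i, n))"
| "U_act q \<alpha> \<beta> UKinv = (\<lambda>w (i, n). inverse (cr q powi n) * w (i, n))"
| "U_act q \<alpha> \<beta> UE = (\<lambda>w (i, n). \<alpha> (n - 1) * w (i, n - 1))"
| "U_act q \<alpha> \<beta> UF = (\<lambda>w (i, n). \<beta> (n + 1) * w (i, n + 1))"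

lemma linop_U_act: "linop (U_act q \<alpha> \<beta> g)"
  by (cases g) (auto simp: linop_def algebra_simps)

text \<open>The eigenvalue is written with base q^j and exponent \<open>n\<close>: later it is read
  as a geometric sequence in \<open>n\<close>, and distinct \<open>j\<close> give distinct
  bases.\<close>

lemma word_op_k_word:
  "word_op (U_act q \<alpha> \<beta>) (k_word j) w (i, n) = (cr q powi j) powi n * w (i, n)"
proof -
  have "word_op (U_act q \<alpha> \<beta>) (replicate t UK) w (i, n) = (cr q powi n) ^ t * w (i, n)"
    "word_op (U_act q \<alpha> \<beta>) (replicate t UKinv) w (i, n) = inverse (cr q powi n) ^ t * w (i, n)" for t
    by (induction t) auto
  then have "word_op (U_act q \<alpha> \<beta>) (k_word j) w (i, n) = (cr q powi n) powi j * w (i, n)"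
    by (auto simp: k_word_def word_op_append power_int_def)
  also have "(cr q powi n) powi j = (cr q powi j) powi n"
    by (simp add: mult.commute flip: power_int_mult)
  finally show ?thesis .
qed

text \<open>The product of the weights met on the way from index \<open>n - m\<close> to index
  \<open>n\<close>. E sends the basis vector \<open>k\<close> to \<open>\<alpha> k\<close> times the
  vector \<open>k + 1\<close>, and F sends it to \<open>\<beta> k\<close> times the vector
  \<open>k - 1\<close>.\<close>

definition shift_coeff :: "(int \<Rightarrow> complex) \<Rightarrow> (int \<Rightarrow> complex) \<Rightarrow> int \<Rightarrow> int \<Rightarrow> complex" where
  "shift_coeff \<alpha> \<beta> m n =
     (if 0 \<le> m then \<Prod>t<nat m. \<alpha> (n - 1 - int t) else \<Prod>t<nat (- m). \<beta> (n + 1 + int t))"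

lemma word_op_ef_word:
  "word_op (U_act q \<alpha> \<beta>) (ef_word m) w (i, n) = shift_coeff \<alpha> \<beta> m n * w (i, n - m)"
proof -
  have E: "word_op (U_act q \<alpha> \<beta>) (replicate t UE) w (i, n)
      = (\<Prod>s<t. \<alpha> (n - 1 - int s)) * w (i, n - int t)" for t n
    by (induction t arbitrary: n) (simp_all add: prod.lessThan_Suc_shift algebra_simps del: prod.lessThan_Suc)
  have F: "word_op (U_act q \<alpha> \<beta>) (replicate t UF) w (i, n)
      = (\<Prod>s<t. \<beta> (n + 1 + int s)) * w (i, n + int t)" for t n
    by (induction t arbitrary: n) (simp_all add: prod.lessThan_Suc_shift algebra_simps del: prod.lessThan_Suc)
  show ?thesis
    using E[of "nat m" n] F[of "nat (- m)" n] by (simp add: ef_word_def shift_coeff_def)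
qed

lemma power_int_eq_one_iff:
  assumes "0 < q" "q < (1 :: real)"
  shows "cr q powi j = 1 \<longleftrightarrow> j = 0"
proof
  assume "cr q powi j = 1"
  then have "q powi j = 1" by (metis of_real_eq_1_iff of_real_power_int)
  then have "real_of_int j * ln q = 0"
    using assms ln_powr[of q "real_of_int j"] powr_real_of_int'[of q j] by simp
  then show "j = 0" using assms by simp
qed simp

context podles
begin

text \<open>
  The eigenvalue of $EF$ on the \<open>n\<close>-th basis vector that the Casimir relation forces. It may vanish,
  in which case no single choice of weights gives a representation that is faithful on
  all $E^m$ and $F^m$; hence the two choices made in \<open>commutant_scalar\<close>.
\<close>

definition casimir_weight :: "int \<Rightarrow> complex" where
  "casimir_weight n = cr ((lam q)\<^sup>2) * (cr (\<tau> * inverse q) - cr (inverse q * \<mu>) * (cr q powi n)\<^sup>2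
     - cr (q * \<nu>) * (inverse (cr q powi n))\<^sup>2)"

text \<open>The left side is the eigenvalue of EF at \<open>n\<close>. Only this product is
  prescribed, so either sequence can be normalised to 1; no adjointness between
  \<open>\<alpha>\<close> and \<open>\<beta>\<close> is imposed.\<close>

definition weights :: "(int \<Rightarrow> complex) \<Rightarrow> (int \<Rightarrow> complex) \<Rightarrow> bool" where
  "weights \<alpha> \<beta> \<longleftrightarrow> (\<forall>n. \<alpha> (n - 1) * \<beta> n = casimir_weight n)"

definition rep :: "(int \<Rightarrow> complex) \<Rightarrow> (int \<Rightarrow> complex) \<Rightarrow> (U_gen list \<Rightarrow>\<^sub>0 complex) set set
    \<Rightarrow> vec \<Rightarrow> vec" where
  "rep \<alpha> \<beta> = quotient_rep (quotient_rep (free_rep (U_act q \<alpha> \<beta>)))"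

lemma q_square_neq_one: "cr q * cr q \<noteq> 1"
  using q_pos q_less mult_strict_mono[of q 1 q 1] by (simp flip: of_real_mult)

lemma lam_identity: "cr (lam q) * (cr q - inverse (cr q)) = 1"
proof -
  have "q - inverse q \<noteq> 0"
    using q_square_neq_one by (simp add: field_simps flip: of_real_mult)
  then have "lam q * (q - inverse q) = 1" by (simp add: lam_def)
  then have "cr (lam q * (q - inverse q)) = 1" by (simp only: of_real_1)
  then show ?thesis by simp
qed

text \<open>FE has at \<open>n\<close> the eigenvalue that EF has at \<open>n + 1\<close>, so this
  is the commutator relation for E and F. Weights chosen to satisfy the Casimir relation therefore
  satisfy the relations of U as well.\<close>

lemma casimir_weight_step:
  "casimir_weight n - casimir_weight (n + 1) =
     cr (lam q) * (cr \<mu> * (cr q powi n)\<^sup>2 - cr \<nu> * (inverse (cr q powi n))\<^sup>2)"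
proof -
  \<comment> \<open>With these names the claim is a polynomial identity modulo
    \<open>Q * p = 1\<close> and \<open>L * (Q - p) = 1\<close>.\<close>
  define Q p y z L where "Q = cr q" and "p = inverse Q" and "y = cr q powi n"
    and "z = inverse y" and "L = cr (lam q)"
  have y: "cr q powi (n + 1) = Q * y" "inverse (Q * y) = p * z"
    by (auto simp: Q_def p_def z_def y_def power_int_add)
  have L: "L * (Q - p) = 1" using lam_identity by (simp add: L_def Q_def p_def)
  have Q: "Q * p = 1" by (simp add: Q_def p_def)
  have "p * Q\<^sup>2 = Q" "Q * p\<^sup>2 = p" using Q by (simp_all add: power2_eq_square algebra_simps)
  moreover have "L\<^sup>2 * (Q - p) = L" using L by (simp add: power2_eq_square mult.assoc)
  ultimately have "L\<^sup>2 * (p * Q\<^sup>2 - p) = L" "L\<^sup>2 * (Q - Q * p\<^sup>2) = L"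
    by (simp_all only:)
  moreover have "L\<^sup>2 * (t - p * a * y\<^sup>2 - Q * b * z\<^sup>2) - L\<^sup>2 * (t - p * a * (Q * y)\<^sup>2 - Q * b * (p * z)\<^sup>2)
      = (L\<^sup>2 * (p * Q\<^sup>2 - p)) * (a * y\<^sup>2) - (L\<^sup>2 * (Q - Q * p\<^sup>2)) * (b * z\<^sup>2)" for t a b
    by (simp add: algebra_simps power_mult_distrib)
  ultimately have e: "L\<^sup>2 * (t - p * a * y\<^sup>2 - Q * b * z\<^sup>2) - L\<^sup>2 * (t - p * a * (Q * y)\<^sup>2 - Q * b * (p * z)\<^sup>2)
      = L * (a * y\<^sup>2 - b * z\<^sup>2)" for t a b
    by (simp add: right_diff_distrib)
  have c: "cr (inverse q * \<mu>) = p * cr \<mu>" "cr (q * \<nu>) = Q * cr \<nu>" "cr ((lam q)\<^sup>2) = L\<^sup>2"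
    by (simp_all add: p_def Q_def L_def)
  show ?thesis
    unfolding casimir_weight_def y c y_def[symmetric] z_def[symmetric] L_def[symmetric]
    using e by simp
qed

lemma free_rep_relators:
  assumes "weights \<alpha> \<beta>" "r \<in> U_relators q \<mu> \<nu>"
  shows "free_rep (U_act q \<alpha> \<beta>) r = (\<lambda>w z. 0)"
proof -
  have step: "\<alpha> (n - 1) * \<beta> n - \<beta> (n + 1) * \<alpha> n =
      cr (lam q) * (cr \<mu> * (cr q powi n)\<^sup>2 - cr \<nu> * (inverse (cr q powi n))\<^sup>2)" for n
    using assms(1)[unfolded weights_def, rule_format, of n]
      assms(1)[unfolded weights_def, rule_format, of "n + 1"] casimir_weight_step[of n]
    by (simp add: mult.commute)
  have "free_rep (U_act q \<alpha> \<beta>) r w (i, n) = 0" for w i n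
  proof -
    have "\<alpha> (n - 1) * (\<beta> n * w (i, n)) - \<beta> (n + 1) * (\<alpha> n * w (i, n)) =
        (cr (lam q) * (cr \<mu> * (cr q powi n)\<^sup>2 - cr \<nu> * (inverse (cr q powi n))\<^sup>2)) * w (i, n)"
      unfolding step[symmetric] by (simp add: algebra_simps)
    moreover have "cr q powi (n - 1) = inverse (cr q) * cr q powi n" "cr q powi (n + 1) = cr q * cr q powi n"
      by (simp_all add: power_int_add power_int_diff field_simps)
    ultimately show ?thesis
      using assms(2) unfolding U_relators_def
      by (elim insertE emptyE) (simp_all add: power2_eq_square mult_ac right_diff_distrib left_diff_distrib)
  qed
  then show ?thesis by (auto simp: fun_eq_iff)
qed

lemma rep_U:
  assumes "weights \<alpha> \<beta>"
  shows "quotient_rep (free_rep (U_act q \<alpha> \<beta>)) (prU u) = free_rep (U_act q \<alpha> \<beta>) u"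
    and "oprep U (quotient_rep (free_rep (U_act q \<alpha> \<beta>)))"
  using UP.presented_rep[of "U_act q \<alpha> \<beta>"] UP.oprep_presented[of "U_act q \<alpha> \<beta>"]
    linop_U_act free_rep_relators[OF assms] by (auto simp: Uq_def)

lemma rep_casimir_relator:
  assumes "weights \<alpha> \<beta>"
  shows "quotient_rep (free_rep (U_act q \<alpha> \<beta>)) casimir_relator = (\<lambda>w z. 0)"
proof -
  note o = oprep_linop[OF rep_U(2)[OF assms]] oprep_smult[OF rep_U(2)[OF assms]] oprep_add[OF rep_U(2)[OF assms]]
    oprep_mult[OF rep_U(2)[OF assms]] oprep_one[OF rep_U(2)[OF assms]] U.oprep_minus[OF rep_U(2)[OF assms]]
  have "quotient_rep (free_rep (U_act q \<alpha> \<beta>)) casimir_relator w (i, n) = 0" for w i n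
  proof -
    have "\<alpha> (n - 1) * (\<beta> n * w (i, n)) = casimir_weight n * w (i, n)"
      using assms by (simp add: weights_def flip: mult.assoc)
    then show ?thesis
      by (simp add: Casimir_def Let_def o Uq_gen_eq prU_simps(6) rep_U(1)[OF assms]
         casimir_weight_def power2_eq_square algebra_simps)
  qed
  then show ?thesis by (auto simp: fun_eq_iff)
qed

lemma
  assumes "weights \<alpha> \<beta>"
  shows rep_pr: "rep \<alpha> \<beta> (pr u) = free_rep (U_act q \<alpha> \<beta>) u"
    and oprep_rep: "oprep A (rep \<alpha> \<beta>)"
proof -
  have z: "quotient_rep (free_rep (U_act q \<alpha> \<beta>)) i = (\<lambda>w z. 0)" if "i \<in> IA" for i
    by (rule U.oprep_genideal[OF rep_U(2)[OF assms] _ _ that[unfolded IA_eq]])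
      (auto simp only: rep_casimir_relator[OF assms] singleton_iff intro: U.minus_closed Casimir_closed)
  show "rep \<alpha> \<beta> (pr u) = free_rep (U_act q \<alpha> \<beta>) u"
    unfolding rep_def pr_def A_proj_def
    by (subst U.quotient_rep_coset[OF rep_U(2)[OF assms] IA_ideal z])
       (simp_all add: rep_U(1)[OF assms] prU_simps(6))
  show "oprep A (rep \<alpha> \<beta>)"
    unfolding rep_def A_eq by (rule U.oprep_quotient[OF rep_U(2)[OF assms] IA_ideal z])
qed

lemma rep_normal_form:
  assumes "weights \<alpha> \<beta>"
  shows "rep \<alpha> \<beta> (pr (normal_form N)) w (i, n) =
    lin (\<lambda>(j, m). (cr q powi j) powi n * (shift_coeff \<alpha> \<beta> m n * w (i, n - m))) N"
  unfolding rep_pr[OF assms] free_rep_def lin_normal_form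
  by (rule lin_cong) (auto simp: normal_word_def word_op_append word_op_k_word word_op_ef_word)

text \<open>The matrix entry of a normal form at \<open>(n, n - m)\<close> without the factor \<open>shift_coeff\<close>.\<close>

definition symbol :: "(int \<times> int \<Rightarrow>\<^sub>0 complex) \<Rightarrow> int \<Rightarrow> int \<Rightarrow> complex" where
  "symbol N m n = lin (\<lambda>(j, m'). if m' = m then (cr q powi j) powi n else 0) N"

lemma symbol_eq_sum:
  "symbol N m n = (\<Sum>j\<in>fst ` Poly_Mapping.keys N. Poly_Mapping.lookup N (j, m) * (cr q powi j) powi n)"
proof -
  let ?J = "fst ` Poly_Mapping.keys N"
  have "Poly_Mapping.keys N \<subseteq> ?J \<times> insert m (snd ` Poly_Mapping.keys N)"
    using subset_fst_snd[of "Poly_Mapping.keys N"] by (rule order_trans) (intro Sigma_mono, auto)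
  then have "symbol N m n = (\<Sum>k\<in>?J \<times> insert m (snd ` Poly_Mapping.keys N). Poly_Mapping.lookup N k *
      (\<lambda>(j, m'). if m' = m then (cr q powi j) powi n else 0) k)"
    unfolding symbol_def by (intro lin_superset) simp_all
  also have "\<dots> = (\<Sum>j\<in>?J. \<Sum>m'\<in>insert m (snd ` Poly_Mapping.keys N).
      if m' = m then Poly_Mapping.lookup N (j, m) * (cr q powi j) powi n else 0)"
    unfolding sum.cartesian_product by (rule sum.cong) auto
  also have "\<dots> = (\<Sum>j\<in>?J. Poly_Mapping.lookup N (j, m) * (cr q powi j) powi n)"
    by (intro sum.cong refl, subst sum.delta) auto
  finally show ?thesis .
qed

lemma inj_q_power: "inj (\<lambda>j. cr q powi j)"
proof (rule injI)
  fix i j assume "cr q powi i = cr q powi j"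
  then have "cr q powi (i - j) = 1" by (simp add: power_int_diff)
  then show "i = j" using power_int_eq_one_iff[OF q_pos q_less] by simp
qed

text \<open>The factor \<open>c\<close> lets one argument serve twice: the constant 1 yields
  \<open>symbol_zero\<close>, and q^j - 1 yields \<open>symbol_constant\<close>. The bases q^j are
  distinct, so \<open>exp_independent\<close> applies; a \<open>j\<close> outside the index set has
  coefficient 0 anyway.\<close>

lemma symbol_independent:
  assumes "\<And>n. (\<Sum>j\<in>fst ` Poly_Mapping.keys N. Poly_Mapping.lookup N (j, m) * c j * (cr q powi j) powi n) = 0"
  shows "Poly_Mapping.lookup N (j, m) * c j = 0"
proof (cases "j \<in> fst ` Poly_Mapping.keys N")
  case True
  have "(\<Sum>j\<in>fst ` Poly_Mapping.keys N. Poly_Mapping.lookup N (j, m) * c j * (cr q powi j) ^ n) = 0" for n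
    using assms[of "int n"] by simp
  from exp_independent[OF _ inj_on_subset[OF inj_q_power subset_UNIV] this True] show ?thesis by simp
next
  case False
  then have "(j, m) \<notin> Poly_Mapping.keys N" by force
  then show ?thesis by (simp add: in_keys_iff)
qed

lemma symbol_zero:
  assumes "\<And>n. symbol N m n = 0"
  shows "Poly_Mapping.lookup N (j, m) = 0"
  using symbol_independent[of N m "\<lambda>_. 1" j] assms by (simp add: symbol_eq_sum)

text \<open>Taking the difference in \<open>n\<close> multiplies the coefficient at \<open>j\<close>
  by q^j - 1, which vanishes for \<open>j = 0\<close> only.\<close>

lemma symbol_constant:
  assumes "\<And>n. symbol N m (n + 1) = symbol N m n" "j \<noteq> 0"
  shows "Poly_Mapping.lookup N (j, m) = 0"
proof -
  have "Poly_Mapping.lookup N (j, m) * (cr q powi j - 1) = 0"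
  proof (rule symbol_independent)
    fix n
    show "(\<Sum>j\<in>fst ` Poly_Mapping.keys N. Poly_Mapping.lookup N (j, m) *
        (cr q powi j - 1) * (cr q powi j) powi n) = 0"
      using assms(1)[of n] by (simp add: symbol_eq_sum power_int_add algebra_simps sum_subtractf)
  qed
  then show ?thesis using power_int_eq_one_iff[OF q_pos q_less, of j] assms(2) by simp
qed

text \<open>
  The intertwiner is a block matrix, upper triangular with diagonal $Q$, $1$ and corner $-e$. Here
  $Q$ is the diagonal operator $q^{-2n}$ and $e$ is a multiple of $X^*Z^{-1}$, the weighted shift with
  weights \<open>twist\<close>. Its scalar is the one for which $Ze - eZ = q^{-1}X^*$.
\<close>

definition twist :: "(int \<Rightarrow> complex) \<Rightarrow> int \<Rightarrow> complex" where
  "twist \<alpha> n = - (cr (sqrt q) * inverse (cr q powi n) * \<alpha> (n - 1))"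

definition intertwiner :: "(int \<Rightarrow> complex) \<Rightarrow> vec \<Rightarrow> vec" where
  "intertwiner \<alpha> w = (\<lambda>(i, n). if i then inverse ((cr q powi n)\<^sup>2) * w (True, n) - twist \<alpha> n * w (False, n - 1)
     else w (False, n))"

lemma commutant_off_diagonal:
  assumes wt: "weights \<alpha> \<beta>"
    and comm: "\<And>w. rep \<alpha> \<beta> (pr (normal_form N)) (intertwiner \<alpha> w) = intertwiner \<alpha> (rep \<alpha> \<beta> (pr (normal_form N)) w)"
    and m: "m \<noteq> 0" and nz: "\<And>n. shift_coeff \<alpha> \<beta> m n \<noteq> 0"
  shows "Poly_Mapping.lookup N (j, m) = 0"
proof (rule symbol_zero)
  fix n
  let ?x = "pr (normal_form N)"
  \<comment> \<open>A basis vector of the first block, where G acts by Q alone: it is an eigenvector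
    for q^(-2(n - m)). Its image under x is compared at index \<open>n\<close>, where Q has the
    different eigenvalue q^(-2n), so the entry must vanish.\<close>
  let ?w = "\<lambda>(i, k :: int). if i \<and> k = n - m then 1 else 0 :: complex"
  have val: "rep \<alpha> \<beta> ?x ?w (True, n) = shift_coeff \<alpha> \<beta> m n * symbol N m n"
    unfolding rep_normal_form[OF wt] symbol_def lin_fun_mult[symmetric]
    by (rule lin_cong) (auto split: prod.splits)
  have "intertwiner \<alpha> ?w = (\<lambda>z. inverse ((cr q powi (n - m))\<^sup>2) * ?w z)"
    by (auto simp: intertwiner_def fun_eq_iff)
  then have "rep \<alpha> \<beta> ?x (intertwiner \<alpha> ?w) (True, n) = inverse ((cr q powi (n - m))\<^sup>2) * rep \<alpha> \<beta> ?x ?w (True, n)"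
    using oprep_linop[OF oprep_rep[OF wt], of ?x] by (simp only: linop_def pr_closed)
  moreover have "rep \<alpha> \<beta> ?x ?w (False, n - 1) = 0"
    unfolding rep_normal_form[OF wt] by (simp add: case_prod_beta)
  ultimately have "inverse ((cr q powi (n - m))\<^sup>2) * rep \<alpha> \<beta> ?x ?w (True, n) =
      inverse ((cr q powi n)\<^sup>2) * rep \<alpha> \<beta> ?x ?w (True, n)"
    unfolding comm by (auto simp: intertwiner_def)
  moreover have "inverse ((cr q powi (n - m))\<^sup>2) \<noteq> inverse ((cr q powi n)\<^sup>2)"
  proof
    assume "inverse ((cr q powi (n - m))\<^sup>2) = inverse ((cr q powi n)\<^sup>2)"
    then have "(cr q powi (n - m)) powi 2 = (cr q powi n) powi 2" by simp
    then have "cr q powi ((n - m) * 2) = cr q powi (n * 2)" by (simp only: power_int_mult)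
    then have "(n - m) * 2 = n * 2" by (rule injD[OF inj_q_power])
    then show False using m by simp
  qed
  ultimately have "rep \<alpha> \<beta> ?x ?w (True, n) = 0" by auto
  then show "symbol N m n = 0" using nz val by simp
qed

lemma commutant_diagonal:
  assumes wt: "weights \<alpha> \<beta>"
    and comm: "\<And>w. rep \<alpha> \<beta> (pr (normal_form N)) (intertwiner \<alpha> w) = intertwiner \<alpha> (rep \<alpha> \<beta> (pr (normal_form N)) w)"
    and nz: "\<And>n. \<alpha> n \<noteq> 0" and j: "j \<noteq> 0"
  shows "Poly_Mapping.lookup N (j, 0) = 0"
proof (rule symbol_constant[OF _ j])
  fix n
  let ?x = "pr (normal_form N)"
  \<comment> \<open>A basis vector of the second block at \<open>n\<close>. The corner -e carries it
    to the first block at \<open>n + 1\<close>, so the entry there is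
    \<open>- twist \<alpha> (n + 1)\<close> times the diagonal entry of x at \<open>n + 1\<close> if
    G acts first, and at \<open>n\<close> if x acts first.\<close>
  let ?w = "\<lambda>(i, k :: int). if \<not> i \<and> k = n then 1 else 0 :: complex"
  have "rep \<alpha> \<beta> ?x (intertwiner \<alpha> ?w) (True, n + 1) = - twist \<alpha> (n + 1) * symbol N 0 (n + 1)"
    unfolding rep_normal_form[OF wt] symbol_def lin_fun_mult[symmetric]
    by (rule lin_cong) (auto simp: intertwiner_def shift_coeff_def split: prod.splits)
  moreover have "rep \<alpha> \<beta> ?x ?w (False, n) = symbol N 0 n"
    unfolding rep_normal_form[OF wt] symbol_def
    by (rule lin_cong) (auto simp: shift_coeff_def split: prod.splits)
  moreover have "rep \<alpha> \<beta> ?x ?w (True, n + 1) = 0"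
    unfolding rep_normal_form[OF wt] by (simp add: case_prod_beta)
  moreover have "twist \<alpha> (n + 1) \<noteq> 0" using nz q_pos by (simp add: twist_def)
  ultimately show "symbol N 0 (n + 1) = symbol N 0 n"
    unfolding comm by (simp add: intertwiner_def)
qed

lemma commutant_scalar:
  assumes x: "x \<in> carrier A"
    and comm: "\<And>\<alpha> \<beta> w. weights \<alpha> \<beta> \<Longrightarrow> rep \<alpha> \<beta> x (intertwiner \<alpha> w) = intertwiner \<alpha> (rep \<alpha> \<beta> x w)"
  shows "\<exists>c. x = c \<odot>\<^bsub>A\<^esub> \<one>\<^bsub>A\<^esub>"
proof -
  obtain N where N: "x = pr (normal_form N)" using normal_form_exists[OF x] .
  note comm = comm[unfolded N]
  \<comment> \<open>In \<open>w1\<close> E is a pure shift, which settles \<open>m = 0\<close> and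
    positive \<open>m\<close>; in \<open>w2\<close> F is a pure shift, which settles negative
    \<open>m\<close>. The index \<open>n + 1\<close> in \<open>w2\<close> compensates for the
    \<open>n - 1\<close> in \<open>weights\<close>.\<close>
  have w1: "weights (\<lambda>_. 1) casimir_weight" and w2: "weights (\<lambda>n. casimir_weight (n + 1)) (\<lambda>_. 1)"
    by (simp_all add: weights_def)
  have zero: "Poly_Mapping.lookup N (j, m) = 0" if "(j, m) \<noteq> (0, 0)" for j m
  proof (cases "m = 0")
    case True
    then show ?thesis using commutant_diagonal[OF w1 comm[OF w1]] that by simp
  next
    case False
    then show ?thesis
      using commutant_off_diagonal[OF w1 comm[OF w1] False] commutant_off_diagonal[OF w2 comm[OF w2] False]
      by (cases "0 \<le> m") (simp_all add: shift_coeff_def)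
  qed
  have "N = Poly_Mapping.single (0, 0) (Poly_Mapping.lookup N (0, 0))"
  proof (rule poly_mapping_eqI)
    fix k :: "int \<times> int"
    show "Poly_Mapping.lookup N k =
        Poly_Mapping.lookup (Poly_Mapping.single (0, 0) (Poly_Mapping.lookup N (0, 0))) k"
      using zero[of "fst k" "snd k"] by (cases "k = (0, 0)") (simp_all add: lookup_single_not_eq)
  qed
  then have "x = pr (normal_form (Poly_Mapping.single (0, 0) (Poly_Mapping.lookup N (0, 0))))"
    unfolding N by simp
  then have "x = Poly_Mapping.lookup N (0, 0) \<odot>\<^bsub>A\<^esub> W []"
    by (simp add: normal_word_def k_word_def ef_word_def pr_single)
  then show ?thesis by (auto simp: W_Nil)
qed

end

section \<open>The Hopf algebra and the tensor product\<close>

text \<open>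
  $a$ acts as $\mathrm{diag}(q,1)$ and $b$ as the matrix unit $e_{12}$, where \<open>True\<close> is the first index;
  $c$ acts as zero, so that the image is upper triangular.
\<close>

primrec P_act :: "real \<Rightarrow> P_gen \<Rightarrow> vec \<Rightarrow> vec" where
  "P_act q Pa = (\<lambda>w (i, n). (if i then cr q else 1) * w (i, n))"
| "P_act q Pb = (\<lambda>w (i, n). if i then w (False, n) else 0)"
| "P_act q Pc = (\<lambda>w z. 0)"
| "P_act q Pd = (\<lambda>w (i, n). (if i then inverse (cr q) else 1) * w (i, n))"

lemma linop_P_act: "linop (P_act q g)"
  by (cases g) (auto simp: linop_def algebra_simps)

lemma U_P_act_commute: "U_act q \<alpha> \<beta> g (P_act q g' w) = P_act q g' (U_act q \<alpha> \<beta> g w)"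
  by (cases g; cases g') (auto simp: fun_eq_iff)

context podles
begin

abbreviation "FP \<equiv> free_star_algebra (P_star q \<mu>)"
abbreviation "P \<equiv> Polq q \<mu>"

lemma P_star_presentation: "star_presentation (P_star q \<mu>) (P_relators q \<mu>)"
proof
  \<comment> \<open>Applying the star twice to \<open>Pb\<close> or \<open>Pc\<close> multiplies by
    \<mu>^2.\<close>
  have m: "cr \<mu> * cr \<mu> = 1" if "\<mu> \<noteq> 0" using \<mu> that by auto
  show inv: "star FP (P_star q \<mu> g) = wd [g]" for g
  proof (cases "\<mu> = 0")
    case True
    then show ?thesis by (cases g) (simp_all add: P_star_def)
  next
    case False
    then show ?thesis using m by (cases g) (simp_all add: P_star_def field_simps)
  qed
  interpret FP: star_alg FP
    by (rule star_alg_free) (rule inv)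
  let ?I = "Idl\<^bsub>FP\<^esub> (P_relators q \<mu>)"
  have I: "ideal ?I FP" by (rule FP.genideal_ideal) simp
  have mem: "r \<in> ?I" if "r \<in> P_relators q \<mu>" for r
    using FP.genideal_self[of "P_relators q \<mu>"] that by auto
  have mem_scale: "scale c r \<in> ?I" if "r \<in> P_relators q \<mu>" for c r
    using FP.smult_in_ideal[OF I mem[OF that]] by simp
  show "star FP ` P_relators q \<mu> \<subseteq> ?I"
  proof (cases "\<mu> = 0")
    case True
    \<comment> \<open>For \<mu> = 0 the relators contain their adjoints by definition, so an
      involution maps the set of relators to itself.\<close>
    have ss: "star FP (star FP x) = x" for x by (rule FP.star_star) simp
    have "star FP r \<in> P_relators q \<mu>" if "r \<in> P_relators q \<mu>" for r
      using that ss True by (auto simp: P_relators_def P0_relators_def P_star_def)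
    then show ?thesis using mem by auto
  next
    case False
    \<comment> \<open>For \<mu> = 1 or -1 each adjoint is a scalar multiple of a relator; the
      multiples come from the coefficients of \<open>SL_star\<close>.\<close>
    have "\<exists>c r'. r' \<in> P_relators q \<mu> \<and> star FP r = scale c r'" if "r \<in> P_relators q \<mu>" for r
    proof -
      have 1: "star FP (wd [Pa, Pb] - scale (cr q) (wd [Pb, Pa])) =
          scale (- cr \<mu> * inverse (cr q)) (wd [Pc, Pd] - scale (cr q) (wd [Pd, Pc]))"
        "star FP (wd [Pa, Pc] - scale (cr q) (wd [Pc, Pa])) =
          scale (- cr \<mu> * cr q) (wd [Pb, Pd] - scale (cr q) (wd [Pd, Pb]))"
        "star FP (wd [Pb, Pd] - scale (cr q) (wd [Pd, Pb])) =
          scale (- cr \<mu> * inverse (cr q)) (wd [Pa, Pc] - scale (cr q) (wd [Pc, Pa]))"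
        "star FP (wd [Pc, Pd] - scale (cr q) (wd [Pd, Pc])) =
          scale (- cr \<mu> * cr q) (wd [Pa, Pb] - scale (cr q) (wd [Pb, Pa]))"
        "star FP (wd [Pb, Pc] - wd [Pc, Pb]) = scale 1 (wd [Pb, Pc] - wd [Pc, Pb])"
        "star FP ((wd [Pd, Pa] - scale (cr (inverse q)) (wd [Pc, Pb])) - wd []) =
          scale 1 ((wd [Pd, Pa] - scale (cr (inverse q)) (wd [Pc, Pb])) - wd [])"
        "star FP ((wd [Pa, Pd] - scale (cr q) (wd [Pb, Pc])) - wd []) =
          scale 1 ((wd [Pa, Pd] - scale (cr q) (wd [Pb, Pc])) - wd [])"
        using False m by (auto intro!: lin_eqI simp: P_star_def field_simps)
      show ?thesis
        using that False unfolding P_relators_def SL_relators_def if_not_P[OF False]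
        by (elim insertE emptyE; hypsubst; subst 1; blast)
    qed
    then show ?thesis using mem_scale by fastforce
  qed
qed

sublocale PP: star_presentation "P_star q \<mu>" "P_relators q \<mu>"
  by (rule P_star_presentation)

abbreviation "prP \<equiv> PP.proj"

sublocale P: star_alg P
  unfolding Polq_def by (rule PP.star_alg_presented)

lemmas prP_simps = PP.proj_add[folded Polq_def] PP.proj_mult[folded Polq_def] PP.proj_scale[folded Polq_def]
  PP.proj_one[folded Polq_def] PP.proj_star[folded Polq_def] PP.proj_closed[folded Polq_def]

lemmas carrier_P = PP.carrier_presented[folded Polq_def]

definition repP :: "(P_gen list \<Rightarrow>\<^sub>0 complex) set \<Rightarrow> vec \<Rightarrow> vec" where
  "repP = quotient_rep (free_rep (P_act q))"

text \<open>Once \<open>c\<close> acts as zero, both presentations reduce to ad = da = 1, ab = q ba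
  and bd = q db. This is why one triangular representation serves all three values of \<mu>.\<close>

lemma free_rep_P_relators:
  assumes "r \<in> P_relators q \<mu>"
  shows "free_rep (P_act q) r = (\<lambda>w z. 0)"
proof (intro ext)
  fix w :: vec and z :: "bool \<times> int"
  obtain i n where z: "z = (i, n)" by (cases z)
  show "free_rep (P_act q) r w z = 0"
  proof (cases "\<mu> = 0")
    case True
    then have "r \<in> P0_defining_relators q \<union> star (free_star_algebra P0_star) ` P0_defining_relators q"
      using assms by (simp add: P_relators_def P0_relators_def)
    then show ?thesis
      unfolding z P0_defining_relators_def by (cases i) auto
  next
    case False
    then have "r \<in> SL_relators q" using assms by (simp add: P_relators_def)
    then show ?thesis
      unfolding z SL_relators_def by (cases i) auto
  qed
qed

lemma repP_prP: "repP (prP u) = free_rep (P_act q) u"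
  and oprep_repP: "oprep P repP"
  using PP.presented_rep[of "P_act q"] PP.oprep_presented[of "P_act q"]
    linop_P_act free_rep_P_relators by (auto simp: Polq_def repP_def)

lemma rep_repP_commute:
  assumes "weights \<alpha> \<beta>" "a \<in> carrier A" "p \<in> carrier P"
  shows "rep \<alpha> \<beta> a (repP p w) = repP p (rep \<alpha> \<beta> a w)"
proof -
  obtain u v where uv: "a = pr u" "p = prP v" using assms by (auto simp: carrier_A carrier_P)
  show ?thesis
    unfolding uv rep_pr[OF assms(1)] repP_prP
    by (rule free_rep_commute) (simp_all add: linop_U_act linop_P_act U_P_act_commute)
qed

section \<open>The subalgebra B inside A\<close>

abbreviation "B \<equiv> B_alg q \<mu> \<nu> \<tau>"

lemma B_alg_fields [simp]:
  "mult B = mult A" "one B = one A" "zero B = zero A" "add B = add A"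
  "module.smult B = module.smult A" "star B = star A"
  by (simp_all add: B_alg_def generated_star_subalgebra_def Let_def)

lemma pr_gen: "A_proj q \<mu> \<nu> \<tau> (Uq_gen q \<mu> \<nu> g \<otimes>\<^bsub>U\<^esub> Uq_gen q \<mu> \<nu> h) = W [g, h]"
  using prU_simps(2)[of "wd [g]" "wd [h]"] by (simp add: Uq_gen_eq W_def pr_def)

lemma carrier_B: "carrier B = \<Inter>{S. star_subalgebra S A \<and> {W [UK, UK], W [UK, UE]} \<subseteq> S}"
  by (simp add: B_alg_def generated_star_subalgebra_def Let_def pr_gen)

lemma star_subalgebra_A: "star_subalgebra (carrier A) A"
  by (simp add: star_subalgebra_def)

lemma carrier_B_subset: "carrier B \<subseteq> carrier A"
  unfolding carrier_B using star_subalgebra_A by (intro Inter_lower) auto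

lemma star_subalgebra_B: "star_subalgebra (carrier B) A"
proof -
  have Inter: "star_subalgebra (\<Inter>\<S>) A" if "\<S> \<noteq> {}" "\<And>S. S \<in> \<S> \<Longrightarrow> star_subalgebra S A" for \<S>
    using that unfolding star_subalgebra_def by blast
  show ?thesis unfolding carrier_B
  proof (rule Inter)
    have "carrier A \<in> {S. star_subalgebra S A \<and> {W [UK, UK], W [UK, UE]} \<subseteq> S}"
      using star_subalgebra_A by simp
    then show "{S. star_subalgebra S A \<and> {W [UK, UK], W [UK, UE]} \<subseteq> S} \<noteq> {}" by blast
  qed simp
qed

lemma B_induct:
  assumes "star_subalgebra S A" "W [UK, UK] \<in> S" "W [UK, UE] \<in> S"
  shows "carrier B \<subseteq> S"
  unfolding carrier_B using assms by blast

lemma W_in_B: "W [UK, UK] \<in> carrier B" "W [UK, UE] \<in> carrier B"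
  unfolding carrier_B by auto

lemma B_closed:
  "\<one>\<^bsub>A\<^esub> \<in> carrier B"
  "x \<in> carrier B \<Longrightarrow> y \<in> carrier B \<Longrightarrow> x \<oplus>\<^bsub>A\<^esub> y \<in> carrier B"
  "x \<in> carrier B \<Longrightarrow> y \<in> carrier B \<Longrightarrow> x \<otimes>\<^bsub>A\<^esub> y \<in> carrier B"
  "x \<in> carrier B \<Longrightarrow> c \<odot>\<^bsub>A\<^esub> x \<in> carrier B"
  "x \<in> carrier B \<Longrightarrow> star A x \<in> carrier B"
  using star_subalgebra_B unfolding star_subalgebra_def by blast+

lemma in_A: "x \<in> carrier B \<Longrightarrow> x \<in> carrier A"
  using carrier_B_subset by blast

section \<open>The tensor product of B and P and its representation\<close>

abbreviation "T\<^sub>0 \<equiv> tensor_free B P"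
abbreviation "T \<equiv> tensor B P"
abbreviation "N\<^sub>T \<equiv> tensor_null B P"

lemma T0_fields [simp]:
  "carrier T\<^sub>0 = {f. Poly_Mapping.keys f \<subseteq> carrier B \<times> carrier P}"
  "mult T\<^sub>0 = convolution (B \<times>\<times> P)" "add T\<^sub>0 = (+)" "module.smult T\<^sub>0 = scale"
  by (simp_all add: tensor_free_def monoid_algebra_def)

lemma star_T0: "star T\<^sub>0 f =
    (\<Sum>x\<in>Poly_Mapping.keys f. scale (cnj (Poly_Mapping.lookup f x))
       (Poly_Mapping.single (star A (fst x), star P (snd x)) 1))"
  by (simp add: tensor_free_def monoid_algebra_def case_prod_beta)

lemma lin_star_T0:
  "lin \<phi> (star T\<^sub>0 f) = cnj (lin (\<lambda>(a, p). cnj (\<phi> (star A a, star P p))) f)"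
  by (simp add: star_T0 lin_def[of _ f] case_prod_beta)

lemma star_T0_closed: "f \<in> carrier T\<^sub>0 \<Longrightarrow> star T\<^sub>0 f \<in> carrier T\<^sub>0"
proof -
  assume f: "f \<in> carrier T\<^sub>0"
  have "Poly_Mapping.keys (star T\<^sub>0 f) \<subseteq> (\<Union>x\<in>Poly_Mapping.keys f. Poly_Mapping.keys
      (scale (cnj (Poly_Mapping.lookup f x)) (Poly_Mapping.single (star A (fst x), star P (snd x)) 1)))"
    unfolding star_T0 by (rule Poly_Mapping.keys_sum)
  also have "\<dots> \<subseteq> carrier B \<times> carrier P"
  proof (rule UN_least)
    fix x assume "x \<in> Poly_Mapping.keys f"
    then have "fst x \<in> carrier B" "snd x \<in> carrier P" using f by auto
    then show "Poly_Mapping.keys (scale (cnj (Poly_Mapping.lookup f x))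
        (Poly_Mapping.single (star A (fst x), star P (snd x)) 1)) \<subseteq> carrier B \<times> carrier P"
      using B_closed(5) P.star_closed by (auto split: if_splits)
  qed
  finally show ?thesis by simp
qed

text \<open>The universal property of the tensor product at the level of representatives: a function
  on pairs that is bilinear on the carriers kills the four kinds of relators, hence their
  span.\<close>

lemma null_induct:
  assumes f: "f \<in> N\<^sub>T"
    and add1: "\<And>a a' p. a \<in> carrier B \<Longrightarrow> a' \<in> carrier B \<Longrightarrow> p \<in> carrier P \<Longrightarrow>
      \<phi> (a \<oplus>\<^bsub>A\<^esub> a', p) = \<phi> (a, p) + \<phi> (a', p)"
    and add2: "\<And>a p p'. a \<in> carrier B \<Longrightarrow> p \<in> carrier P \<Longrightarrow> p' \<in> carrier P \<Longrightarrow>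
      \<phi> (a, p \<oplus>\<^bsub>P\<^esub> p') = \<phi> (a, p) + \<phi> (a, p')"
    and smult1: "\<And>c a p. a \<in> carrier B \<Longrightarrow> p \<in> carrier P \<Longrightarrow> \<phi> (c \<odot>\<^bsub>A\<^esub> a, p) = c * \<phi> (a, p)"
    and smult2: "\<And>c a p. a \<in> carrier B \<Longrightarrow> p \<in> carrier P \<Longrightarrow> \<phi> (a, c \<odot>\<^bsub>P\<^esub> p) = c * \<phi> (a, p)"
  shows "lin \<phi> f = 0" and "f \<in> carrier T\<^sub>0"
proof -
  interpret vs: vector_space "scale :: complex \<Rightarrow>
      tensor_coeffs \<Rightarrow> _"
    by (rule vector_space_scale)
  have keys: "Poly_Mapping.keys (f - g) \<subseteq> S" if "Poly_Mapping.keys f \<subseteq> S" "Poly_Mapping.keys g \<subseteq> S"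
    for f g :: "'d \<Rightarrow>\<^sub>0 complex" and S
    using that Poly_Mapping.keys_diff[of f g] by blast
  have "N\<^sub>T \<subseteq> {f. f \<in> carrier T\<^sub>0 \<and> lin \<phi> f = 0}"
    unfolding tensor_null_def
  proof (rule vs.span_minimal)
    show "bilinearity_relators B P \<subseteq> {f. f \<in> carrier T\<^sub>0 \<and> lin \<phi> f = 0}"
      unfolding bilinearity_relators_def
      by (auto simp: add1 add2 smult1 smult2 B_closed dest!: subsetD[OF Poly_Mapping.keys_diff] split: if_splits)
    show "vs.subspace {f. f \<in> carrier T\<^sub>0 \<and> lin \<phi> f = 0}"
      by (rule vs.subspaceI)
        (auto dest!: subsetD[OF Poly_Mapping.keys_add] subsetD[OF keys_scale])
  qed
  then show "lin \<phi> f = 0" "f \<in> carrier T\<^sub>0" using f by auto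
qed

text \<open>This is R \<otimes> \<rho> on the free space over pairs; by
  \<open>tensor_rep_null\<close> it depends only on the class in the tensor product.\<close>

definition tensor_rep :: "(int \<Rightarrow> complex) \<Rightarrow> (int \<Rightarrow> complex)
    \<Rightarrow> tensor_coeffs
    \<Rightarrow> vec \<Rightarrow> vec" where
  "tensor_rep \<alpha> \<beta> f w z = lin (\<lambda>(a, p). rep \<alpha> \<beta> a (repP p w) z) f"

lemma tensor_rep_linear:
  "tensor_rep \<alpha> \<beta> (f + g) = (\<lambda>w z. tensor_rep \<alpha> \<beta> f w z + tensor_rep \<alpha> \<beta> g w z)"
  "tensor_rep \<alpha> \<beta> (scale c f) = (\<lambda>w z. c * tensor_rep \<alpha> \<beta> f w z)"
  "tensor_rep \<alpha> \<beta> (Poly_Mapping.single (a, p) 1) = rep \<alpha> \<beta> a \<circ> repP p"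
  by (auto simp: tensor_rep_def fun_eq_iff)

text \<open>Multiplicativity needs the images of B and P to commute, so that the inner pair of
  factors can be exchanged; this is \<open>rep_repP_commute\<close>.\<close>

lemma tensor_rep_mult:
  assumes wt: "weights \<alpha> \<beta>" and "f \<in> carrier T\<^sub>0" "g \<in> carrier T\<^sub>0"
  shows "tensor_rep \<alpha> \<beta> (convolution (B \<times>\<times> P) f g) = tensor_rep \<alpha> \<beta> f \<circ> tensor_rep \<alpha> \<beta> g"
proof (intro ext)
  fix w z
  note R = oprep_rep[OF wt]
  have "tensor_rep \<alpha> \<beta> (convolution (B \<times>\<times> P) f g) w z =
      lin (\<lambda>x. lin (\<lambda>y. rep \<alpha> \<beta> (fst x) (repP (snd x) (rep \<alpha> \<beta> (fst y) (repP (snd y) w))) z) g) f"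
    unfolding tensor_rep_def lin_convolution
  proof (intro lin_cong)
    fix x y assume "x \<in> Poly_Mapping.keys f" "y \<in> Poly_Mapping.keys g"
    then have "fst x \<in> carrier A" "snd x \<in> carrier P" "fst y \<in> carrier A" "snd y \<in> carrier P"
      using assms in_A by auto
    then show "(case x \<otimes>\<^bsub>B \<times>\<times> P\<^esub> y of (a, p) \<Rightarrow> rep \<alpha> \<beta> a (repP p w) z) =
        rep \<alpha> \<beta> (fst x) (repP (snd x) (rep \<alpha> \<beta> (fst y) (repP (snd y) w))) z"
      by (simp add: DirProd_def case_prod_beta oprep_mult[OF R] oprep_mult[OF oprep_repP]
        rep_repP_commute[OF wt])
  qed
  also have "\<dots> = (tensor_rep \<alpha> \<beta> f \<circ> tensor_rep \<alpha> \<beta> g) w z"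
    unfolding tensor_rep_def comp_apply
  proof (rule lin_cong)
    fix x assume "x \<in> Poly_Mapping.keys f"
    then have x: "fst x \<in> carrier A" "snd x \<in> carrier P" using assms in_A by auto
    have inner: "repP (snd x) (\<lambda>z. lin (\<lambda>y. rep \<alpha> \<beta> (fst y) (repP (snd y) w) z) g) =
        (\<lambda>z. lin (\<lambda>y. repP (snd x) (rep \<alpha> \<beta> (fst y) (repP (snd y) w)) z) g)"
      by (intro ext linop_lin[OF oprep_linop[OF oprep_repP x(2)]])
    show "lin (\<lambda>y. rep \<alpha> \<beta> (fst x) (repP (snd x) (rep \<alpha> \<beta> (fst y) (repP (snd y) w))) z) g =
        (case x of (a, p) \<Rightarrow> rep \<alpha> \<beta> a (repP p (\<lambda>z. lin (\<lambda>(a, p). rep \<alpha> \<beta> a (repP p w) z) g)) z)"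
      unfolding case_prod_beta inner by (rule linop_lin[OF oprep_linop[OF R x(1)], symmetric])
  qed
  finally show "tensor_rep \<alpha> \<beta> (convolution (B \<times>\<times> P) f g) w z = (tensor_rep \<alpha> \<beta> f \<circ> tensor_rep \<alpha> \<beta> g) w z" .
qed

lemma tensor_rep_null:
  assumes wt: "weights \<alpha> \<beta>" and f: "f \<in> N\<^sub>T"
  shows "tensor_rep \<alpha> \<beta> f = (\<lambda>w z. 0)" and "f \<in> carrier T\<^sub>0" and "tensor_rep \<alpha> \<beta> (star T\<^sub>0 f) = (\<lambda>w z. 0)"
proof -
  note R = oprep_rep[OF wt]
  note lin_rep = linop_add[OF oprep_linop[OF R]] linop_mult[OF oprep_linop[OF R]]
  note simps = oprep_add[OF R] oprep_smult[OF R] oprep_add[OF oprep_repP] oprep_smult[OF oprep_repP]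
    lin_rep in_A A.star_add A.star_smult P.star_add P.star_smult
  have 1: "lin (\<lambda>(a, p). rep \<alpha> \<beta> a (repP p w) z) f = 0" for w z
    by (rule null_induct(1)[OF f]) (simp_all add: simps)
  then show "tensor_rep \<alpha> \<beta> f = (\<lambda>w z. 0)" by (simp add: tensor_rep_def fun_eq_iff)
  show "f \<in> carrier T\<^sub>0"
    by (rule null_induct(2)[OF f, of "\<lambda>_. 0"]) simp_all
  \<comment> \<open>The star is antilinear in both factors; the outer conjugation restores the
    bilinearity that \<open>null_induct\<close> asks for.\<close>
  have "lin (\<lambda>(a, p). cnj (rep \<alpha> \<beta> (star A a) (repP (star P p) w) z)) f = 0" for w z
    by (rule null_induct(1)[OF f]) (simp_all add: simps)
  then show "tensor_rep \<alpha> \<beta> (star T\<^sub>0 f) = (\<lambda>w z. 0)" by (simp add: tensor_rep_def fun_eq_iff lin_star_T0)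
qed

text \<open>Quantifying over all representatives makes the predicate pass directly through the
  operations of \<open>tensor\<close>, which are sums and unions of cosets. It determines
  \<open>S\<close> as soon as \<open>t\<close> is nonempty.\<close>

definition acts :: "(int \<Rightarrow> complex) \<Rightarrow> (int \<Rightarrow> complex)
    \<Rightarrow> tensor_coeffs set
    \<Rightarrow> (vec \<Rightarrow> vec) \<Rightarrow> bool" where
  "acts \<alpha> \<beta> t S \<longleftrightarrow> (\<forall>f\<in>t. f \<in> carrier T\<^sub>0 \<and> tensor_rep \<alpha> \<beta> f = S)"

text \<open>The operator of an adjoint cannot be computed from that of the element, as R \<otimes>
  \<rho> ignores the star. So the adjoint is tracked by its own predicate, which
  \<open>acts_star\<close> turns into a statement about \<open>star T t\<close>.\<close>

definition star_acts :: "(int \<Rightarrow> complex) \<Rightarrow> (int \<Rightarrow> complex)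
    \<Rightarrow> tensor_coeffs set
    \<Rightarrow> (vec \<Rightarrow> vec) \<Rightarrow> bool" where
  "star_acts \<alpha> \<beta> t S \<longleftrightarrow> (\<forall>f\<in>t. f \<in> carrier T\<^sub>0 \<and> tensor_rep \<alpha> \<beta> (star T\<^sub>0 f) = S)"

lemma star_T0_linear:
  "star T\<^sub>0 (f + g) = star T\<^sub>0 f + star T\<^sub>0 g" "star T\<^sub>0 (scale c f) = scale (cnj c) (star T\<^sub>0 f)"
  "star T\<^sub>0 (Poly_Mapping.single (a, p) 1) = Poly_Mapping.single (star A a, star P p) 1"
  by (rule lin_eqI, simp add: lin_star_T0)+

lemma coset_T0_E:
  assumes "f \<in> N\<^sub>T +>\<^bsub>T\<^sub>0\<^esub> g"
  obtains n where "n \<in> N\<^sub>T" "f = n + g"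
  using assms by (auto simp: a_r_coset_def')

lemma T0_closed:
  "f \<in> carrier T\<^sub>0 \<Longrightarrow> g \<in> carrier T\<^sub>0 \<Longrightarrow> f + g \<in> carrier T\<^sub>0"
  "f \<in> carrier T\<^sub>0 \<Longrightarrow> scale c f \<in> carrier T\<^sub>0"
  "a \<in> carrier B \<Longrightarrow> p \<in> carrier P \<Longrightarrow> Poly_Mapping.single (a, p) 1 \<in> carrier T\<^sub>0"
  using Poly_Mapping.keys_add[of f g] keys_scale[of c f] by auto

lemma T0_mult_closed:
  assumes "f \<in> carrier T\<^sub>0" "g \<in> carrier T\<^sub>0"
  shows "convolution (B \<times>\<times> P) f g \<in> carrier T\<^sub>0"
  using keys_convolution[of "B \<times>\<times> P" f g] assms
  by (fastforce simp: DirProd_def intro: B_closed)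

section \<open>Operators attached to classes of the tensor product\<close>

context
  fixes \<alpha> \<beta> assumes wt: "weights \<alpha> \<beta>"
begin

lemma acts_coset:
  assumes "g \<in> carrier T\<^sub>0" "tensor_rep \<alpha> \<beta> g = S"
  shows "acts \<alpha> \<beta> (N\<^sub>T +>\<^bsub>T\<^sub>0\<^esub> g) S"
  unfolding acts_def
  by (auto elim!: coset_T0_E simp del: T0_fields(1) simp: tensor_rep_linear tensor_rep_null[OF wt] assms
      intro!: T0_closed)

lemma star_acts_coset:
  assumes "g \<in> carrier T\<^sub>0" "tensor_rep \<alpha> \<beta> (star T\<^sub>0 g) = S"
  shows "star_acts \<alpha> \<beta> (N\<^sub>T +>\<^bsub>T\<^sub>0\<^esub> g) S"
  unfolding star_acts_def
  by (auto elim!: coset_T0_E simp del: T0_fields(1) simp: tensor_rep_linear star_T0_linear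
      tensor_rep_null[OF wt] assms intro!: T0_closed)

lemma acts_pure:
  "a \<in> carrier B \<Longrightarrow> p \<in> carrier P \<Longrightarrow> acts \<alpha> \<beta> (pure_tensor B P a p) (rep \<alpha> \<beta> a \<circ> repP p)"
  unfolding pure_tensor_def by (intro acts_coset T0_closed tensor_rep_linear)

lemma star_acts_pure:
  "a \<in> carrier B \<Longrightarrow> p \<in> carrier P \<Longrightarrow>
    star_acts \<alpha> \<beta> (pure_tensor B P a p) (rep \<alpha> \<beta> (star A a) \<circ> repP (star P p))"
  unfolding pure_tensor_def by (intro star_acts_coset T0_closed) (simp_all only: star_T0_linear tensor_rep_linear)

lemma T_add_E:
  assumes "f \<in> t \<oplus>\<^bsub>T\<^esub> t'"
  obtains g g' where "g \<in> t" "g' \<in> t'" "f = g + g'"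
  using assms by (auto simp: tensor_def quotient_algebra_def FactRing_def set_add_def')

lemma T_smult_E:
  assumes "f \<in> c \<odot>\<^bsub>T\<^esub> t"
  obtains g where "g \<in> t" "f \<in> N\<^sub>T +>\<^bsub>T\<^sub>0\<^esub> scale c g"
  using assms by (auto simp: tensor_def quotient_algebra_def)

lemma T_star_E:
  assumes "f \<in> star T t"
  obtains g where "g \<in> t" "f \<in> N\<^sub>T +>\<^bsub>T\<^sub>0\<^esub> star T\<^sub>0 g"
  using assms by (auto simp: tensor_def quotient_algebra_def)

lemma T_mult_E:
  assumes "f \<in> t \<otimes>\<^bsub>T\<^esub> t'"
  obtains g g' where "g \<in> t" "g' \<in> t'" "f \<in> N\<^sub>T +>\<^bsub>T\<^sub>0\<^esub> convolution (B \<times>\<times> P) g g'"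
  using assms by (auto simp: tensor_def quotient_algebra_def FactRing_def rcoset_mult_def)

lemma acts_add:
  "acts \<alpha> \<beta> t S \<Longrightarrow> acts \<alpha> \<beta> t' S' \<Longrightarrow> acts \<alpha> \<beta> (t \<oplus>\<^bsub>T\<^esub> t') (\<lambda>w z. S w z + S' w z)"
  unfolding acts_def by (auto elim!: T_add_E simp del: T0_fields(1) simp: tensor_rep_linear intro!: T0_closed)

lemma star_acts_add:
  "star_acts \<alpha> \<beta> t S \<Longrightarrow> star_acts \<alpha> \<beta> t' S' \<Longrightarrow> star_acts \<alpha> \<beta> (t \<oplus>\<^bsub>T\<^esub> t') (\<lambda>w z. S w z + S' w z)"
  unfolding star_acts_def
  by (auto elim!: T_add_E simp del: T0_fields(1) simp: tensor_rep_linear star_T0_linear intro!: T0_closed)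

lemma acts_smult:
  assumes "acts \<alpha> \<beta> t S"
  shows "acts \<alpha> \<beta> (c \<odot>\<^bsub>T\<^esub> t) (\<lambda>w z. c * S w z)"
  unfolding acts_def
proof
  fix f assume "f \<in> c \<odot>\<^bsub>T\<^esub> t"
  then obtain g where g: "g \<in> t" "f \<in> N\<^sub>T +>\<^bsub>T\<^sub>0\<^esub> scale c g" by (rule T_smult_E)
  have "acts \<alpha> \<beta> (N\<^sub>T +>\<^bsub>T\<^sub>0\<^esub> scale c g) (\<lambda>w z. c * S w z)"
    using g(1) assms by (intro acts_coset T0_closed) (auto simp: acts_def tensor_rep_linear simp del: T0_fields(1))
  then show "f \<in> carrier T\<^sub>0 \<and> tensor_rep \<alpha> \<beta> f = (\<lambda>w z. c * S w z)" using g(2) unfolding acts_def by blast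
qed

lemma star_acts_smult:
  assumes "star_acts \<alpha> \<beta> t S"
  shows "star_acts \<alpha> \<beta> (c \<odot>\<^bsub>T\<^esub> t) (\<lambda>w z. cnj c * S w z)"
  unfolding star_acts_def
proof
  fix f assume "f \<in> c \<odot>\<^bsub>T\<^esub> t"
  then obtain g where g: "g \<in> t" "f \<in> N\<^sub>T +>\<^bsub>T\<^sub>0\<^esub> scale c g" by (rule T_smult_E)
  have "star_acts \<alpha> \<beta> (N\<^sub>T +>\<^bsub>T\<^sub>0\<^esub> scale c g) (\<lambda>w z. cnj c * S w z)"
    using g(1) assms
    by (intro star_acts_coset T0_closed)
      (auto simp: star_acts_def tensor_rep_linear star_T0_linear simp del: T0_fields(1))
  then show "f \<in> carrier T\<^sub>0 \<and> tensor_rep \<alpha> \<beta> (star T\<^sub>0 f) = (\<lambda>w z. cnj c * S w z)"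
    using g(2) unfolding star_acts_def by blast
qed

lemma acts_mult:
  assumes "acts \<alpha> \<beta> t S" "acts \<alpha> \<beta> t' S'"
  shows "acts \<alpha> \<beta> (t \<otimes>\<^bsub>T\<^esub> t') (S \<circ> S')"
  unfolding acts_def
proof
  fix f assume "f \<in> t \<otimes>\<^bsub>T\<^esub> t'"
  then obtain g g' where g: "g \<in> t" "g' \<in> t'" "f \<in> N\<^sub>T +>\<^bsub>T\<^sub>0\<^esub> convolution (B \<times>\<times> P) g g'" by (rule T_mult_E)
  have "acts \<alpha> \<beta> (N\<^sub>T +>\<^bsub>T\<^sub>0\<^esub> convolution (B \<times>\<times> P) g g') (S \<circ> S')"
    using g(1,2) assms
    by (intro acts_coset T0_mult_closed) (auto simp: acts_def tensor_rep_mult[OF wt] simp del: T0_fields(1))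
  then show "f \<in> carrier T\<^sub>0 \<and> tensor_rep \<alpha> \<beta> f = S \<circ> S'" using g(3) unfolding acts_def by blast
qed

lemma acts_star:
  assumes "star_acts \<alpha> \<beta> t S"
  shows "acts \<alpha> \<beta> (star T t) S"
  unfolding acts_def
proof
  fix f assume "f \<in> star T t"
  then obtain g where g: "g \<in> t" "f \<in> N\<^sub>T +>\<^bsub>T\<^sub>0\<^esub> star T\<^sub>0 g" by (rule T_star_E)
  have "acts \<alpha> \<beta> (N\<^sub>T +>\<^bsub>T\<^sub>0\<^esub> star T\<^sub>0 g) S"
    using g(1) assms
    by (intro acts_coset star_T0_closed) (auto simp: star_acts_def simp del: T0_fields(1))
  then show "f \<in> carrier T\<^sub>0 \<and> tensor_rep \<alpha> \<beta> f = S" using g(2) unfolding acts_def by blast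
qed

end

section \<open>The coaction in the representation\<close>

lemma rep_W: "weights \<alpha> \<beta> \<Longrightarrow> rep \<alpha> \<beta> (W v) = word_op (U_act q \<alpha> \<beta>) v"
  by (simp add: W_def rep_pr fun_eq_iff)

lemma star_W: "star A (W [UK, UK]) = W [UK, UK]" "star A (W [UF, UK]) = W [UK, UE]"
    "star A (W [UK, UE]) = W [UF, UK]" "star A \<one>\<^bsub>A\<^esub> = \<one>\<^bsub>A\<^esub>"
  using pr_star[of "wd [UK, UK]"] pr_star[of "wd [UF, UK]"] pr_star[of "wd [UK, UE]"] pr_star[of "wd []"]
  by (simp_all add: W_def pr_one)

definition x_coeff :: complex where "x_coeff = cr (sqrt q * (inverse q - q))"

lemma B_X_eq: "B_X q \<mu> \<nu> \<tau> = x_coeff \<odot>\<^bsub>A\<^esub> W [UF, UK]"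
  by (simp only: B_X_def pr_gen x_coeff_def)

lemma B_Z_eq: "B_Z q \<mu> \<nu> \<tau> = W [UK, UK]"
  by (simp only: B_Z_def pr_gen)

lemma star_B_X: "star A (B_X q \<mu> \<nu> \<tau>) = x_coeff \<odot>\<^bsub>A\<^esub> W [UK, UE]"
  by (simp add: B_X_eq A.star_smult star_W x_coeff_def)

lemma B_gens_closed:
  "B_X q \<mu> \<nu> \<tau> \<in> carrier B" "B_Z q \<mu> \<nu> \<tau> \<in> carrier B" "star A (B_X q \<mu> \<nu> \<tau>) \<in> carrier B"
proof -
  have "W [UF, UK] \<in> carrier B" using B_closed(5)[OF W_in_B(2)] by (simp add: star_W)
  then show X: "B_X q \<mu> \<nu> \<tau> \<in> carrier B" by (simp only: B_X_eq B_closed)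
  show "B_Z q \<mu> \<nu> \<tau> \<in> carrier B" by (simp only: B_Z_eq W_in_B)
  show "star A (B_X q \<mu> \<nu> \<tau>) \<in> carrier B" using X by (rule B_closed)
qed

lemma rep_gens:
  assumes "weights \<alpha> \<beta>"
  shows "rep \<alpha> \<beta> (B_X q \<mu> \<nu> \<tau>) w (i, n) = x_coeff * (\<beta> (n + 1) * (cr q powi (n + 1) * w (i, n + 1)))"
    "rep \<alpha> \<beta> (B_Z q \<mu> \<nu> \<tau>) w (i, n) = cr q powi n * (cr q powi n * w (i, n))"
    "rep \<alpha> \<beta> (star A (B_X q \<mu> \<nu> \<tau>)) w (i, n) = x_coeff * (cr q powi n * (\<alpha> (n - 1) * w (i, n - 1)))"
  by (simp_all only: star_B_X)
    (simp_all add: B_X_eq B_Z_eq oprep_smult[OF oprep_rep[OF assms]] rep_W[OF assms])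

abbreviation "a\<^sub>P \<equiv> Polq_gen q \<mu> Pa"
abbreviation "b\<^sub>P \<equiv> Polq_gen q \<mu> Pb"

lemma Polq_gen_eq: "Polq_gen q \<mu> g = prP (wd [g])"
  by (simp add: Polq_gen_def presented_gen_def)

lemma P_gen_closed [simp]: "Polq_gen q \<mu> g \<in> carrier P"
  by (simp add: Polq_gen_eq prP_simps)

lemma repP_gens:
  "repP a\<^sub>P w (i, n) = (if i then cr q else 1) * w (i, n)"
  "repP b\<^sub>P w (i, n) = (if i then w (False, n) else 0)"
  "repP (star P a\<^sub>P) w (i, n) = (if i then inverse (cr q) else 1) * w (i, n)"
  "repP (star P b\<^sub>P) w (i, n) = 0"
  by (simp_all add: Polq_gen_eq repP_prP flip: prP_simps(5)) (simp_all add: P_star_def)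

text \<open>This is the corner equation q^2 Xe - eX = q (\<tau> - (1 + q^2) \<mu> Z) at index
  \<open>n\<close>: up to the factor -\<open>x_coeff\<close> times sqrt q, Xe and eX are diagonal
  with entries \<open>casimir_weight (n + 1)\<close> and \<open>casimir_weight n\<close>. The \<nu>
  terms cancel because q^2 q^(-2(n + 1)) = q^(-2n), in accordance with a coaction formula free of
  \<nu>.\<close>

lemma casimir_weight_shift:
  "x_coeff * cr (sqrt q) * (cr q * cr q * casimir_weight (n + 1) - casimir_weight n) =
     - (cr q * (cr \<tau> - (1 + cr q * cr q) * cr \<mu> * (cr q powi n)\<^sup>2))"
proof -
  define Q p y z L where "Q = cr q" and "p = inverse Q" and "y = cr q powi n"
    and "z = inverse y" and "L = cr (lam q)"
  have y: "cr q powi (n + 1) = Q * y" "inverse (Q * y) = p * z"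
    by (auto simp: Q_def p_def z_def y_def power_int_add)
  have L: "L * (Q - p) = 1" using lam_identity by (simp add: L_def Q_def p_def)
  have Q: "Q * p = 1" by (simp add: Q_def p_def)
  have c: "cr (inverse q * \<mu>) = p * cr \<mu>" "cr (q * \<nu>) = Q * cr \<nu>" "cr ((lam q)\<^sup>2) = L\<^sup>2"
    "cr (\<tau> * inverse q) = cr \<tau> * p"
    by (simp_all add: p_def Q_def L_def)
  have "sqrt q * sqrt q = q" using q_pos by simp
  then have "sqrt q * (inverse q - q) * sqrt q = q * (inverse q - q)"
    by (metis mult.assoc mult.commute)
  then have "x_coeff * cr (sqrt q) = cr (q * (inverse q - q))"
    by (simp only: x_coeff_def of_real_mult[symmetric])
  then have x: "x_coeff * cr (sqrt q) = Q * (p - Q)"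
    by (simp add: Q_def p_def)
  have "L\<^sup>2 * (Q - p) * (Q - p) = 1" using L by (simp add: power2_eq_square algebra_simps)
  moreover have "Q * (p - Q) * (Q * Q * (L\<^sup>2 * (t * p - p * a * (Q * y)\<^sup>2 - Q * b * (p * z)\<^sup>2)) -
      L\<^sup>2 * (t * p - p * a * y\<^sup>2 - Q * b * z\<^sup>2)) =
      - (L\<^sup>2 * (Q - p) * (Q - p)) * (Q * (t - (1 + Q * Q) * a * y\<^sup>2))" for t a b
  proof -
    have "Q * Q * (t * p - p * a * (Q * y)\<^sup>2 - Q * b * (p * z)\<^sup>2) - (t * p - p * a * y\<^sup>2 - Q * b * z\<^sup>2)
        = (Q - p) * (t - (1 + Q * Q) * a * y\<^sup>2)"
      by (simp add: p_def Q_def field_simps power2_eq_square)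
    then have "Q * (p - Q) * (L\<^sup>2 * (Q * Q * (t * p - p * a * (Q * y)\<^sup>2 - Q * b * (p * z)\<^sup>2) -
          (t * p - p * a * y\<^sup>2 - Q * b * z\<^sup>2)))
        = Q * (p - Q) * (L\<^sup>2 * ((Q - p) * (t - (1 + Q * Q) * a * y\<^sup>2)))" by simp
    then show ?thesis by (simp add: algebra_simps)
  qed
  ultimately show ?thesis
    unfolding casimir_weight_def y c y_def[symmetric] z_def[symmetric] L_def[symmetric] x
    unfolding Q_def[symmetric] by simp
qed

text \<open>The adjoint of \<open>b\<close> acts as zero, so only Z in the diagonal and X'/q in the
  corner remain, with X' the adjoint of X. The corner of the claim is Ze - eZ = X'/q.\<close>

lemma acts_gamma_Z:
  assumes wt: "weights \<alpha> \<beta>"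
  shows "\<exists>S. acts \<alpha> \<beta> (gamma_Z q \<mu> \<nu> \<tau>) S \<and>
    (\<forall>w. S (intertwiner \<alpha> w) = intertwiner \<alpha> (rep \<alpha> \<beta> (B_Z q \<mu> \<nu> \<tau>) w))"
proof -
  let ?R = "rep \<alpha> \<beta>" and ?X = "B_X q \<mu> \<nu> \<tau>" and ?Z = "B_Z q \<mu> \<nu> \<tau>"
  let ?S = "\<lambda>w z. (?R (star A ?X) \<circ> repP (star P a\<^sub>P \<otimes>\<^bsub>P\<^esub> b\<^sub>P)) w z
     + (?R ?Z \<circ> repP (\<one>\<^bsub>P\<^esub> \<ominus>\<^bsub>P\<^esub> (cr ((1 + q\<^sup>2) * \<mu>) \<odot>\<^bsub>P\<^esub> (star P b\<^sub>P \<otimes>\<^bsub>P\<^esub> b\<^sub>P)))) w z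
     + (?R ?X \<circ> repP (star P b\<^sub>P \<otimes>\<^bsub>P\<^esub> a\<^sub>P)) w z
     + cr \<tau> * (?R \<one>\<^bsub>A\<^esub> \<circ> repP (star P b\<^sub>P \<otimes>\<^bsub>P\<^esub> b\<^sub>P)) w z"
  have "acts \<alpha> \<beta> (gamma_Z q \<mu> \<nu> \<tau>) ?S"
    unfolding gamma_Z_def Let_def B_alg_fields
    by (intro acts_add[OF wt] acts_smult[OF wt] acts_pure[OF wt] B_gens_closed B_closed
      P.m_closed P.star_closed P.minus_closed P.smult_closed P.one_closed P_gen_closed)
  moreover have "?S (intertwiner \<alpha> w) = intertwiner \<alpha> (?R ?Z w)" for w
  proof -
    note P_simps = oprep_mult[OF oprep_repP] oprep_smult[OF oprep_repP] oprep_one[OF oprep_repP]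
      P.oprep_minus[OF oprep_repP] oprep_one[OF oprep_rep[OF wt]]
    have nz: "inverse (cr q powi n) \<noteq> 0" "cr q powi n \<noteq> 0" for n by simp_all
    have "?S (intertwiner \<alpha> w) (i, n) = intertwiner \<alpha> (?R ?Z w) (i, n)" for i n
    proof (cases i)
      case True
      have "cr q powi (n - 1) = inverse (cr q) * cr q powi n"
        by (simp add: power_int_diff field_simps)
      moreover have "cr q - inverse (cr q) = cr (q - inverse q)" by simp
      ultimately show ?thesis
        using True nz(2)[of n]
        by (simp add: P_simps repP_gens rep_gens[OF wt] intertwiner_def twist_def x_coeff_def
            power2_eq_square field_simps)
          (metis mult.assoc mult.left_commute)
    next
      case False
      then show ?thesis
        by (simp add: P_simps repP_gens rep_gens[OF wt] intertwiner_def)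
    qed
    then show ?thesis by (simp only: fun_eq_iff split_paired_all) simp
  qed
  ultimately show ?thesis by blast
qed

text \<open>The term with \<open>b b\<close> vanishes and \<open>b a\<close> acts as the matrix
  unit, which leaves diagonal q^2 X, X and corner q (\<tau> - (1 + q^2) \<mu> Z). The corner of the
  claim is \<open>casimir_weight_shift\<close>.\<close>

lemma acts_gamma_X:
  assumes wt: "weights \<alpha> \<beta>"
  shows "\<exists>S. acts \<alpha> \<beta> (gamma_X q \<mu> \<nu> \<tau>) S \<and>
    (\<forall>w. S (intertwiner \<alpha> w) = intertwiner \<alpha> (rep \<alpha> \<beta> (B_X q \<mu> \<nu> \<tau>) w))"
proof -
  let ?R = "rep \<alpha> \<beta>" and ?X = "B_X q \<mu> \<nu> \<tau>" and ?Z = "B_Z q \<mu> \<nu> \<tau>"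
  let ?S = "\<lambda>w z. cr (- q * \<mu>) * (?R (star A ?X) \<circ> repP (b\<^sub>P \<otimes>\<^bsub>P\<^esub> b\<^sub>P)) w z
     + cr (- q * (1 + q\<^sup>2) * \<mu>) * (?R ?Z \<circ> repP (b\<^sub>P \<otimes>\<^bsub>P\<^esub> a\<^sub>P)) w z
     + (?R ?X \<circ> repP (a\<^sub>P \<otimes>\<^bsub>P\<^esub> a\<^sub>P)) w z
     + cr (q * \<tau>) * (?R \<one>\<^bsub>A\<^esub> \<circ> repP (b\<^sub>P \<otimes>\<^bsub>P\<^esub> a\<^sub>P)) w z"
  have "acts \<alpha> \<beta> (gamma_X q \<mu> \<nu> \<tau>) ?S"
    unfolding gamma_X_def Let_def B_alg_fields
    by (intro acts_add[OF wt] acts_smult[OF wt] acts_pure[OF wt] B_gens_closed B_closed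
      P.m_closed P.star_closed P.minus_closed P.smult_closed P.one_closed P_gen_closed)
  moreover have "?S (intertwiner \<alpha> w) = intertwiner \<alpha> (?R ?X w)" for w
  proof -
    note P_simps = oprep_mult[OF oprep_repP] oprep_smult[OF oprep_repP] oprep_one[OF oprep_repP]
      P.oprep_minus[OF oprep_repP] oprep_one[OF oprep_rep[OF wt]]
    have "?S (intertwiner \<alpha> w) (i, n) = intertwiner \<alpha> (?R ?X w) (i, n)" for i n
    proof (cases i)
      case True
      define Y where "Y = cr q powi n"
      have Y: "Y \<noteq> 0" "cr q powi (n + 1) = cr q * Y" by (auto simp: Y_def power_int_add)
      have "x_coeff * cr (sqrt q) * (cr q * cr q * (\<alpha> n * \<beta> (n + 1)) - \<alpha> (n - 1) * \<beta> n) =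
          - (cr q * (cr \<tau> - (1 + cr q * cr q) * cr \<mu> * Y\<^sup>2))"
        using casimir_weight_shift[of n] wt[unfolded weights_def, rule_format, of n]
          wt[unfolded weights_def, rule_format, of "n + 1"] by (simp add: Y_def)
      then have key: "x_coeff * cr (sqrt q) * (cr q * cr q * (\<alpha> n * \<beta> (n + 1))) -
          cr q * (1 + (cr q)\<^sup>2) * cr \<mu> * Y\<^sup>2 + cr q * cr \<tau> = x_coeff * cr (sqrt q) * (\<alpha> (n - 1) * \<beta> n)"
        by (simp add: algebra_simps power2_eq_square)
      \<comment> \<open>Here \<open>u\<close> stands for \<open>w (True, n + 1)\<close> and
        \<open>v\<close> for \<open>w (False, n)\<close>. The identity isolates the coefficient of
        \<open>v\<close> in exactly the form of the left side of \<open>key\<close>.\<close>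
      have eq: "x * (b * (Q * Y * (Q * (Q * (inverse ((Q * Y)\<^sup>2) * u + s * inverse (Q * Y) * a * v)))))
          - Q * (1 + Q\<^sup>2) * m * (Y * (Y * v)) + Q * t * v =
          inverse (Y\<^sup>2) * (x * (b * (Q * Y * u))) +
            (x * s * (Q * Q * (a * b)) - Q * (1 + Q\<^sup>2) * m * Y\<^sup>2 + Q * t) * v"
        if "Q \<noteq> 0" for x b Q u s a v m t :: complex
        using that Y(1) by (simp add: field_simps power2_eq_square)
      show ?thesis
        using True
        by (simp add: P_simps repP_gens rep_gens[OF wt] intertwiner_def twist_def)
          (simp only: Y(2) Y_def[symmetric], subst eq, simp, subst key, simp add: Y(1))
    next
      case False
      then show ?thesis
        by (simp add: P_simps repP_gens rep_gens[OF wt] intertwiner_def)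
    qed
    then show ?thesis by (simp only: fun_eq_iff split_paired_all) simp
  qed
  ultimately show ?thesis by blast
qed

text \<open>Every summand except the third contains the adjoint of \<open>b\<close> or of
  \<open>b a\<close>, which acts as zero. What is left is diagonal with entries X'/q^2 and X', where
  X' is the adjoint of X, so the claim is that X' commutes with Q and with e up to the factor
  q^2.\<close>

lemma acts_star_gamma_X:
  assumes wt: "weights \<alpha> \<beta>"
  shows "\<exists>S. acts \<alpha> \<beta> (star T (gamma_X q \<mu> \<nu> \<tau>)) S \<and>
    (\<forall>w. S (intertwiner \<alpha> w) = intertwiner \<alpha> (rep \<alpha> \<beta> (star A (B_X q \<mu> \<nu> \<tau>)) w))"
proof -
  let ?R = "rep \<alpha> \<beta>" and ?X = "B_X q \<mu> \<nu> \<tau>" and ?Z = "B_Z q \<mu> \<nu> \<tau>"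
  let ?S = "\<lambda>w z. cnj (cr (- q * \<mu>)) * (?R (star A (star A ?X)) \<circ> repP (star P (b\<^sub>P \<otimes>\<^bsub>P\<^esub> b\<^sub>P))) w z
     + cnj (cr (- q * (1 + q\<^sup>2) * \<mu>)) * (?R (star A ?Z) \<circ> repP (star P (b\<^sub>P \<otimes>\<^bsub>P\<^esub> a\<^sub>P))) w z
     + (?R (star A ?X) \<circ> repP (star P (a\<^sub>P \<otimes>\<^bsub>P\<^esub> a\<^sub>P))) w z
     + cnj (cr (q * \<tau>)) * (?R (star A \<one>\<^bsub>A\<^esub>) \<circ> repP (star P (b\<^sub>P \<otimes>\<^bsub>P\<^esub> a\<^sub>P))) w z"
  have "star_acts \<alpha> \<beta> (gamma_X q \<mu> \<nu> \<tau>) ?S"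
    unfolding gamma_X_def Let_def B_alg_fields
    by (intro star_acts_add[OF wt] star_acts_smult[OF wt] star_acts_pure[OF wt] B_gens_closed B_closed
      P.m_closed P.star_closed P.minus_closed P.smult_closed P.one_closed P_gen_closed)
  then have "acts \<alpha> \<beta> (star T (gamma_X q \<mu> \<nu> \<tau>)) ?S" by (rule acts_star[OF wt])
  moreover have "?S (intertwiner \<alpha> w) = intertwiner \<alpha> (?R (star A ?X) w)" for w
  proof -
    have sZ: "star A ?Z = ?Z" by (simp add: B_Z_eq star_W)
    have X: "?X \<in> carrier A" using B_gens_closed in_A by blast
    have zero: "?R x (\<lambda>z. 0) = (\<lambda>z. 0)" if "x \<in> carrier A" for x
      by (rule linop_zero[OF oprep_linop[OF oprep_rep[OF wt] that]])
    have b0: "repP (star P b\<^sub>P) = (\<lambda>w z. 0)" by (auto simp: fun_eq_iff repP_gens)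
    have a0: "repP (star P a\<^sub>P) (\<lambda>z. 0) = (\<lambda>z. 0)"
      by (auto simp: fun_eq_iff repP_gens)
    note P_simps = oprep_mult[OF oprep_repP] P.star_mult oprep_one[OF oprep_rep[OF wt]]
    have "?S (intertwiner \<alpha> w) (i, n) = intertwiner \<alpha> (?R (star A ?X) w) (i, n)" for i n
    proof (cases i)
      case True
      then show ?thesis
        by (simp add: power_int_diff P_simps b0 a0 zero X in_A[OF B_gens_closed(2)] sZ star_W
            repP_gens rep_gens[OF wt] intertwiner_def twist_def power2_eq_square field_simps)
    next
      case False
      then show ?thesis
        by (simp add: P_simps b0 a0 zero X in_A[OF B_gens_closed(2)] sZ star_W
            repP_gens rep_gens[OF wt] intertwiner_def)
    qed
    then show ?thesis by (simp only: fun_eq_iff split_paired_all) simp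
  qed
  ultimately show ?thesis by blast
qed

section \<open>Intertwining on all of B and ergodicity\<close>

lemma null_zero: "0 \<in> N\<^sub>T"
proof -
  interpret vs: vector_space "scale :: complex \<Rightarrow>
      tensor_coeffs \<Rightarrow> _"
    by (rule vector_space_scale)
  show ?thesis unfolding tensor_null_def by (rule vs.span_zero)
qed

lemma one_T: "\<one>\<^bsub>T\<^esub> = pure_tensor B P \<one>\<^bsub>A\<^esub> \<one>\<^bsub>P\<^esub>"
  by (simp add: tensor_def quotient_algebra_def FactRing_def pure_tensor_def tensor_free_def
    monoid_algebra_def DirProd_def)

lemma linop_intertwiner: "linop (intertwiner \<alpha>)"
  by (auto simp: linop_def intertwiner_def algebra_simps)

lemma smult_zero: "x \<in> carrier A \<Longrightarrow> 0 \<odot>\<^bsub>A\<^esub> x = \<zero>\<^bsub>A\<^esub>"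
proof -
  assume "x \<in> carrier A"
  then obtain u where u: "x = pr u" by (auto simp: carrier_A)
  have "scale 0 u = 0" by (rule lin_eqI) simp
  then show ?thesis using pr_scale[of 0 u] by (simp add: u pr_zero)
qed

text \<open>The elements whose coaction is intertwined by G are closed under the algebra operations,
  because \<gamma> and R are homomorphisms and \<open>acts\<close> follows the operations of the
  tensor product. Intertwining thus spreads from the generators to B, and for an invariant x it
  becomes commutation with G.\<close>

lemma ergodic_coaction_B:
  assumes co: "right_coaction B P (Polq_comult q \<mu>) Polq_counit \<gamma>"
    and \<gamma>X: "\<gamma> (B_X q \<mu> \<nu> \<tau>) = gamma_X q \<mu> \<nu> \<tau>"
    and \<gamma>Z: "\<gamma> (B_Z q \<mu> \<nu> \<tau>) = gamma_Z q \<mu> \<nu> \<tau>"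
  shows "ergodic_coaction B P \<gamma>"
proof -
  have hom: "star_alg_hom B T \<gamma>" using co by (simp add: right_coaction_def)
  then have ring_hom: "\<gamma> \<in> ring_hom B T" by (simp add: star_alg_hom_def)
  have \<gamma>_add: "\<gamma> (x \<oplus>\<^bsub>A\<^esub> y) = \<gamma> x \<oplus>\<^bsub>T\<^esub> \<gamma> y" if "x \<in> carrier B" "y \<in> carrier B" for x y
    using ring_hom_add[OF ring_hom that] by simp
  have \<gamma>_mult: "\<gamma> (x \<otimes>\<^bsub>A\<^esub> y) = \<gamma> x \<otimes>\<^bsub>T\<^esub> \<gamma> y" if "x \<in> carrier B" "y \<in> carrier B" for x y
    using ring_hom_mult[OF ring_hom that] by simp
  have \<gamma>_one: "\<gamma> \<one>\<^bsub>A\<^esub> = \<one>\<^bsub>T\<^esub>"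
    using ring_hom_one[OF ring_hom] by simp
  have \<gamma>_smult: "\<gamma> (c \<odot>\<^bsub>A\<^esub> x) = c \<odot>\<^bsub>T\<^esub> \<gamma> x" and \<gamma>_star: "\<gamma> (star A x) = star T (\<gamma> x)"
    if "x \<in> carrier B" for c x
    using hom that by (simp_all add: star_alg_hom_def)
  define intertwined where "intertwined \<alpha> \<beta> x \<longleftrightarrow> (\<exists>S. acts \<alpha> \<beta> (\<gamma> x) S \<and>
      (\<forall>w. S (intertwiner \<alpha> w) = intertwiner \<alpha> (rep \<alpha> \<beta> x w)))" for \<alpha> \<beta> x
  have all: "intertwined \<alpha> \<beta> x" if wt: "weights \<alpha> \<beta>" and x: "x \<in> carrier B" for \<alpha> \<beta> x
  proof -
    note R = oprep_rep[OF wt]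
    note G = linop_add[OF linop_intertwiner] linop_mult[OF linop_intertwiner]
    let ?I = "intertwined \<alpha> \<beta>"
    have add: "?I (x \<oplus>\<^bsub>A\<^esub> y)" if asm: "?I x" "?I y" "x \<in> carrier B" "y \<in> carrier B" for x y
    proof -
      obtain S S' where "acts \<alpha> \<beta> (\<gamma> x) S" "acts \<alpha> \<beta> (\<gamma> y) S'"
        "\<And>w. S (intertwiner \<alpha> w) = intertwiner \<alpha> (rep \<alpha> \<beta> x w)"
        "\<And>w. S' (intertwiner \<alpha> w) = intertwiner \<alpha> (rep \<alpha> \<beta> y w)"
        using asm(1,2) unfolding intertwined_def by blast
      with acts_add[OF wt, of "\<gamma> x" S "\<gamma> y" S'] asm(3,4) show ?thesis
        unfolding intertwined_def by (intro exI[of _ "\<lambda>w z. S w z + S' w z"])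
          (simp add: \<gamma>_add oprep_add[OF R] in_A G)
    qed
    have mult: "?I (x \<otimes>\<^bsub>A\<^esub> y)" if asm: "?I x" "?I y" "x \<in> carrier B" "y \<in> carrier B" for x y
    proof -
      obtain S S' where "acts \<alpha> \<beta> (\<gamma> x) S" "acts \<alpha> \<beta> (\<gamma> y) S'"
        "\<And>w. S (intertwiner \<alpha> w) = intertwiner \<alpha> (rep \<alpha> \<beta> x w)"
        "\<And>w. S' (intertwiner \<alpha> w) = intertwiner \<alpha> (rep \<alpha> \<beta> y w)"
        using asm(1,2) unfolding intertwined_def by blast
      with acts_mult[OF wt, of "\<gamma> x" S "\<gamma> y" S'] asm(3,4) show ?thesis
        unfolding intertwined_def by (intro exI[of _ "S \<circ> S'"])
          (simp add: \<gamma>_mult oprep_mult[OF R] in_A)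
    qed
    have smult: "?I (c \<odot>\<^bsub>A\<^esub> x)" if asm: "?I x" "x \<in> carrier B" for c x
    proof -
      obtain S where "acts \<alpha> \<beta> (\<gamma> x) S"
        "\<And>w. S (intertwiner \<alpha> w) = intertwiner \<alpha> (rep \<alpha> \<beta> x w)"
        using asm(1) unfolding intertwined_def by blast
      with acts_smult[OF wt, of "\<gamma> x" S c] asm(2) show ?thesis
        unfolding intertwined_def by (intro exI[of _ "\<lambda>w z. c * S w z"])
          (simp add: \<gamma>_smult oprep_smult[OF R] in_A G)
    qed
    have one: "?I \<one>\<^bsub>A\<^esub>"
      using acts_pure[OF wt B_closed(1) P.one_closed] unfolding intertwined_def \<gamma>_one one_T
      by (intro exI[of _ "rep \<alpha> \<beta> \<one>\<^bsub>A\<^esub> \<circ> repP \<one>\<^bsub>P\<^esub>"]) (simp add: oprep_one[OF R] oprep_one[OF oprep_repP])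
    have zero: "?I \<zero>\<^bsub>A\<^esub>"
      using smult[OF one B_closed(1), of 0] by (simp add: smult_zero)
    let ?X = "B_X q \<mu> \<nu> \<tau>"
    have x_coeff: "x_coeff \<noteq> 0"
      using q_pos q_less one_less_inverse[of q] by (simp add: x_coeff_def flip: of_real_diff of_real_inverse)
    have Z: "?I (W [UK, UK])"
      using acts_gamma_Z[OF wt] unfolding intertwined_def \<gamma>Z[symmetric] by (simp only: B_Z_eq)
    have X: "?I ?X" using acts_gamma_X[OF wt] unfolding intertwined_def \<gamma>X .
    have X': "?I (star A ?X)"
      using acts_star_gamma_X[OF wt] unfolding intertwined_def \<gamma>_star[OF B_gens_closed(1)] \<gamma>X .
    \<comment> \<open>\<open>x_coeff\<close> is nonzero, so dividing by it passes from X and its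
      adjoint to the unscaled products FK and KE.\<close>
    have FK: "?I (W [UF, UK])" and KE: "?I (W [UK, UE])"
      using smult[OF X B_gens_closed(1), of "inverse x_coeff"]
        smult[OF X' B_gens_closed(3), of "inverse x_coeff"] x_coeff
      by (simp_all add: star_B_X) (simp_all add: B_X_eq A.smult_smult)
    \<comment> \<open>Intertwining of x says nothing about its adjoint, since G and \<rho> do not
      respect the star. Requiring both makes the set stable under the star.\<close>
    let ?S = "{x \<in> carrier B. ?I x \<and> ?I (star A x)}"
    have "star_subalgebra ?S A"
      unfolding star_subalgebra_def
      using add mult smult one zero B_closed star_subalgebra_B[unfolded star_subalgebra_def]
      by (auto simp: in_A A.star_add A.star_mult A.star_smult star_W)
    moreover have "W [UK, UK] \<in> ?S" "W [UK, UE] \<in> ?S"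
      using W_in_B Z KE FK by (simp_all add: star_W)
    ultimately have "carrier B \<subseteq> ?S" by (rule B_induct)
    then show ?thesis using x by blast
  qed
  show ?thesis
    unfolding ergodic_coaction_def B_alg_fields
  proof (intro ballI impI)
    fix x assume x: "x \<in> carrier B" and inv: "\<gamma> x = pure_tensor B P x \<one>\<^bsub>P\<^esub>"
    show "\<exists>c. x = c \<odot>\<^bsub>A\<^esub> \<one>\<^bsub>A\<^esub>"
    proof (rule commutant_scalar[OF in_A[OF x]])
      fix \<alpha> \<beta> w assume wt: "weights \<alpha> \<beta>"
      obtain S where S: "acts \<alpha> \<beta> (\<gamma> x) S" "\<And>w. S (intertwiner \<alpha> w) = intertwiner \<alpha> (rep \<alpha> \<beta> x w)"
        using all[OF wt x] unfolding intertwined_def by blast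
      have "acts \<alpha> \<beta> (\<gamma> x) (rep \<alpha> \<beta> x \<circ> repP \<one>\<^bsub>P\<^esub>)"
        unfolding inv by (rule acts_pure[OF wt x P.one_closed])
      \<comment> \<open>Two operators attached to the same class agree only if the class has an
        element; the defining representative of the pure tensor supplies one.\<close>
      moreover obtain f where "f \<in> \<gamma> x"
      proof -
        have "Poly_Mapping.single (x, \<one>\<^bsub>P\<^esub>) 1 \<in> \<gamma> x"
          using null_zero unfolding inv pure_tensor_def a_r_coset_def' by force
        then show ?thesis by (rule that)
      qed
      ultimately have "S = rep \<alpha> \<beta> x \<circ> repP \<one>\<^bsub>P\<^esub>"
        using S(1) unfolding acts_def by metis
      then show "rep \<alpha> \<beta> x (intertwiner \<alpha> w) = intertwiner \<alpha> (rep \<alpha> \<beta> x w)"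
        using S(2)[of w] by (simp add: oprep_one[OF oprep_repP])
    qed
  qed
qed

end

theorem proposition2p11:
  fixes q \<mu> \<nu> \<tau> :: real
    and \<gamma> :: "(U_gen list \<Rightarrow>\<^sub>0 complex) set set
      \<Rightarrow> ((U_gen list \<Rightarrow>\<^sub>0 complex) set set \<times> (P_gen list \<Rightarrow>\<^sub>0 complex) set \<Rightarrow>\<^sub>0 complex) set"
  assumes "0 < q" and "q < 1"
    and "\<mu> \<in> {-1, 0, 1}" and "\<nu> \<in> {-1, 0, 1}"
    and "right_coaction (B_alg q \<mu> \<nu> \<tau>) (Polq q \<mu>) (Polq_comult q \<mu>) Polq_counit \<gamma>"
    and "\<gamma> (B_X q \<mu> \<nu> \<tau>) = gamma_X q \<mu> \<nu> \<tau>"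
    and "\<gamma> (B_Z q \<mu> \<nu> \<tau>) = gamma_Z q \<mu> \<nu> \<tau>"
  shows "ergodic_coaction (B_alg q \<mu> \<nu> \<tau>) (Polq q \<mu>) \<gamma>"
proof -
  interpret podles q \<mu> \<nu> \<tau>
    using assms by unfold_locales
  show ?thesis by (rule ergodic_coaction_B) (use assms in auto)
qed

end
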